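(* Let $k$ be a positive integer and $s\in\{1,k,k+1\}$. Then \[ \sum_{\substack{n_1,\dots,n_k\geq 0 \\ m_1,\dots,m_{k-1}\geq 0}} \frac{q^{n_k^2+\sum_{i=s}^k n_i}}{(q)_{n_1}} \prod_{i=1}^{k-1} q^{n_i^2-n_im_i+m_i^2+m_i} {n_i \brack n_{i+1}} {n_i-n_{i+1}+m_{i+1} \brack m_i} =\frac{(q^{3k+2};q^{3k+2})_{\infty}^2}{(q;q)_{\infty}^2}\, \theta(q,q^s,q^{s+1};q^{3k+2}), \] where $m_k:=2n_k$.
   Context: Identities are between formal power series in $q$. For $n\in\mathbb{Z}$, $(a)_n=(a;q)_n:=(a;q)_\infty/(aq^n;q)_\infty$ with $(a;q)_\infty=\prod_{i\geq0}(1-aq^i)$; in particular $1/(q)_n=0$ for $n<0$. $\theta(a;q):=(a;q)_\infty(q/a;q)_\infty$ and $\theta(a_1,\dots,a_j;q):=\theta(a_1;q)\cdots\theta(a_j;q)$. For $n,m\in\mathbb{Z}$, ${n\brack m}=\frac{(q)_n}{(q)_m(q)_{n-m}}$ if $0\leq m\leq n$ and $0$ otherwise. Empty sums are $0$ (e.g. $\sum_{i=k+1}^k n_i=0$) and empty products are $1$. *)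

theory Defs
  imports "HOL-Analysis.Analysis" "HOL-Computational_Algebra.Formal_Power_Series"
begin

text \<open>
  Identities live in \<open>rat fps\<close>, with \<^const>\<open>fps_X\<close> in the role of the variable \<open>q\<close> and with the
  library's \<open>X\<close>-adic metric on power series as the notion of convergence. The base of a Pochhammer
  symbol is a parameter, because both \<open>q\<close> and \<open>q\<^sup>3\<^sup>k\<^sup>+\<^sup>2\<close> occur as bases.
\<close>

definition qpoch_inf :: "rat fps \<Rightarrow> rat fps \<Rightarrow> rat fps" where
  "qpoch_inf a q = (\<Prod>i. 1 - a * q ^ i)"

text \<open>
  Only indices \<open>n \<ge> 0\<close> are covered: for \<open>n < 0\<close> the element \<open>a q\<^sup>n\<close> need not be a power series.
\<close>

definition qpoch :: "rat fps \<Rightarrow> rat fps \<Rightarrow> nat \<Rightarrow> rat fps" where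
  "qpoch a q n = qpoch_inf a q / qpoch_inf (a * q ^ n) q"

abbreviation qfac :: "nat \<Rightarrow> rat fps" where
  "qfac n \<equiv> qpoch fps_X fps_X n"

definition qbinom :: "int \<Rightarrow> int \<Rightarrow> rat fps" where
  "qbinom n m =
     (if 0 \<le> m \<and> m \<le> n then qfac (nat n) / (qfac (nat m) * qfac (nat (n - m))) else 0)"

text \<open>
  The quotient \<open>q / a\<close> below is the true quotient only if \<open>a\<close> divides \<open>q\<close> in \<open>rat fps\<close>;
  otherwise division of power series truncates.
\<close>

definition qtheta :: "rat fps \<Rightarrow> rat fps \<Rightarrow> rat fps" where
  "qtheta a q = qpoch_inf a q * qpoch_inf (q / a) q"

definition qthetas :: "rat fps list \<Rightarrow> rat fps \<Rightarrow> rat fps" where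
  "qthetas as q = (\<Prod>a\<leftarrow>as. qtheta a q)"

text \<open>
  The exponent \<open>n\<^sup>2 - n m + m\<^sup>2 + m\<close> is computed in the integers, since subtraction on \<^typ>\<open>nat\<close>
  truncates; it is never negative, so that \<^const>\<open>nat\<close> is harmless.
\<close>

definition qexponent :: "nat \<Rightarrow> nat \<Rightarrow> nat" where
  "qexponent n m = nat ((int n)\<^sup>2 - int n * int m + (int m)\<^sup>2 + int m)"

lemma int_qexponent: "int (qexponent n m) = (int n)\<^sup>2 - int n * int m + (int m)\<^sup>2 + int m"
proof -
  have "2 * (int n * int m) \<le> (int n)\<^sup>2 + (int m)\<^sup>2"
    using zero_le_power2[of "int n - int m"] by (simp add: power2_diff)
  moreover have "0 \<le> int n * int m"
    by simp
  ultimately have "0 \<le> (int n)\<^sup>2 - int n * int m + (int m)\<^sup>2 + int m"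
    by linarith
  then show ?thesis
    by (simp add: qexponent_def)
qed

text \<open>
  The summand for index families \<open>n\<close> on \<open>{1..k}\<close> and \<open>m\<close> on \<open>{1..k - 1}\<close>; the local \<open>m'\<close> extends
  \<open>m\<close> by \<open>m\<^sub>k = 2 n\<^sub>k\<close>.
\<close>

definition summand :: "nat \<Rightarrow> nat \<Rightarrow> (nat \<Rightarrow> nat) \<Rightarrow> (nat \<Rightarrow> nat) \<Rightarrow> rat fps" where
  "summand k s n m =
     (let m' = m(k := 2 * n k) in
        fps_X ^ ((n k)\<^sup>2 + (\<Sum>i=s..k. n i)) / qfac (n 1) *
        (\<Prod>i=1..k-1.
           fps_X ^ qexponent (n i) (m' i) *
           qbinom (int (n i)) (int (n (i + 1))) *
           qbinom (int (n i) - int (n (i + 1)) + int (m' (i + 1))) (int (m' i))))"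

end

theory Submission
  imports Defs "HOL-Computational_Algebra.Formal_Laurent_Series"
begin

text \<open>
  For fixed \<open>n\<^sub>i\<close>, a Heine-type transformation applied level by level turns the sums over the \<open>m\<^sub>i\<close> into
  sums with the denominators \<open>(q)\<close> of \<open>n\<^sub>i - n\<^sub>i\<^sub>+\<^sub>1\<close> and \<open>m\<^sub>i - m\<^sub>i\<^sub>+\<^sub>1\<close>, that is, into \<open>k\<close> steps of the
  A2 Bailey chain started at \<open>q\<^sup>2\<^sup>n\<^sup>m / ((q)\<^sub>n (q)\<^sub>m (q)\<^sub>n\<^sub>+\<^sub>m\<^sub>+\<^sub>1)\<close>, up to a factor \<open>q\<^sup>n\<close> if \<open>s = k\<close>. The kernel
  \<open>(q)\<^sub>n\<^sub>+\<^sub>m\<^sub>+\<^sub>c / \<Prod>\<^sub>i (q) (n - x\<^sub>i) (q) (m + c + x\<^sub>i)\<close>, the coefficient of a \<open>q\<close>-Toda eigenfunction for sl3, is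
  reproduced by such a step up to a power of \<open>q\<close>: writing \<open>q\<^sup>-\<^sup>n\<^sup>m\<close> times the kernel as a \<open>q\<close>-Vandermonde
  sum decouples the sums over \<open>n\<close> and \<open>m\<close>. It remains to expand the starting point in kernels. This is
  a statement about an alternating form on triples of vectors of \<open>q\<close>-binomial coefficients; the two
  Pascal rules, alternation and invariance under affine translations give recurrences in \<open>n + m\<close>
  that determine the values needed. As the outer bounds of the chain tend to infinity, the kernels
  become constant and the right-hand side becomes the sum side of Macdonald's identity of type A2,
  whose product side follows from three Jacobi triple products and the pentagonal number theorem.
\<close>

subsection \<open>Finite q-Vandermonde sums\<close>

text \<open>Why these \<open>s\<close> and this modulus. A kernel of shift r with parameters x, y, z
  is reproduced by a step with linear exponent -(x+y+z+r) n + (2r+x+y+z) m. The chain steps carry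
  \<open>\<epsilon>\<close> n + m, where \<open>\<epsilon>\<close> is 1 on the levels i >= s and 0
  otherwise; this forces r = 1 + \<open>\<epsilon>\<close> and x+y+z = - r -
  \<open>\<epsilon>\<close>. One kernel serves the whole chain only if \<open>\<epsilon>\<close> is
  the same on all levels below k: s = 1 gives r = 2, while s = k and s = k + 1 give r = 1 and differ
  only on level k, which the starting point absorbs. The sums of the chain start at 0, and
  reproduction needs the kernel to live there. This fails for the zero triple; the alternating
  weight removes it, and every other zero-sum triple has a positive and a negative entry. In the
  coordinates A, B of Macdonald's identity, let Q be its quadratic form, (A^2 + B^2 - A B - A - B) /
  3. The weight contributes q^(2 Q) and each of the k steps q^(3 Q) times a linear power, whence 3 k
  + 2.\<close>

locale qfield =
  fixes q :: "'a :: field_char_0"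
  assumes q_nonzero: "q \<noteq> 0" and q_power_neq_1: "n > 0 \<Longrightarrow> q ^ n \<noteq> 1"
begin

text \<open>Exponents such as \<open>- (u * v)\<close> may be negative, so the finite identities are
  proved in a field. It is later specialised to rational Laurent series, with \<open>fls_X\<close>
  as q for the chain and \<open>fls_X ^ K\<close> for the triple product.\<close>

definition qe :: "int \<Rightarrow> 'a" where "qe e = q powi e"

lemma qe_add: "qe (a + b) = qe a * qe b"
  by (simp add: qe_def power_int_add q_nonzero)

lemma qe_0 [simp]: "qe 0 = 1"
  by (simp add: qe_def)

lemma qe_nonzero [simp]: "qe a \<noteq> 0"
  by (simp add: qe_def q_nonzero)

lemma qe_of_nat: "qe (int n) = q ^ n"
  by (simp add: qe_def)

lemma qe_neq_1: "n > 0 \<Longrightarrow> qe n \<noteq> 1"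
  using q_power_neq_1[of "nat n"] qe_of_nat[of "nat n"] by simp

definition qp :: "int \<Rightarrow> 'a" where "qp n = (\<Prod>i<nat n. 1 - q ^ Suc i)"

text \<open>The value 0 at negative arguments makes \<open>ri_pred\<close> hold at every integer, so
  that sums may be extended freely and Pascal rules need no boundary cases. The default value 1 of
  \<open>qp\<close> at negative arguments does no harm in \<open>qb\<close> and \<open>psi\<close>:
  some \<open>ri\<close> factor vanishes then.\<close>

definition ri :: "int \<Rightarrow> 'a" where "ri n = (if n < 0 then 0 else inverse (qp n))"

lemma qp_0 [simp]: "qp 0 = 1"
  by (simp add: qp_def)

lemma ri_0 [simp]: "ri 0 = 1"
  by (simp add: ri_def)

lemma ri_neg [simp]: "n < 0 \<Longrightarrow> ri n = 0"
  by (simp add: ri_def)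

lemma qp_nonzero [simp]: "qp n \<noteq> 0"
  unfolding qp_def using q_power_neq_1[OF zero_less_Suc] by (simp del: power_Suc)

lemma qp_Suc: "n \<ge> 0 \<Longrightarrow> qp (n + 1) = (1 - qe (n + 1)) * qp n"
  using qe_of_nat[of "Suc (nat n)"] by (simp add: qp_def nat_add_distrib add.commute)

lemma qp_ri: "n \<ge> 0 \<Longrightarrow> qp n * ri n = 1"
  by (simp add: ri_def)

lemma ri_pred: "ri (n - 1) = (1 - qe n) * ri n"
proof -
  consider "n < 0" | "n = 0" | "n > 0"
    by linarith
  then show ?thesis
  proof cases
    case 3
    then have "qp n = (1 - qe n) * qp (n - 1)"
      using qp_Suc[of "n - 1"] by simp
    moreover have "1 - qe n \<noteq> 0"
      using qe_neq_1[OF 3] by simp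
    ultimately show ?thesis
      using 3 by (simp add: ri_def)
  qed auto
qed

lemma ri_Suc: "ri n = (1 - qe (n + 1)) * ri (n + 1)"
  using ri_pred[of "n + 1"] by simp

text \<open>Splits 1 - q^a as (1 - q^(a-i)) + q^(a-i) (1 - q^i); \<open>ri_pascal2\<close> exchanges
  i and a - i. With the numerator (q)_a cancelled, the Pascal rules hold for all integers.\<close>

lemma ri_pascal1:
  "(1 - qe a) * (ri (a - i) * ri i) = ri (a - 1 - i) * ri i + qe (a - i) * (ri (a - i) * ri (i - 1))"
proof -
  have 1: "ri (a - 1 - i) = (1 - qe (a - i)) * ri (a - i)"
    using ri_pred[of "a - i"] by (simp add: algebra_simps)
  have 2: "qe a = qe (a - i) * qe i"
    by (simp add: qe_add[symmetric])
  show ?thesis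
    unfolding 1 2 ri_pred[of i] by (simp add: algebra_simps)
qed

lemma ri_pascal2:
  "(1 - qe a) * (ri (a - i) * ri i) = ri (a - i) * ri (i - 1) + qe i * (ri (a - 1 - i) * ri i)"
proof -
  have 1: "ri (a - 1 - i) = (1 - qe (a - i)) * ri (a - i)"
    using ri_pred[of "a - i"] by (simp add: algebra_simps)
  have 2: "qe a = qe (a - i) * qe i"
    by (simp add: qe_add[symmetric])
  show ?thesis
    unfolding 1 2 ri_pred[of i] by (simp add: algebra_simps)
qed

lemma ri_pascal1_Suc:
  "(1 - qe (int (Suc A))) * (ri (int (Suc A) - i) * ri i) =
     ri (int A - i) * ri i + qe (int (Suc A) - i) * (ri (int (Suc A) - i) * ri (i - 1))"
  using ri_pascal1[of "int (Suc A)" i] by simp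

lemma ri_pascal2_Suc:
  "(1 - qe (int (Suc A))) * (ri (int (Suc A) - i) * ri i) =
     ri (int (Suc A) - i) * ri (i - 1) + qe i * (ri (int A - i) * ri i)"
  using ri_pascal2[of "int (Suc A)" i] by simp

lemma ri_int_Suc: "ri (int A) = (1 - qe (int (Suc A))) * ri (int (Suc A))"
  using ri_Suc[of "int A"] by (simp add: add.commute)

lemma ri_int_Suc_add: "ri (int A + p) = (1 - qe (int (Suc A) + p)) * ri (int (Suc A) + p)"
  using ri_Suc[of "int A + p"] by (simp add: add_ac)

lemma distrib_inner: "c * r = t + u \<Longrightarrow> c * (x * r * y) = x * t * y + x * u * (y :: 'a)"
proof -
  assume "c * r = t + u"
  then have "c * (x * r * y) = x * (t + u) * y"
    by (simp only: mult_ac flip: \<open>c * r = t + u\<close>)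
  then show ?thesis
    by (simp add: algebra_simps)
qed

lemma distrib_inner2: "c * r = t + u \<Longrightarrow> c * (x * r * y * z) = x * t * y * z + x * u * y * (z :: 'a)"
  using distrib_inner[of c r t u x "y * z"] by (simp add: mult.assoc)

text \<open>The limit of \<open>vandermonde_nat\<close> for B to infinity. Induction on
  \<open>A\<close> with \<open>p\<close> free: the first Pascal rule splits the sum into the sums
  for \<open>p\<close> and for \<open>p + 1\<close> at the smaller \<open>A\<close>.\<close>

lemma vandermonde_limit_nat:
  "(\<Sum>i\<le>A. qe (int i * (int i + p)) * (ri (int A - int i) * ri (int i)) * ri (int i + p))
    = ri (int A) * ri (int A + p)"
proof (induction A arbitrary: p)
  case (Suc A)
  define h where "h A p = (\<Sum>i\<le>A. qe (int i * (int i + p)) * (ri (int A - int i) * ri (int i)) * ri (int i + p))"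
    for A p
  have IH: "h A p = ri (int A) * ri (int A + p)" for p
    unfolding h_def by (rule Suc.IH)
  have "(1 - qe (int (Suc A))) * h (Suc A) p =
      (\<Sum>i\<le>Suc A. qe (int i * (int i + p)) * (ri (int A - int i) * ri (int i)) * ri (int i + p)) +
      (\<Sum>i\<le>Suc A. qe (int i * (int i + p)) * (qe (int (Suc A) - int i) * (ri (int (Suc A) - int i) * ri (int i - 1))) * ri (int i + p))"
    unfolding h_def sum_distrib_left sum.distrib[symmetric]
    by (intro sum.cong refl distrib_inner ri_pascal1_Suc)
  also have "(\<Sum>i\<le>Suc A. qe (int i * (int i + p)) * (ri (int A - int i) * ri (int i)) * ri (int i + p)) = h A p"
    by (simp add: h_def)
  also have "(\<Sum>i\<le>Suc A. qe (int i * (int i + p)) * (qe (int (Suc A) - int i) * (ri (int (Suc A) - int i) * ri (int i - 1))) * ri (int i + p))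
     = qe (int (Suc A) + p) * h A (p + 1)"
    unfolding h_def sum_distrib_left
  proof (subst sum.atMost_Suc_shift, simp, intro sum.cong refl)
    fix i
    have "qe ((1 + int i) * (1 + int i + p)) * qe (int A - int i) = qe (1 + int A + p) * qe (int i * (int i + (p + 1)))"
      by (simp add: qe_add[symmetric] algebra_simps)
    then show "qe ((1 + int i) * (1 + int i + p)) * (qe (int A - int i) * (ri (int A - int i) * ri (int i))) * ri (1 + int i + p) =
         qe (1 + int A + p) * (qe (int i * (int i + (p + 1))) * (ri (int A - int i) * ri (int i)) * ri (int i + (p + 1)))"
      by (simp add: algebra_simps)
  qed
  finally have "(1 - qe (int (Suc A))) * h (Suc A) p = h A p + qe (int (Suc A) + p) * h A (p + 1)" .
  also have "\<dots> = ri (int A) * ri (int A + p) + qe (int (Suc A) + p) * (ri (int A) * ri (int (Suc A) + p))"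
    by (simp add: IH algebra_simps)
  also have "\<dots> = (1 - qe (int (Suc A))) * (ri (int (Suc A)) * ri (int (Suc A) + p))"
    unfolding ri_int_Suc[of A] ri_int_Suc_add[of A p] by (simp add: algebra_simps)
  finally show ?case
    using qe_neq_1[of "int (Suc A)"] by (simp add: h_def)
qed simp

lemma vandermonde_nat:
  "(\<Sum>j\<le>A. qe (int j * (int j + p)) * (ri (int A - int j) * ri (int j)) * ri (B - int j) * ri (int j + p))
    = qp (int A + B + p) * ri (int A) * ri B * ri (int A + p) * ri (B + p)"
proof (induction A arbitrary: B p)
  case 0
  show ?case
    using qp_ri[of "B + p"] by (cases "B + p < 0"; cases "B < 0") auto
next
  case (Suc A)
  define h where "h A B p = (\<Sum>j\<le>A. qe (int j * (int j + p)) * (ri (int A - int j) * ri (int j)) * ri (B - int j) * ri (int j + p))"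
    for A B p
  have IH: "h A B p = qp (int A + B + p) * ri (int A) * ri B * ri (int A + p) * ri (B + p)" for B p
    unfolding h_def by (rule Suc.IH)
  have "(1 - qe (int (Suc A))) * h (Suc A) B p =
      (\<Sum>i\<le>Suc A. qe (int i * (int i + p)) * (ri (int A - int i) * ri (int i)) * ri (B - int i) * ri (int i + p)) +
      (\<Sum>i\<le>Suc A. qe (int i * (int i + p)) * (qe (int (Suc A) - int i) * (ri (int (Suc A) - int i) * ri (int i - 1))) * ri (B - int i) * ri (int i + p))"
    unfolding h_def sum_distrib_left sum.distrib[symmetric]
    by (intro sum.cong refl distrib_inner2 ri_pascal1_Suc)
  also have "(\<Sum>i\<le>Suc A. qe (int i * (int i + p)) * (ri (int A - int i) * ri (int i)) * ri (B - int i) * ri (int i + p)) = h A B p"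
    by (simp add: h_def)
  also have "(\<Sum>i\<le>Suc A. qe (int i * (int i + p)) * (qe (int (Suc A) - int i) * (ri (int (Suc A) - int i) * ri (int i - 1))) * ri (B - int i) * ri (int i + p))
     = qe (int (Suc A) + p) * h A (B - 1) (p + 1)"
    unfolding h_def sum_distrib_left
  proof (subst sum.atMost_Suc_shift, simp, intro sum.cong refl)
    fix i
    have "qe ((1 + int i) * (1 + int i + p)) * qe (int A - int i) = qe (1 + int A + p) * qe (int i * (int i + (p + 1)))"
      by (simp add: qe_add[symmetric] algebra_simps)
    then show "qe ((1 + int i) * (1 + int i + p)) * (qe (int A - int i) * (ri (int A - int i) * ri (int i))) * ri (B - (1 + int i)) * ri (1 + int i + p) =
         qe (1 + int A + p) * (qe (int i * (int i + (p + 1))) * (ri (int A - int i) * ri (int i)) * ri (B - 1 - int i) * ri (int i + (p + 1)))"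
      by (simp add: algebra_simps)
  qed
  finally have "(1 - qe (int (Suc A))) * h (Suc A) B p = h A B p + qe (int (Suc A) + p) * h A (B - 1) (p + 1)" .
  also have "\<dots> = qp (int A + B + p) * ri (int A) * ri B * ri (int A + p) * ri (B + p) +
      qe (int (Suc A) + p) * (qp (int A + B + p) * ri (int A) * ri (B - 1) * ri (int (Suc A) + p) * ri (B + p))"
    by (simp add: IH algebra_simps)
  also have "\<dots> = (1 - qe (int (Suc A))) * (qp (int (Suc A) + B + p) * ri (int (Suc A)) * ri B * ri (int (Suc A) + p) * ri (B + p))"
  proof (cases "B < 0 \<or> B + p < 0")
    case False
    then have "qp (int (Suc A) + B + p) = (1 - qe (int (Suc A) + p) * qe B) * qp (int A + B + p)"
      using qp_Suc[of "int A + B + p"] by (simp add: qe_add[symmetric] add_ac)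
    then show ?thesis
      unfolding ri_int_Suc[of A] ri_int_Suc_add[of A p] ri_pred[of B] by (simp only:) (simp add: algebra_simps)
  qed auto
  finally show ?case
    using qe_neq_1[of "int (Suc A)"] by (simp add: h_def)
qed

text \<open>The second form of the q-Chu-Vandermonde sum, related to \<open>vandermonde_nat\<close>
  by inverting q; its induction runs on the second Pascal rule. Both forms are needed: this one
  takes the kernel apart, the other reassembles it.\<close>

lemma vandermonde_nat':
  "(\<Sum>j\<le>A. qe ((int A - int j) * (B - int j)) * (ri (int A - int j) * ri (int j)) * ri (B - int j) * ri (int j + p))
    = qp (int A + B + p) * ri (int A) * ri B * ri (int A + p) * ri (B + p)"
proof (induction A arbitrary: B p)
  case 0
  show ?case
    using qp_ri[of "B + p"] by (cases "B + p < 0"; cases "B < 0") auto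
next
  case (Suc A)
  define h where "h A B p = (\<Sum>j\<le>A. qe ((int A - int j) * (B - int j)) * (ri (int A - int j) * ri (int j)) * ri (B - int j) * ri (int j + p))"
    for A B p
  have IH: "h A B p = qp (int A + B + p) * ri (int A) * ri B * ri (int A + p) * ri (B + p)" for B p
    unfolding h_def by (rule Suc.IH)
  have "(1 - qe (int (Suc A))) * h (Suc A) B p =
      (\<Sum>i\<le>Suc A. qe ((int (Suc A) - int i) * (B - int i)) * (ri (int (Suc A) - int i) * ri (int i - 1)) * ri (B - int i) * ri (int i + p)) +
      (\<Sum>i\<le>Suc A. qe ((int (Suc A) - int i) * (B - int i)) * (qe (int i) * (ri (int A - int i) * ri (int i))) * ri (B - int i) * ri (int i + p))"
    unfolding h_def sum_distrib_left sum.distrib[symmetric]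
    by (intro sum.cong refl distrib_inner2 ri_pascal2_Suc)
  also have "(\<Sum>i\<le>Suc A. qe ((int (Suc A) - int i) * (B - int i)) * (ri (int (Suc A) - int i) * ri (int i - 1)) * ri (B - int i) * ri (int i + p)) = h A (B - 1) (p + 1)"
    unfolding h_def
    by (subst sum.atMost_Suc_shift, simp, intro sum.cong refl) (simp add: algebra_simps)
  also have "(\<Sum>i\<le>Suc A. qe ((int (Suc A) - int i) * (B - int i)) * (qe (int i) * (ri (int A - int i) * ri (int i))) * ri (B - int i) * ri (int i + p))
     = qe B * h A B p"
    unfolding h_def sum_distrib_left
  proof (simp, intro sum.cong refl)
    fix i
    have "qe ((1 + int A - int i) * (B - int i)) * qe (int i) = qe B * qe ((int A - int i) * (B - int i))"
      by (simp add: qe_add[symmetric] algebra_simps)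
    then show "qe ((1 + int A - int i) * (B - int i)) * (qe (int i) * (ri (int A - int i) * ri (int i))) * ri (B - int i) * ri (int i + p) =
         qe B * (qe ((int A - int i) * (B - int i)) * (ri (int A - int i) * ri (int i)) * ri (B - int i) * ri (int i + p))"
      by (simp add: algebra_simps)
  qed
  finally have "(1 - qe (int (Suc A))) * h (Suc A) B p = h A (B - 1) (p + 1) + qe B * h A B p" .
  also have "\<dots> = qp (int A + B + p) * ri (int A) * ri (B - 1) * ri (int (Suc A) + p) * ri (B + p) +
      qe B * (qp (int A + B + p) * ri (int A) * ri B * ri (int A + p) * ri (B + p))"
    by (simp add: IH algebra_simps)
  also have "\<dots> = (1 - qe (int (Suc A))) * (qp (int (Suc A) + B + p) * ri (int (Suc A)) * ri B * ri (int (Suc A) + p) * ri (B + p))"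
  proof (cases "B < 0 \<or> B + p < 0")
    case False
    then have "qp (int (Suc A) + B + p) = (1 - qe (int (Suc A) + p) * qe B) * qp (int A + B + p)"
      using qp_Suc[of "int A + B + p"] by (simp add: qe_add[symmetric] add_ac)
    then show ?thesis
      unfolding ri_int_Suc[of A] ri_int_Suc_add[of A p] ri_pred[of B] by (simp only:) (simp add: algebra_simps)
  qed auto
  finally show ?case
    using qe_neq_1[of "int (Suc A)"] by (simp add: h_def)
qed

lemma sum_int_from:
  fixes f :: "int \<Rightarrow> 'b :: comm_monoid_add"
  assumes "\<And>n. n < u \<Longrightarrow> f n = 0" "a \<le> u" "u \<le> N"
  shows "sum f {a..N} = (\<Sum>i\<le>nat (N - u). f (u + int i))"
proof -
  have "sum f {a..N} = sum f {u..N}"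
    using assms by (intro sum.mono_neutral_right) auto
  also have "\<dots> = (\<Sum>i\<le>nat (N - u). f (u + int i))"
    by (rule sum.reindex_bij_witness[of _ "\<lambda>i. u + int i" "\<lambda>n. nat (n - u)"]) (use assms in auto)
  finally show ?thesis .
qed

lemma vandermonde_limit_aux:
  assumes "a \<le> u"
  shows "(\<Sum>n\<in>{a..N}. qe (n\<^sup>2 - (u + v) * n) * (ri (N - n) * ri (n - u) * ri (n - v)))
    = qe (- (u * v)) * ri (N - u) * ri (N - v)"
proof (cases "N < u")
  case True
  then show ?thesis
    by (auto intro!: sum.neutral)
next
  case False
  define A where "A = nat (N - u)"
  have A: "int A = N - u"
    using False by (simp add: A_def)
  have "(\<Sum>n\<in>{a..N}. qe (n\<^sup>2 - (u + v) * n) * (ri (N - n) * ri (n - u) * ri (n - v)))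
     = (\<Sum>i\<le>A. qe ((u + int i)\<^sup>2 - (u + v) * (u + int i)) * (ri (N - (u + int i)) * ri (u + int i - u) * ri (u + int i - v)))"
    unfolding A_def using False assms by (intro sum_int_from) auto
  also have "\<dots> = qe (- (u * v)) * (\<Sum>i\<le>A. qe (int i * (int i + (u - v))) * (ri (int A - int i) * ri (int i)) * ri (int i + (u - v)))"
    unfolding sum_distrib_left
  proof (intro sum.cong refl)
    fix i
    have "qe ((u + int i)\<^sup>2 - (u + v) * (u + int i)) = qe (- (u * v)) * qe (int i * (int i + (u - v)))"
      by (simp add: qe_add[symmetric] power2_eq_square algebra_simps)
    then show "qe ((u + int i)\<^sup>2 - (u + v) * (u + int i)) * (ri (N - (u + int i)) * ri (u + int i - u) * ri (u + int i - v)) =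
      qe (- (u * v)) * (qe (int i * (int i + (u - v))) * (ri (int A - int i) * ri (int i)) * ri (int i + (u - v)))"
      by (simp add: A algebra_simps)
  qed
  also have "\<dots> = qe (- (u * v)) * ri (N - u) * ri (N - v)"
    unfolding vandermonde_limit_nat by (simp add: A)
  finally show ?thesis .
qed

text \<open>Terms with n < max u v vanish, so nothing is lost if the sum starts at or below this
  maximum. The support hypotheses of \<open>psi_invariance\<close> enter in this form.\<close>

lemma vandermonde_limit:
  assumes "a \<le> max u v"
  shows "(\<Sum>n\<in>{a..N}. qe (n\<^sup>2 - (u + v) * n) * (ri (N - n) * ri (n - u) * ri (n - v)))
    = qe (- (u * v)) * ri (N - u) * ri (N - v)"
proof (cases "a \<le> u")
  case False
  then have "a \<le> v"
    using assms by linarith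
  from vandermonde_limit_aux[where u = v and v = u and N = N, OF this] show ?thesis
    by (simp add: ac_simps)
qed (rule vandermonde_limit_aux)

text \<open>The upper end \<open>N\<close> does not depend on \<open>n\<close>, so that in
  \<open>psi_invariance\<close> the sum over u can be exchanged with the sum over n.\<close>

lemma vandermonde:
  assumes "n \<le> N"
  shows "(\<Sum>u\<in>{x..N}. qe ((u - x) * (u - y)) * (ri (u - x) * ri (u - y) * ri (n - u) * ri (m + x + y - u)))
    = qp (n + m) * (ri (n - x) * ri (n - y) * ri (m + x) * ri (m + y))" (is ?thesis1)
  and "(\<Sum>u\<in>{x..N}. qe ((n - u) * (m + x + y - u)) * (ri (u - x) * ri (u - y) * ri (n - u) * ri (m + x + y - u)))
    = qp (n + m) * (ri (n - x) * ri (n - y) * ri (m + x) * ri (m + y))" (is ?thesis2)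
proof -
  define A where "A = nat (n - x)"
  have *: "(\<Sum>u\<in>{x..N}. f u * (ri (u - x) * ri (u - y) * ri (n - u) * ri (m + x + y - u))) =
      (\<Sum>i\<le>A. f (x + int i) * (ri (int A - int i) * ri (int i)) * ri (m + y - int i) * ri (int i + (x - y)))"
    if "n \<ge> x" for f
  proof -
    have A: "int A = n - x"
      using that by (simp add: A_def)
    have "(\<Sum>u\<in>{x..N}. f u * (ri (u - x) * ri (u - y) * ri (n - u) * ri (m + x + y - u))) =
      (\<Sum>u\<in>{x..n}. f u * (ri (u - x) * ri (u - y) * ri (n - u) * ri (m + x + y - u)))"
      using assms by (intro sum.mono_neutral_right) auto
    also have "\<dots> = (\<Sum>i\<le>A. f (x + int i) * (ri (x + int i - x) * ri (x + int i - y) * ri (n - (x + int i)) * ri (m + x + y - (x + int i))))"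
      unfolding A_def using that by (intro sum_int_from) auto
    also have "\<dots> = (\<Sum>i\<le>A. f (x + int i) * (ri (int A - int i) * ri (int i)) * ri (m + y - int i) * ri (int i + (x - y)))"
      by (intro sum.cong refl) (simp add: A algebra_simps)
    finally show ?thesis .
  qed
  have **: "(\<Sum>u\<in>{x..N}. f u * (ri (u - x) * ri (u - y) * ri (n - u) * ri (m + x + y - u))) = 0"
    if "n < x" for f
    using that by (intro sum.neutral) auto
  show ?thesis1
  proof (cases "n < x")
    case False
    then show ?thesis
      using vandermonde_nat[of "x - y" A "m + y"]
      by (subst *) (auto simp: A_def algebra_simps)
  qed (subst **, auto)
  show ?thesis2
  proof (cases "n < x")
    case False
    then show ?thesis
      using vandermonde_nat'[of A "m + y" "x - y"]
      by (subst *) (auto simp: A_def algebra_simps)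
  qed (subst **, auto)
qed

section \<open>The kernel and its invariance under a step of the chain\<close>

definition psi :: "int \<Rightarrow> int \<Rightarrow> int \<Rightarrow> int \<Rightarrow> int \<Rightarrow> int \<Rightarrow> 'a" where
  "psi c x y z n m = qp (n + m + c) *
     (ri (n - x) * ri (n - y) * ri (n - z) * ri (m + c + x) * ri (m + c + y) * ri (m + c + z))"

text \<open>The kernel vanishes unless n >= max(x, y, z) and m >= - c - min(x, y, z). The two
  hypotheses make these bounds nonnegative, so the sums starting at 0 miss no term.\<close>

lemma psi_invariance:
  assumes "x \<ge> 0 \<or> y \<ge> 0 \<or> z \<ge> 0" and "x \<le> - c \<or> y \<le> - c \<or> z \<le> - c"
  shows "(\<Sum>n\<in>{0..N}. \<Sum>m\<in>{0..M}.
       qe (n\<^sup>2 - n * m + m\<^sup>2 - (x + y + z + c) * n + (2 * c + x + y + z) * m) *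
       (ri (N - n) * ri (M - m) * psi c x y z n m)) =
     qe (- (c * (x + y + z) + c\<^sup>2 + x * y + x * z + y * z)) * psi c x y z N M"
proof -
  \<comment> \<open>For fixed u this is a function of n times a function of m, each of the shape
    summed by \<open>vandermonde_limit\<close>; \<open>E\<close> collects the remaining
    factors.\<close>
  define G where "G u n m = qe (n\<^sup>2 - (u + y) * n) * (ri (N - n) * ri (n - u) * ri (n - y)) *
       (qe (m\<^sup>2 - ((u - x - z - c) + (- c - y)) * m) * (ri (M - m) * ri (m - (u - x - z - c)) * ri (m - (- c - y))))"
    for u n m
  define E where "E u = qe (u * (u - x - z - c)) * (ri (u - x) * ri (u - z))" for u
  have 1: "qe (n\<^sup>2 - n * m + m\<^sup>2 - (x + y + z + c) * n + (2 * c + x + y + z) * m) *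
       (ri (N - n) * ri (M - m) * psi c x y z n m) = (\<Sum>u\<in>{x..N}. E u * G u n m)"
    if "n \<le> N" for n m
  proof -
    have "qp (n + (m + c)) * (ri (n - x) * ri (n - z) * ri (m + c + x) * ri (m + c + z)) =
      (\<Sum>u\<in>{x..N}. qe ((n - u) * (m + c + x + z - u)) * (ri (u - x) * ri (u - z) * ri (n - u) * ri (m + c + x + z - u)))"
      using vandermonde(2)[OF that, where m = "m + c" and x = x and y = z] by simp
    then have p: "psi c x y z n m = (\<Sum>u\<in>{x..N}. qe ((n - u) * (m + c + x + z - u)) * (ri (u - x) * ri (u - z) * ri (n - u) * ri (m + c + x + z - u))) * (ri (n - y) * ri (m + c + y))"
      by (simp add: psi_def ac_simps)
    show ?thesis
      unfolding p sum_distrib_left sum_distrib_right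
    proof (intro sum.cong refl)
      fix u
      \<comment> \<open>The decoupling: the cross term - n m cancels against the n m in (n - u) (m +
        c + x + z - u).\<close>
      have e: "qe (n\<^sup>2 - n * m + m\<^sup>2 - (x + y + z + c) * n + (2 * c + x + y + z) * m) * qe ((n - u) * (m + c + x + z - u)) =
         qe (u * (u - x - z - c)) * (qe (n\<^sup>2 - (u + y) * n) * qe (m\<^sup>2 - ((u - x - z - c) + (- c - y)) * m))"
        by (simp add: qe_add[symmetric] power2_eq_square algebra_simps)
      have a: "m + c + x + z - u = m - (u - x - z - c)" "m + c + y = m - (- c - y)"
        by simp_all
      have "qe (n\<^sup>2 - n * m + m\<^sup>2 - (x + y + z + c) * n + (2 * c + x + y + z) * m) * (ri (N - n) * ri (M - m) *
         (qe ((n - u) * (m + c + x + z - u)) * (ri (u - x) * ri (u - z) * ri (n - u) * ri (m + c + x + z - u)) * (ri (n - y) * ri (m + c + y)))) =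
         (qe (n\<^sup>2 - n * m + m\<^sup>2 - (x + y + z + c) * n + (2 * c + x + y + z) * m) * qe ((n - u) * (m + c + x + z - u))) *
         (ri (N - n) * ri (M - m) * (ri (u - x) * ri (u - z) * ri (n - u) * ri (m + c + x + z - u)) * (ri (n - y) * ri (m + c + y)))"
        by (simp only: mult_ac)
      also have "\<dots> = E u * G u n m"
        unfolding e E_def G_def unfolding a by (simp only: mult_ac)
      finally show "qe (n\<^sup>2 - n * m + m\<^sup>2 - (x + y + z + c) * n + (2 * c + x + y + z) * m) * (ri (N - n) * ri (M - m) *
         (qe ((n - u) * (m + c + x + z - u)) * (ri (u - x) * ri (u - z) * ri (n - u) * ri (m + c + x + z - u)) * (ri (n - y) * ri (m + c + y)))) = E u * G u n m" .
    qed
  qed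
  have 2: "E u * (\<Sum>n\<in>{0..N}. \<Sum>m\<in>{0..M}. G u n m) =
     qe (- (c * (x + y + z) + c\<^sup>2 + x * y + x * z + y * z)) *
     (qe ((u - x) * (u - z)) * (ri (u - x) * ri (u - z) * ri (N - u) * ri (M + c + x + z - u)) * (ri (N - y) * ri (M + c + y)))"
    if "u \<in> {x..N}" for u
  proof (cases "u < z")
    case True
    then show ?thesis
      by (simp add: E_def)
  next
    case False
    \<comment> \<open>Here u >= x and u >= z, so max u y is at least max(x, y, z), and u - x - z - c
      is at least - c - min(x, z).\<close>
    have n: "0 \<le> max u y"
      using that False assms(1) by auto
    have m: "0 \<le> max (u - x - z - c) (- c - y)"
      using that False assms(2) by auto
    have s: "(\<Sum>n\<in>{0..N}. \<Sum>m\<in>{0..M}. G u n m) =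
      (qe (- (u * y)) * ri (N - u) * ri (N - y)) *
      (qe (- ((u - x - z - c) * (- c - y))) * ri (M - (u - x - z - c)) * ri (M - (- c - y)))"
      unfolding G_def sum_distrib_left[symmetric] sum_distrib_right[symmetric]
      by (simp only: vandermonde_limit[OF n] vandermonde_limit[OF m])
    have e: "qe (u * (u - x - z - c)) * (qe (- (u * y)) * qe (- ((u - x - z - c) * (- c - y)))) =
        qe (- (c * (x + y + z) + c\<^sup>2 + x * y + x * z + y * z)) * qe ((u - x) * (u - z))"
      by (simp add: qe_add[symmetric] power2_eq_square algebra_simps)
    have a: "M + c + x + z - u = M - (u - x - z - c)" "M + c + y = M - (- c - y)"
      by simp_all
    have "E u * (\<Sum>n\<in>{0..N}. \<Sum>m\<in>{0..M}. G u n m) =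
      (qe (u * (u - x - z - c)) * (qe (- (u * y)) * qe (- ((u - x - z - c) * (- c - y))))) *
      (ri (u - x) * ri (u - z) * ri (N - u) * ri (M + c + x + z - u) * (ri (N - y) * ri (M + c + y)))"
      unfolding s E_def a by (simp only: mult_ac)
    also have "\<dots> = qe (- (c * (x + y + z) + c\<^sup>2 + x * y + x * z + y * z)) *
     (qe ((u - x) * (u - z)) * (ri (u - x) * ri (u - z) * ri (N - u) * ri (M + c + x + z - u)) * (ri (N - y) * ri (M + c + y)))"
      unfolding e by (simp only: mult_ac)
    finally show ?thesis .
  qed
  have "(\<Sum>n\<in>{0..N}. \<Sum>m\<in>{0..M}.
       qe (n\<^sup>2 - n * m + m\<^sup>2 - (x + y + z + c) * n + (2 * c + x + y + z) * m) *
       (ri (N - n) * ri (M - m) * psi c x y z n m)) = (\<Sum>n\<in>{0..N}. \<Sum>m\<in>{0..M}. \<Sum>u\<in>{x..N}. E u * G u n m)"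
    by (intro sum.cong refl 1) auto
  also have "\<dots> = (\<Sum>u\<in>{x..N}. E u * (\<Sum>n\<in>{0..N}. \<Sum>m\<in>{0..M}. G u n m))"
    unfolding sum_distrib_left
    by (subst sum.swap[of _ _ "{0..M}"], subst sum.swap[of _ _ "{0..N}"]) (rule refl)
  also have "\<dots> = (\<Sum>u\<in>{x..N}. qe (- (c * (x + y + z) + c\<^sup>2 + x * y + x * z + y * z)) *
      (qe ((u - x) * (u - z)) * (ri (u - x) * ri (u - z) * ri (N - u) * ri (M + c + x + z - u)) * (ri (N - y) * ri (M + c + y))))"
    by (intro sum.cong refl 2)
  also have "\<dots> = qe (- (c * (x + y + z) + c\<^sup>2 + x * y + x * z + y * z)) *
      ((\<Sum>u\<in>{x..N}. qe ((u - x) * (u - z)) * (ri (u - x) * ri (u - z) * ri (N - u) * ri (M + c + x + z - u))) * (ri (N - y) * ri (M + c + y)))"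
    by (simp only: sum_distrib_left sum_distrib_right)
  also have "\<dots> = qe (- (c * (x + y + z) + c\<^sup>2 + x * y + x * z + y * z)) * psi c x y z N M"
    using vandermonde(1)[of N N, where m = "M + c" and x = x and y = z]
    by (simp add: psi_def ac_simps)
  finally show ?thesis .
qed

definition qb :: "int \<Rightarrow> int \<Rightarrow> 'a" where "qb n j = qp n * ri j * ri (n - j)"

lemma qb_pascal1:
  assumes "n \<ge> 0"
  shows "qb (n + 1) j = qb n j + qe (n + 1 - j) * qb n (j - 1)"
proof -
  have "qb (n + 1) j = qp n * ((1 - qe (n + 1)) * (ri (n + 1 - j) * ri j))"
    unfolding qb_def qp_Suc[OF assms] by (simp only: mult_ac)
  then show ?thesis
    unfolding ri_pascal1 by (simp add: qb_def algebra_simps)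
qed

lemma qb_pascal2:
  assumes "n \<ge> 0"
  shows "qb (n + 1) j = qb n (j - 1) + qe j * qb n j"
proof -
  have "qb (n + 1) j = qp n * ((1 - qe (n + 1)) * (ri (n + 1 - j) * ri j))"
    unfolding qb_def qp_Suc[OF assms] by (simp only: mult_ac)
  then show ?thesis
    unfolding ri_pascal2 by (simp add: qb_def algebra_simps)
qed

lemma qb_eq_0: "j < 0 \<or> j > n \<Longrightarrow> qb n j = 0"
  by (auto simp: qb_def)

end

subsection \<open>An antisymmetric trilinear form\<close>

text \<open>
  The bound \<open>R\<close> is only a cut-off that makes the sums finite; it will exceed the supports of all vectors.
\<close>

definition zero_sum_box :: "int \<Rightarrow> (int \<times> int \<times> int) set" where
  "zero_sum_box R = {(a, b, c). a \<in> {-R..R} \<and> b \<in> {-R..R} \<and> c \<in> {-R..R} \<and> a + b + c = 0}"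

lemma finite_zero_sum_box [simp]: "finite (zero_sum_box R)"
  by (rule finite_subset[of _ "{-R..R} \<times> {-R..R} \<times> {-R..R}"]) (auto simp: zero_sum_box_def)

context qfield
begin

definition chi :: "int \<Rightarrow> 'a" where
  "chi d = (if d mod 3 = 1 then 1 else if d mod 3 = 2 then - 1 else 0)"

lemma chi_uminus: "chi (- d) = - chi d"
proof -
  have "d mod 3 = 0 \<or> d mod 3 = 1 \<or> d mod 3 = 2"
    by presburger
  moreover have "(- d) mod 3 = (3 - d mod 3) mod 3"
    by presburger
  ultimately show ?thesis
    by (auto simp: chi_def)
qed

lemma chi_cong: "d mod 3 = d' mod 3 \<Longrightarrow> chi d = chi d'"
  by (simp add: chi_def)

text \<open>If a + b + c = 0, then a - b, b - c and c - a agree modulo 3. So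
  \<open>chi (b - c)\<close> is 0 when the residues coincide, and otherwise a sign for their cyclic
  order. In the latter case the residues are 0, 1, 2, the squares add up to 2 modulo 3, and the
  division is exact.\<close>

definition weight :: "int \<Rightarrow> int \<Rightarrow> int \<Rightarrow> 'a" where
  "weight a b c = chi (b - c) * qe ((a\<^sup>2 + b\<^sup>2 + c\<^sup>2 - 2) div 3)"

definition tri :: "int \<Rightarrow> (int \<Rightarrow> 'a) \<Rightarrow> (int \<Rightarrow> 'a) \<Rightarrow> (int \<Rightarrow> 'a) \<Rightarrow> 'a" where
  "tri R f g h = (\<Sum>(a, b, c)\<in>zero_sum_box R. weight a b c * (f a * g b * h c))"

lemma tri_add1: "tri R (\<lambda>y. f y + k * f' y) g h = tri R f g h + k * tri R f' g h"
  by (simp add: tri_def sum_distrib_left sum.distrib[symmetric] case_prod_unfold algebra_simps)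

lemma tri_add2: "tri R g (\<lambda>y. f y + k * f' y) h = tri R g f h + k * tri R g f' h"
  by (simp add: tri_def sum_distrib_left sum.distrib[symmetric] case_prod_unfold algebra_simps)

lemma tri_add3: "tri R g h (\<lambda>y. f y + k * f' y) = tri R g h f + k * tri R g h f'"
  by (simp add: tri_def sum_distrib_left sum.distrib[symmetric] case_prod_unfold algebra_simps)

lemma weight_swap12: "a + b + c = 0 \<Longrightarrow> weight b a c = - weight a b c"
proof -
  assume "a + b + c = 0"
  then have "a - c = - (b - c) + (- c) * 3"
    by simp
  then have "(a - c) mod 3 = (- (b - c)) mod 3"
    by (simp only: mod_mult_self1)
  then have "chi (a - c) = - chi (b - c)"
    unfolding chi_uminus[symmetric] by (rule chi_cong)
  then show ?thesis
    by (simp add: weight_def add_ac)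
qed

lemma weight_swap23: "weight a c b = - weight a b c"
  using chi_uminus[of "b - c"] by (simp add: weight_def add_ac)

lemma tri_swap12: "tri R g f h = - tri R f g h"
proof -
  have "tri R g f h = (\<Sum>(a, b, c)\<in>zero_sum_box R. weight b a c * (g b * f a * h c))"
    unfolding tri_def
    by (rule sum.reindex_bij_witness[of _ "\<lambda>(a, b, c). (b, a, c)" "\<lambda>(a, b, c). (b, a, c)"]) (auto simp: zero_sum_box_def)
  also have "\<dots> = (\<Sum>(a, b, c)\<in>zero_sum_box R. - (weight a b c * (f a * g b * h c)))"
  proof (intro sum.cong refl, clarify)
    fix a b c assume "(a, b, c) \<in> zero_sum_box R"
    then have "weight b a c = - weight a b c"
      by (intro weight_swap12) (simp add: zero_sum_box_def)
    then show "weight b a c * (g b * f a * h c) = - (weight a b c * (f a * g b * h c))"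
      by simp
  qed
  finally show ?thesis
    by (simp add: tri_def sum_negf case_prod_unfold)
qed

lemma tri_swap23: "tri R f h g = - tri R f g h"
proof -
  have "tri R f h g = (\<Sum>(a, b, c)\<in>zero_sum_box R. weight a c b * (f a * h c * g b))"
    unfolding tri_def
    by (rule sum.reindex_bij_witness[of _ "\<lambda>(a, b, c). (a, c, b)" "\<lambda>(a, b, c). (a, c, b)"]) (auto simp: zero_sum_box_def)
  also have "\<dots> = (\<Sum>(a, b, c)\<in>zero_sum_box R. - (weight a b c * (f a * g b * h c)))"
  proof (intro sum.cong refl, clarify)
    fix a b c
    show "weight a c b * (f a * h c * g b) = - (weight a b c * (f a * g b * h c))"
      unfolding weight_swap23[of a c b] by simp
  qed
  finally show ?thesis
    by (simp add: tri_def sum_negf case_prod_unfold)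
qed

lemma eq_neg_self: "(x :: 'a) = - x \<Longrightarrow> x = 0"
  by (simp add: eq_neg_iff_add_eq_0 mult_2[symmetric])

lemma tri_same12 [simp]: "tri R f f h = 0"
  by (rule eq_neg_self, rule tri_swap12)

lemma tri_same23 [simp]: "tri R h f f = 0"
  by (rule eq_neg_self, rule tri_swap23)

lemma tri_same13 [simp]: "tri R f h f = 0"
  using tri_swap23[of R f f h] by simp

text \<open>A row of q-binomial coefficients at position \<open>p\<close>, twisted by q^(l y). The
  coefficients in the Pascal rules depend on y; changing the twist absorbs them, so the family is
  closed under both rules.\<close>

definition vec :: "int \<Rightarrow> int \<Rightarrow> int \<Rightarrow> int \<Rightarrow> 'a" where
  "vec L p l y = qe (l * y) * qb L (p - y)"

lemma vec_pascal1:
  assumes "L \<ge> 0"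
  shows "vec (L + 1) p l = (\<lambda>y. vec L p l y + qe (L + 1 - p) * vec L (p - 1) (l + 1) y)"
proof
  fix y
  have "qe (l * y) * qe (L + 1 - (p - y)) = qe (L + 1 - p) * qe ((l + 1) * y)"
    by (simp add: qe_add[symmetric] algebra_simps)
  then show "vec (L + 1) p l y = vec L p l y + qe (L + 1 - p) * vec L (p - 1) (l + 1) y"
    unfolding vec_def qb_pascal1[OF assms] by (simp add: distrib_left mult.assoc[symmetric]) (simp add: algebra_simps)
qed

lemma vec_pascal2:
  assumes "L \<ge> 0"
  shows "vec (L + 1) p l = (\<lambda>y. vec L (p - 1) l y + qe p * vec L p (l - 1) y)"
proof
  fix y
  have "qe (l * y) * qe (p - y) = qe p * qe ((l - 1) * y)"
    by (simp add: qe_add[symmetric] algebra_simps)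
  then show "vec (L + 1) p l y = vec L (p - 1) l y + qe p * vec L p (l - 1) y"
    unfolding vec_def qb_pascal2[OF assms] by (simp add: distrib_left mult.assoc[symmetric]) (simp add: algebra_simps)
qed

text \<open>A common change of twist contributes q^(k (a + b + c)) = 1.\<close>

lemma tri_vec_shift:
  "tri R (vec L p (l + k)) (vec L' p' (l' + k)) (vec L'' p'' (l'' + k)) = tri R (vec L p l) (vec L' p' l') (vec L'' p'' l'')"
  unfolding tri_def
proof (intro sum.cong refl, clarify)
  fix a b c assume "(a, b, c) \<in> zero_sum_box R"
  then have "a + b + c = 0"
    by (simp add: zero_sum_box_def)
  moreover have "(l + k) * a + ((l' + k) * b + (l'' + k) * c) = l * a + (l' * b + l'' * c) + k * (a + b + c)"
    by (simp add: algebra_simps)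
  ultimately have "qe ((l + k) * a) * (qe ((l' + k) * b) * qe ((l'' + k) * c)) = qe (l * a) * (qe (l' * b) * qe (l'' * c))"
    by (simp add: qe_add[symmetric])
  then show "weight a b c * (vec L p (l + k) a * vec L' p' (l' + k) b * vec L'' p'' (l'' + k) c) =
     weight a b c * (vec L p l a * vec L' p' l' b * vec L'' p'' l'' c)"
    unfolding vec_def by (simp add: mult_ac)
qed

text \<open>On zero-sum triples, negation and the exchange of the outer entries each reverse the
  sign of the weight, so their composition preserves it. The rest is the symmetry of q-binomial
  coefficients.\<close>

lemma tri_vec_reflect:
  "tri R (vec L p l) (vec L' p' l') (vec L'' p'' l'') =
   tri R (vec L'' (L'' - p'') (- l'')) (vec L' (L' - p') (- l')) (vec L (L - p) (- l))"
proof -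
  have v: "vec L (L - p) (- l) (- y) = vec L p l y" for L p l y
    by (simp add: vec_def qb_def algebra_simps)
  have w: "weight (- c) (- b) (- a) = weight a b c" if "a + b + c = 0" for a b c
  proof -
    have "a - b = (b - c) + (- b) * 3"
      using that by simp
    then have "(a - b) mod 3 = (b - c) mod 3"
      by (simp only: mod_mult_self1)
    then have "chi (a - b) = chi (b - c)"
      by (rule chi_cong)
    then show ?thesis
      by (simp add: weight_def add_ac)
  qed
  show ?thesis
    unfolding tri_def
    by (rule sum.reindex_bij_witness[of _ "\<lambda>(a, b, c). (- c, - b, - a)" "\<lambda>(a, b, c). (- c, - b, - a)"])
      (auto simp: zero_sum_box_def v w)
qed

text \<open>
  The affine reflection that sends \<open>(a, b, c)\<close> to \<open>(b - 3, a + 3, c)\<close> changes only the sign of the summands.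
\<close>

lemma tri_vec_translate:
  assumes "\<bar>p\<bar> + L + 3 \<le> R"
  shows "tri R (vec L p l) (vec L (p + 3) (l - 2)) h = 0"
proof -
  \<comment> \<open>The box is not stable under the reflection, but the support of the two vectors
    is; the bound on \<open>R\<close> keeps its image inside the box.\<close>
  define S where "S = {(a, b, c). (a, b, c) \<in> zero_sum_box R \<and> a \<in> {p - L..p} \<and> b \<in> {p + 3 - L..p + 3}}"
  define T where "T = (\<lambda>(a, b, c). weight a b c * (vec L p l a * vec L (p + 3) (l - 2) b * h c))"
  define \<phi> :: "int \<times> int \<times> int \<Rightarrow> int \<times> int \<times> int" where "\<phi> = (\<lambda>(a, b, c). (b - 3, a + 3, c))"
  have "S \<subseteq> zero_sum_box R"
    by (auto simp: S_def)
  moreover have "T x = 0" if "x \<in> zero_sum_box R - S" for x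
    using that qb_eq_0 by (cases x) (force simp: S_def T_def vec_def)
  ultimately have tri: "tri R (vec L p l) (vec L (p + 3) (l - 2)) h = sum T S"
    unfolding tri_def T_def[symmetric] by (intro sum.mono_neutral_right) auto
  have "T (\<phi> x) = - T x" if "x \<in> S" for x
  proof (cases x)
    case (fields a b c)
    then have abc: "a + b + c = 0"
      using that by (simp add: S_def zero_sum_box_def)
    \<comment> \<open>The squares change by 3 (2 a - 2 b + 6). The resulting power of q is absorbed
      by the difference 2 between the two twists, and the translation by 3 leaves residues alone, so
      only the sign of the exchange remains.\<close>
    have "((b - 3)\<^sup>2 + (a + 3)\<^sup>2 + c\<^sup>2 - 2) div 3 = (a\<^sup>2 + b\<^sup>2 + c\<^sup>2 - 2 + (2 * a - 2 * b + 6) * 3) div 3"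
      by (simp add: power2_eq_square algebra_simps)
    then have e: "((b - 3)\<^sup>2 + (a + 3)\<^sup>2 + c\<^sup>2 - 2) div 3 = (a\<^sup>2 + b\<^sup>2 + c\<^sup>2 - 2) div 3 + (2 * a - 2 * b + 6)"
      by (simp only: div_mult_self1)
    have "a + 3 - c = - (b - c) + (1 - c) * 3"
      using abc by simp
    then have "(a + 3 - c) mod 3 = (- (b - c)) mod 3"
      by (simp only: mod_mult_self1)
    then have "chi (a + 3 - c) = - chi (b - c)"
      unfolding chi_uminus[symmetric] by (rule chi_cong)
    then have w: "weight (b - 3) (a + 3) c = - weight a b c * qe (2 * a - 2 * b + 6)"
      unfolding weight_def e qe_add by (simp add: mult_ac)
    have q: "qe (2 * a - 2 * b + 6) * (qe (l * (b - 3)) * qe ((l - 2) * (a + 3))) = qe (l * a) * qe ((l - 2) * b)"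
      by (simp add: qe_add[symmetric] algebra_simps)
    have p: "p - (b - 3) = p + 3 - b" "p + 3 - (a + 3) = p - a"
      by simp_all
    have "T (\<phi> x) = - weight a b c * (qe (2 * a - 2 * b + 6) * (qe (l * (b - 3)) * qe ((l - 2) * (a + 3)))) *
        (qb L (p + 3 - b) * qb L (p - a) * h c)"
      unfolding fields T_def \<phi>_def vec_def prod.case w p by (simp only: mult_ac)
    also have "\<dots> = - T x"
      unfolding q fields T_def vec_def prod.case by (simp add: mult_ac)
    finally show ?thesis .
  qed
  then have "sum T S = (\<Sum>x\<in>S. - T (\<phi> x))"
    by simp
  also have "\<dots> = (\<Sum>x\<in>S. - T x)"
    by (rule sum.reindex_bij_witness[of _ \<phi> \<phi>]) (use assms in \<open>auto simp: \<phi>_def S_def zero_sum_box_def\<close>)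
  finally show ?thesis
    unfolding tri by (intro eq_neg_self) (simp add: sum_negf)
qed

lemma tri_vec_translate13:
  assumes "\<bar>p\<bar> + L + 3 \<le> R"
  shows "tri R (vec L (p + 3) (l - 2)) h (vec L p l) = 0"
  using tri_vec_translate[OF assms, of l h] tri_swap12[of R "vec L p l" "vec L (p + 3) (l - 2)" h]
    tri_swap23[of R "vec L (p + 3) (l - 2)" "vec L p l" h] by simp

text \<open>One Pascal rule for each vector writes both as combinations of the same two vectors of
  level \<open>L - 1\<close>. The determinant is 1 - q^(L - p) q^p.\<close>

lemma tri_vec_consecutive:
  assumes "L \<ge> 0"
  shows "tri R h (vec L p l) (vec L p (l + 1)) = (1 - qe L) * tri R h (vec (L - 1) p l) (vec (L - 1) (p - 1) (l + 1))"
proof (cases "L = 0")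
  case True
  \<comment> \<open>At \<open>L = 0\<close> the two vectors are proportional. The zero summand only
    provides the shape required by \<open>tri_add3\<close>.\<close>
  have "vec 0 p (l + 1) = (\<lambda>y. 0 * vec 0 p l y + qe p * vec 0 p l y)"
  proof
    fix y
    show "vec 0 p (l + 1) y = 0 * vec 0 p l y + qe p * vec 0 p l y"
      by (cases "y = p"; cases "y < p") (auto simp: vec_def qb_def algebra_simps qe_add)
  qed
  then have "tri R h (vec 0 p l) (vec 0 p (l + 1)) = tri R h (vec 0 p l) (\<lambda>y. 0 * vec 0 p l y) + qe p * tri R h (vec 0 p l) (vec 0 p l)"
    by (simp only: tri_add3)
  then show ?thesis
    by (simp add: True) (simp add: tri_def)
next
  case False
  then have L: "L - 1 \<ge> 0"
    using assms by simp
  have 1: "vec L p l = (\<lambda>y. vec (L - 1) p l y + qe (L - p) * vec (L - 1) (p - 1) (l + 1) y)"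
    using vec_pascal1[OF L, of p l] by simp
  have 2: "vec L p (l + 1) = (\<lambda>y. vec (L - 1) (p - 1) (l + 1) y + qe p * vec (L - 1) p l y)"
    using vec_pascal2[OF L, of p "l + 1"] by simp
  have "qe L = qe (L - p) * qe p"
    by (simp add: qe_add[symmetric])
  then show ?thesis
    unfolding 1 2 tri_add2 tri_add3
    using tri_swap23[of R h "vec (L - 1) p l" "vec (L - 1) (p - 1) (l + 1)"]
    by (simp add: algebra_simps)
qed

section \<open>Closed form of the special values of the trilinear form\<close>

definition core :: "int \<Rightarrow> int \<Rightarrow> int \<Rightarrow> 'a" where
  "core R L n = tri R (vec L (n + 1) (- 1)) (vec L n 0) (vec L (n - 1) 1)"

text \<open>The starting points of the chain reduce to \<open>core\<close> alone;
  \<open>core'\<close> closes the recursion and turns out to be q times \<open>core\<close>.\<close>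

definition core' :: "int \<Rightarrow> int \<Rightarrow> int \<Rightarrow> 'a" where
  "core' R L n = tri R (vec L (n + 1) (- 1)) (vec L n 0) (vec L (n - 1) 0)"

lemma core'_reflect: "tri R (vec L (n + 1) 0) (vec L n 0) (vec L (n - 1) 1) = core' R L (L - n)"
  using tri_vec_reflect[of R L "n + 1" 0 L n 0 L "n - 1" 1] by (simp add: core'_def algebra_simps)

lemma core_shift: "tri R (vec L n 0) (vec L (n - 1) 1) (vec L (n - 2) 2) = core R L (n - 1)"
  using tri_vec_shift[of R L n "- 1" 1 L "n - 1" 0 L "n - 2" 1] by (simp add: core_def)

lemma core'_shift: "tri R (vec L n 0) (vec L (n - 1) 1) (vec L (n - 2) 1) = core' R L (n - 1)"
  using tri_vec_shift[of R L n "- 1" 1 L "n - 1" 0 L "n - 2" 0] by (simp add: core'_def)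

text \<open>\<open>tri_vec_consecutive\<close> lowers the level. Of the two terms of the first
  vector, one is killed by translation (positions 3 apart, twists 2 apart) and the other is
  \<open>core'\<close> after reflection.\<close>

lemma tri_eliminate1:
  assumes "L \<ge> 0" "\<bar>n\<bar> + L + 10 \<le> R"
  shows "tri R (vec L (n + 1) (- 1)) (vec L (n - 1) 0) (vec L (n - 1) 1) =
    (1 - qe L) * qe (L - n - 1) * core' R (L - 1) (L - n)"
proof (cases "L = 0")
  case True
  then show ?thesis
    using tri_vec_consecutive[OF assms(1), of R _ "n - 1" 0] by simp
next
  case False
  then have L: "L - 1 \<ge> 0"
    using assms by simp
  have "vec L (n + 1) (- 1) = (\<lambda>y. vec (L - 1) (n + 1) (- 1) y + qe (L - n - 1) * vec (L - 1) n 0 y)"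
    using vec_pascal1[OF L, of "n + 1" "- 1"] by (simp add: algebra_simps)
  moreover have "tri R (vec (L - 1) (n + 1) (- 1)) (vec (L - 1) (n - 1) 0) (vec (L - 1) (n - 2) 1) = 0"
    using tri_vec_translate13[of "n - 2" "L - 1" R 1] assms by (simp add: algebra_simps)
  moreover have "tri R (vec (L - 1) n 0) (vec (L - 1) (n - 1) 0) (vec (L - 1) (n - 2) 1) = core' R (L - 1) (L - n)"
    using core'_reflect[of R "L - 1" "n - 1"] by simp
  ultimately show ?thesis
    using tri_vec_consecutive[OF assms(1), of R "vec L (n + 1) (- 1)" "n - 1" 0] by (simp add: tri_add1)
qed

lemma tri_eliminate2:
  assumes "L \<ge> 0"
  shows "tri R (vec L n 0) (vec L (n - 1) 0) (vec L (n - 1) 1) = (1 - qe L) * qe n * core R (L - 1) (n - 1)"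
proof (cases "L = 0")
  case True
  then show ?thesis
    using tri_vec_consecutive[OF assms(1), of R _ "n - 1" 0] by simp
next
  case False
  then have L: "L - 1 \<ge> 0"
    using assms by simp
  have "vec L n 0 = (\<lambda>y. vec (L - 1) (n - 1) 0 y + qe n * vec (L - 1) n (- 1) y)"
    using vec_pascal2[OF L, of n 0] by (simp add: algebra_simps)
  moreover have "tri R (vec (L - 1) n (- 1)) (vec (L - 1) (n - 1) 0) (vec (L - 1) (n - 2) 1) = core R (L - 1) (n - 1)"
    by (simp add: core_def)
  ultimately show ?thesis
    using tri_vec_consecutive[OF assms(1), of R "vec L n 0" "n - 1" 0] by (simp add: tri_add1)
qed

text \<open>Expanding every vector by a Pascal rule leaves terms with a repeated vector, terms
  killed by translation, and values of \<open>core\<close> and \<open>core'\<close> one or two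
  levels down, so the system is closed. The factor 1 - q^L removes level -1 when
  \<open>L = 0\<close>.\<close>

lemma core_rec:
  assumes "L \<ge> 0" "\<bar>n\<bar> + L + 10 \<le> R"
  defines "m \<equiv> L + 1 - n"
  shows "core R (L + 1) n = qe (n - 1) * core' R L n
      - qe (m + n - 1) * ((1 - qe L) * qe (m - 2) * core' R (L - 1) (m - 1)) + qe (3 * m) * core R L (n - 1)"
    (is ?th1)
  and "core' R (L + 1) n = core' R L n - qe m * ((1 - qe L) * qe (m - 2) * core' R (L - 1) (m - 1))
      - qe (2 * m - 1) * ((1 - qe L) * qe n * core R (L - 1) (n - 1)) + qe (3 * m) * core' R L (n - 1)"
    (is ?th2)
proof -
  define a b c d e f where "a = vec L (n + 1) (- 1)" and "b = vec L n 0" and "c = vec L (n - 1) 1"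
    and "d = vec L (n - 2) 2" and "e = vec L (n - 1) 0" and "f = vec L (n - 2) 1"
  have v1: "vec (L + 1) (n + 1) (- 1) = (\<lambda>y. a y + qe (m - 1) * b y)"
    using vec_pascal1[OF assms(1), of "n + 1" "- 1"] by (simp add: a_def b_def m_def algebra_simps)
  have v2: "vec (L + 1) n 0 = (\<lambda>y. b y + qe m * c y)"
    using vec_pascal1[OF assms(1), of n 0] by (simp add: b_def c_def m_def algebra_simps)
  \<comment> \<open>The third vector is expanded in two ways: \<open>v3\<close> is used next to \<open>b\<close>, and \<open>v3'\<close> next to \<open>a\<close>,
    where the translation rule kills \<open>f\<close>.\<close>
  have v3: "vec (L + 1) (n - 1) 1 = (\<lambda>y. c y + qe (m + 1) * d y)"
    using vec_pascal1[OF assms(1), of "n - 1" 1] by (simp add: c_def d_def m_def algebra_simps)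
  have v3': "vec (L + 1) (n - 1) 1 = (\<lambda>y. f y + qe (n - 1) * e y)"
    using vec_pascal2[OF assms(1), of "n - 1" 1] by (simp add: f_def e_def algebra_simps)
  have v4: "vec (L + 1) (n - 1) 0 = (\<lambda>y. e y + qe (m + 1) * f y)"
    using vec_pascal1[OF assms(1), of "n - 1" 0] by (simp add: e_def f_def m_def algebra_simps)
  have af: "tri R a g f = 0" for g
    using tri_vec_translate13[of "n - 2" L R 1 g] assms by (simp add: a_def f_def algebra_simps)
  have abe: "tri R a b e = core' R L n"
    by (simp add: a_def b_def e_def core'_def)
  have ace: "tri R a c e = - ((1 - qe L) * qe (m - 2) * core' R (L - 1) (m - 1))"
    using tri_eliminate1[OF assms(1,2)] tri_swap23[of R a c e]
    by (simp add: a_def c_def e_def m_def algebra_simps)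
  have bce: "tri R b c e = - ((1 - qe L) * qe n * core R (L - 1) (n - 1))"
    using tri_eliminate2[OF assms(1), of R n] tri_swap23[of R b c e]
    by (simp add: b_def c_def e_def)
  have bcd: "tri R b c d = core R L (n - 1)"
    by (simp add: b_def c_def d_def core_shift)
  have bcf: "tri R b c f = core' R L (n - 1)"
    by (simp add: b_def c_def f_def core'_shift)
  have q1: "qe (m - 1) * (qe m * qe (m + 1)) = qe (3 * m)"
    by (simp add: qe_add[symmetric])
  have q2: "qe m * qe (n - 1) = qe (m + n - 1)"
    by (simp add: qe_add[symmetric] algebra_simps)
  have q3: "qe (m - 1) * qe m = qe (2 * m - 1)"
    by (simp add: qe_add[symmetric])
  have "core R (L + 1) n = tri R a (vec (L + 1) n 0) (\<lambda>y. f y + qe (n - 1) * e y) +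
      qe (m - 1) * tri R b (vec (L + 1) n 0) (\<lambda>y. c y + qe (m + 1) * d y)"
    unfolding core_def v1 tri_add1 v3[symmetric] v3'[symmetric] ..
  also have "tri R a (vec (L + 1) n 0) (\<lambda>y. f y + qe (n - 1) * e y) =
      qe (n - 1) * core' R L n - (qe m * qe (n - 1)) * ((1 - qe L) * qe (m - 2) * core' R (L - 1) (m - 1))"
    unfolding v2 tri_add2 tri_add3 af abe ace by (simp add: algebra_simps)
  also have "qe (m - 1) * tri R b (vec (L + 1) n 0) (\<lambda>y. c y + qe (m + 1) * d y) =
      (qe (m - 1) * (qe m * qe (m + 1))) * core R L (n - 1)"
    unfolding v2 tri_add2 tri_add3 bcd by (simp add: algebra_simps)
  finally show ?th1
    unfolding q1 q2 .
  have "core' R (L + 1) n = core' R L n - qe m * ((1 - qe L) * qe (m - 2) * core' R (L - 1) (m - 1))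
      - (qe (m - 1) * qe m) * ((1 - qe L) * qe n * core R (L - 1) (n - 1)) +
      (qe (m - 1) * (qe m * qe (m + 1))) * core' R L (n - 1)"
    unfolding core'_def[of R "L + 1"] v1 v2 v4 tri_add1 tri_add2 tri_add3 af abe ace bce bcf by (simp add: algebra_simps)
  then show ?th2
    unfolding q1 q3 .
qed

lemma core_0:
  assumes "\<bar>n\<bar> + 1 \<le> R"
  shows "core R 0 n = (if n = 0 then qe (- 2) else 0)" "core' R 0 n = (if n = 0 then qe (- 1) else 0)"
proof -
  have v: "vec 0 p l y = (if y = p then qe (l * p) else 0)" for p l y
    by (cases "y < p") (auto simp: vec_def qb_def)
  have *: "(\<Sum>(a, b, c)\<in>zero_sum_box R. weight a b c * (vec 0 (n + 1) j a * vec 0 n k b * vec 0 (n - 1) l c)) =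
    (if n = 0 then qe j * qe (- l) else 0)" for j k l
  proof (cases "n = 0")
    case True
    have "(\<Sum>(a, b, c)\<in>zero_sum_box R. weight a b c * (vec 0 (n + 1) j a * vec 0 n k b * vec 0 (n - 1) l c)) =
       (\<Sum>(a, b, c)\<in>{(1, 0, - 1)}. weight a b c * (vec 0 (n + 1) j a * vec 0 n k b * vec 0 (n - 1) l c))"
    proof (intro sum.mono_neutral_right finite_zero_sum_box)
      show "{(1, 0, - 1)} \<subseteq> zero_sum_box R"
        using assms True by (simp add: zero_sum_box_def)
    qed (auto simp: v True split: if_splits)
    then show ?thesis
      using True by (simp add: v weight_def chi_def)
  next
    case False
    then show ?thesis
      by (intro trans[OF sum.neutral]) (auto simp: zero_sum_box_def v)
  qed
  show "core R 0 n = (if n = 0 then qe (- 2) else 0)" "core' R 0 n = (if n = 0 then qe (- 1) else 0)"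
    unfolding core_def core'_def tri_def * by (simp_all add: qe_add[symmetric])
qed

definition core_val :: "int \<Rightarrow> int \<Rightarrow> 'a" where
  "core_val L n = qe (2 * n * (L - n) - 2) * qb L n"

text \<open>All terms are multiples of \<open>K\<close> by Laurent polynomials in q^n, q^m and q.
  After extracting \<open>K\<close>, both claims are rational identities in three letters.\<close>

lemma core_val_identities:
  fixes L n :: int
  assumes "L \<ge> 0"
  defines "m \<equiv> L + 1 - n"
  shows "qe (n - 1) * (qe 1 * core_val L n) - qe (m + n - 1) * ((1 - qe L) * qe (m - 2) * (qe 1 * core_val (L - 1) (m - 1)))
     + qe (3 * m) * core_val L (n - 1) = core_val (L + 1) n" (is ?th1)
  and "qe 1 * core_val L n - qe m * ((1 - qe L) * qe (m - 2) * (qe 1 * core_val (L - 1) (m - 1)))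
     - qe (2 * m - 1) * ((1 - qe L) * qe n * core_val (L - 1) (n - 1))
     + qe (3 * m) * (qe 1 * core_val L (n - 1)) = qe 1 * core_val (L + 1) n" (is ?th2)
proof -
  define K where "K = qe (2 * n * m - 2) * (qp L * ri n * ri m)"
  have nm: "L = n + m - 1"
    by (simp add: m_def)
  have s: "core_val (L + 1) n = (1 - qe n * qe m) * K"
  proof -
    have "qe (L + 1) = qe n * qe m"
      by (simp add: qe_add[symmetric] nm)
    then have "qp (L + 1) = (1 - qe n * qe m) * qp L"
      using qp_Suc[OF assms(1)] by simp
    then show ?thesis
      by (simp add: core_val_def qb_def K_def m_def)
  qed
  have "ri (L - n) = (1 - qe m) * ri m"
    using ri_pred[of m] by (simp add: nm)
  moreover have "qe (2 * n * (L - n) - 2) = qe (- n) * qe (- n) * qe (2 * n * m - 2)"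
    by (simp add: qe_add[symmetric] nm algebra_simps)
  ultimately have s1: "core_val L n = qe (- n) * qe (- n) * (1 - qe m) * K"
    by (simp add: core_val_def qb_def K_def)
  have "ri (n - 1) = (1 - qe n) * ri n"
    by (rule ri_pred)
  moreover have "qe (2 * (n - 1) * (L - (n - 1)) - 2) = qe (- m) * qe (- m) * qe (2 * n * m - 2)"
    by (simp add: qe_add[symmetric] nm algebra_simps)
  ultimately have s2: "core_val L (n - 1) = qe (- m) * qe (- m) * (1 - qe n) * K"
    by (simp add: core_val_def qb_def K_def nm)
  \<comment> \<open>At \<open>L = 0\<close> the arguments n - 1 and m - 1 add up to -1, so one
    reciprocal is 0 and both sides vanish.\<close>
  have q: "(1 - qe L) * (qp (L - 1) * ri (n - 1) * ri (m - 1)) = qp L * ri (n - 1) * ri (m - 1)"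
  proof (cases "L = 0")
    case True
    then have "n - 1 < 0 \<or> m - 1 < 0"
      using nm by linarith
    then show ?thesis
      by auto
  next
    case False
    then have "qp L = (1 - qe L) * qp (L - 1)"
      using qp_Suc[of "L - 1"] assms(1) by simp
    then show ?thesis
      by simp
  qed
  have e: "qe (2 * (n - 1) * (m - 1) - 2) = qe 1 * qe 1 * qe (- n) * qe (- n) * qe (- m) * qe (- m) * qe (2 * n * m - 2)"
    by (simp add: qe_add[symmetric] algebra_simps)
  have s3: "(1 - qe L) * core_val (L - 1) (n - 1) = qe 1 * qe 1 * qe (- n) * qe (- n) * qe (- m) * qe (- m) * ((1 - qe n) * (1 - qe m)) * K"
  proof -
    have "L - 1 - (n - 1) = m - 1"
      by (simp add: nm)
    then have "(1 - qe L) * core_val (L - 1) (n - 1) = qe (2 * (n - 1) * (m - 1) - 2) * ((1 - qe L) * (qp (L - 1) * ri (n - 1) * ri (m - 1)))"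
      unfolding core_val_def qb_def by simp
    then have "(1 - qe L) * core_val (L - 1) (n - 1) = qe (2 * (n - 1) * (m - 1) - 2) * (qp L * ri (n - 1) * ri (m - 1))"
      unfolding q .
    then show ?thesis
      unfolding e ri_pred[of n] ri_pred[of m] K_def by (simp only: mult_ac)
  qed
  have s4: "core_val (L - 1) (m - 1) = core_val (L - 1) (n - 1)"
    by (simp add: core_val_def qb_def nm algebra_simps)
  define N M u where "N = qe n" and "M = qe m" and "u = qe 1"
  have inv: "qe (- j) = inverse (qe j)" for j
    by (simp add: qe_def power_int_minus)
  have nz: "N \<noteq> 0" "M \<noteq> 0" "u \<noteq> 0"
    by (simp_all add: N_def M_def u_def)
  have r: "qe (n - 1) = N * inverse u" "qe (m + n - 1) = M * N * inverse u" "qe (m - 2) = M * inverse u * inverse u"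
      "qe (3 * m) = M * M * M" "qe (2 * m - 1) = M * M * inverse u"
    unfolding N_def M_def u_def inv[symmetric] by (simp_all add: qe_add[symmetric])
  have s5: "(1 - qe L) * x * (y * core_val (L - 1) (n - 1)) = x * y * ((1 - qe L) * core_val (L - 1) (n - 1))" for x y
    by (simp only: mult_ac)
  have s6: "(1 - qe L) * x * core_val (L - 1) (n - 1) = x * ((1 - qe L) * core_val (L - 1) (n - 1))" for x
    by (simp only: mult_ac)
  show ?th1
    unfolding s s1 s2 s4 s5 s3 inv r N_def[symmetric] M_def[symmetric] u_def[symmetric]
    using nz by (simp add: field_simps)
  show ?th2
    unfolding s s1 s2 s4 s5 s6 s3 inv r N_def[symmetric] M_def[symmetric] u_def[symmetric]
    using nz by (simp add: field_simps)
qed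

text \<open>The quantity |2 n - L| + L does not increase along the arguments of
  \<open>core_rec\<close>, including the reflected one, so one cut-off \<open>R\<close> serves the
  whole induction; it also dominates the bound that \<open>core_rec\<close> asks for.\<close>

lemma core_eq:
  assumes "2 * (\<bar>2 * n - int L\<bar> + int L) + 20 \<le> R"
  shows "core R (int L) n = core_val (int L) n \<and> core' R (int L) n = qe 1 * core_val (int L) n"
  using assms
proof (induction L arbitrary: n rule: less_induct)
  case (less L)
  show ?case
  proof (cases L)
    case 0
    have "core_val 0 n = (if n = 0 then qe (- 2) else 0)"
      by (cases n "0 :: int" rule: linorder_cases) (auto simp: core_val_def qb_def)
    then show ?thesis
      using core_0[of n R] less.prems 0 by (auto simp: qe_add[symmetric])
  next
    case (Suc l)
    define m where "m = int l + 1 - n"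
    have Lsuc: "int L = int l + 1"
      using Suc by simp
    have R: "\<bar>n\<bar> + int l + 10 \<le> R"
      using less.prems Lsuc by (simp add: abs_if split: if_splits)
    have IH: "core R (int l) n = core_val (int l) n" "core' R (int l) n = qe 1 * core_val (int l) n"
       "core R (int l) (n - 1) = core_val (int l) (n - 1)" "core' R (int l) (n - 1) = qe 1 * core_val (int l) (n - 1)"
    proof -
      have "2 * (\<bar>2 * n - int l\<bar> + int l) + 20 \<le> R" "2 * (\<bar>2 * (n - 1) - int l\<bar> + int l) + 20 \<le> R"
        using less.prems Lsuc by (simp_all add: abs_if split: if_splits)
      then show "core R (int l) n = core_val (int l) n" "core' R (int l) n = qe 1 * core_val (int l) n"
       "core R (int l) (n - 1) = core_val (int l) (n - 1)" "core' R (int l) (n - 1) = qe 1 * core_val (int l) (n - 1)"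
        using less.IH[of l n] less.IH[of l "n - 1"] Suc by simp_all
    qed
    \<comment> \<open>Kept with the factor 1 - q^l: for \<open>l = 0\<close> it vanishes, and level
      -1 need not be evaluated.\<close>
    have "(1 - qe (int l)) * core R (int l - 1) (n - 1) = (1 - qe (int l)) * core_val (int l - 1) (n - 1) \<and>
      (1 - qe (int l)) * core' R (int l - 1) (m - 1) = (1 - qe (int l)) * (qe 1 * core_val (int l - 1) (m - 1))"
    proof (cases l)
      case (Suc l')
      then have l': "int l - 1 = int l'" "l' < L"
        using \<open>L = Suc l\<close> by simp_all
      have "2 * (\<bar>2 * (n - 1) - int l'\<bar> + int l') + 20 \<le> R" "2 * (\<bar>2 * (m - 1) - int l'\<bar> + int l') + 20 \<le> R"
        using less.prems Lsuc l' by (simp_all add: m_def abs_if split: if_splits)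
      then show ?thesis
        using less.IH[OF l'(2), of "n - 1"] less.IH[OF l'(2), of "m - 1"] unfolding l'(1) by simp
    qed simp
    then have IH': "(1 - qe (int l)) * x * core R (int l - 1) (n - 1) = (1 - qe (int l)) * x * core_val (int l - 1) (n - 1)"
      "(1 - qe (int l)) * x * core' R (int l - 1) (m - 1) = (1 - qe (int l)) * x * (qe 1 * core_val (int l - 1) (m - 1))" for x
      by (auto simp: mult_ac)
    show ?thesis
      unfolding Lsuc core_rec[OF of_nat_0_le_iff R, folded m_def] IH IH'
      using core_val_identities[of "int l" n, folded m_def] by simp
  qed
qed

end

subsection \<open>Iteration of the invariance property\<close>

context qfield
begin

text \<open>The triples of \<open>tri_pair1\<close>, \<open>tri_pair2\<close> and
  \<open>tri_pair3\<close> belong to s = k + 1, s = k and s = 1. Here, after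
  \<open>tri_vec_consecutive\<close>, one term of the first vector repeats the second vector and the
  other gives \<open>core\<close>.\<close>

lemma tri_pair1:
  assumes "L \<ge> 1"
  shows "tri R (vec L (n + 1) (- 1)) (vec L n 0) (vec L n 1) = (1 - qe L) * core R (L - 1) n"
proof -
  have "vec L (n + 1) (- 1) = (\<lambda>y. vec (L - 1) (n + 1) (- 1) y + qe (L - 1 - n) * vec (L - 1) n 0 y)"
    using vec_pascal1[of "L - 1" "n + 1" "- 1"] assms by (simp add: algebra_simps)
  then show ?thesis
    using tri_vec_consecutive[of L R "vec L (n + 1) (- 1)" n 0] assms by (simp add: tri_add1 core_def)
qed

lemma tri_pair2:
  assumes "L \<ge> 1"
  shows "tri R (vec L (n + 1) 0) (vec L n 0) (vec L n 1) = qe (n + 1) * (1 - qe L) * core R (L - 1) n"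
proof -
  have "vec L (n + 1) 0 = (\<lambda>y. vec (L - 1) n 0 y + qe (n + 1) * vec (L - 1) (n + 1) (- 1) y)"
    using vec_pascal2[of "L - 1" "n + 1" 0] assms by simp
  then show ?thesis
    using tri_vec_consecutive[of L R "vec L (n + 1) 0" n 0] assms by (simp add: tri_add1 core_def)
qed

lemma tri_pair3:
  assumes "L \<ge> 2"
  shows "tri R (vec L (n + 1) (- 1)) (vec L (n + 1) 0) (vec L (n + 1) 1) =
    (1 - qe L)\<^sup>2 * (1 - qe (L - 1)) * core R (L - 2) n"
proof -
  define a b d e where "a = vec (L - 1) (n + 1) (- 1)" and "b = vec (L - 1) n 0"
    and "d = vec (L - 1) (n + 1) 0" and "e = vec (L - 1) n 1"
  define F where "F = vec L (n + 1) (- 1)"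
  have F: "F = (\<lambda>y. a y + qe (L - 1 - n) * b y)"
    using vec_pascal1[of "L - 1" "n + 1" "- 1"] assms by (simp add: a_def b_def F_def algebra_simps)
  \<comment> \<open>The middle vector is expanded in two ways: with \<open>e\<close>, which repeats
    the third vector and drops out, and below in terms of \<open>a\<close> and \<open>b\<close>,
    which also span \<open>F\<close>. Comparison gives the determinant 1 - q^L.\<close>
  have "vec L (n + 1) 0 = (\<lambda>y. d y + qe (L - 1 - n) * e y)"
    using vec_pascal1[of "L - 1" "n + 1" 0] assms by (simp add: d_def e_def algebra_simps)
  then have "tri R F (vec L (n + 1) 0) e = tri R F d e"
    by (simp add: tri_add2)
  moreover have "vec L (n + 1) 0 = (\<lambda>y. b y + qe (n + 1) * a y)"
    using vec_pascal2[of "L - 1" "n + 1" 0] assms by (simp add: a_def b_def)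
  then have "tri R F (vec L (n + 1) 0) e = tri R a b e + (qe (L - 1 - n) * qe (n + 1)) * tri R b a e"
    unfolding F by (simp add: tri_add1 tri_add2)
  moreover have "qe (L - 1 - n) * qe (n + 1) = qe L"
    by (simp add: qe_add[symmetric])
  ultimately have "tri R F d e = tri R a b e + qe L * tri R b a e"
    by simp
  then have "tri R F d e = (1 - qe L) * tri R a b e"
    unfolding tri_swap12[of R b a e] by (simp add: algebra_simps)
  moreover have "tri R a b e = (1 - qe (L - 1)) * core R (L - 2) n"
    using tri_pair1[of "L - 1" R n] assms by (simp add: a_def b_def e_def)
  moreover have "tri R F (vec L (n + 1) 0) (vec L (n + 1) 1) = (1 - qe L) * tri R F d e"
    using tri_vec_consecutive[of L R F "n + 1" 0] assms by (simp add: d_def e_def)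
  ultimately show ?thesis
    by (simp add: F_def power2_eq_square)
qed

lemma core_eq_nat:
  assumes "4 * (int n + int m) + 20 \<le> R"
  shows "core R (int n + int m) (int n) = qe (2 * int n * int m - 2) * (qp (int n + int m) * ri (int n) * ri (int m))"
proof -
  have "2 * (\<bar>2 * int n - int (n + m)\<bar> + int (n + m)) + 20 \<le> R"
    using assms by (simp add: abs_if)
  from core_eq[OF this] show ?thesis
    by (simp add: core_val_def qb_def)
qed

text \<open>The shifts turn a zero-sum triple into parameters of total -1, as the linear exponents
  require for shift 1; in \<open>psi_2_eq\<close> the total is -3, as required for shift 2.\<close>

lemma psi_1_eq:
  "psi 1 (a - 1) b c n m * qp (n + m + 1) ^ 2 = qb (n + m + 1) (n + 1 - a) * qb (n + m + 1) (n - b) * qb (n + m + 1) (n - c)"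
  by (simp add: psi_def qb_def power2_eq_square algebra_simps)

lemma psi_2_eq:
  "psi 2 (a - 1) (b - 1) (c - 1) n m * qp (n + m + 2) ^ 2 = qb (n + m + 2) (n + 1 - a) * qb (n + m + 2) (n + 1 - b) * qb (n + m + 2) (n + 1 - c)"
  by (simp add: psi_def qb_def power2_eq_square algebra_simps)

definition beta0 :: "int \<Rightarrow> nat \<Rightarrow> nat \<Rightarrow> 'a" where
  "beta0 d n m = qe (2 * int n * int m + d * int n) * (ri (int n) * ri (int m) * ri (int n + int m + 1))"

lemma beta0_expansion1:
  assumes "4 * (int n + int m) + 20 \<le> R"
  shows "beta0 0 n m = (\<Sum>(a, b, c)\<in>zero_sum_box R. weight a b c * (qe (c - a + 2) * psi 2 (a - 1) (b - 1) (c - 1) (int n) (int m)))"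
proof -
  define L where "L = int n + int m + 2"
  \<comment> \<open>Each kernel is a product of three q-binomial coefficients divided by (q)_L^2, so
    multiplying by this square produces a value of \<open>tri\<close>.\<close>
  have "(\<Sum>(a, b, c)\<in>zero_sum_box R. weight a b c * (qe (c - a + 2) * psi 2 (a - 1) (b - 1) (c - 1) (int n) (int m))) * qp L ^ 2 =
     (\<Sum>(a, b, c)\<in>zero_sum_box R. qe 2 * (weight a b c * (vec L (int n + 1) (- 1) a * vec L (int n + 1) 0 b * vec L (int n + 1) 1 c)))"
    unfolding sum_distrib_right
  proof (intro sum.cong refl, clarify)
    fix a b c
    have "qe (c - a + 2) = qe 2 * (qe (- a) * qe c)"
      by (simp add: qe_add[symmetric] algebra_simps)
    then have "weight a b c * (qe (c - a + 2) * psi 2 (a - 1) (b - 1) (c - 1) (int n) (int m)) * qp L ^ 2 =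
      qe 2 * (qe (- a) * qe c) * weight a b c * (psi 2 (a - 1) (b - 1) (c - 1) (int n) (int m) * qp L ^ 2)"
      by (simp only: mult_ac)
    then show "weight a b c * (qe (c - a + 2) * psi 2 (a - 1) (b - 1) (c - 1) (int n) (int m)) * qp L ^ 2 =
       qe 2 * (weight a b c * (vec L (int n + 1) (- 1) a * vec L (int n + 1) 0 b * vec L (int n + 1) 1 c))"
      unfolding L_def psi_2_eq vec_def by (simp add: mult_ac)
  qed
  also have "\<dots> = qe 2 * tri R (vec L (int n + 1) (- 1)) (vec L (int n + 1) 0) (vec L (int n + 1) 1)"
    by (simp add: tri_def sum_distrib_left case_prod_unfold)
  also have "\<dots> = qe 2 * ((1 - qe L)\<^sup>2 * (1 - qe (L - 1)) * (qe (2 * int n * int m - 2) * (qp (L - 2) * ri (int n) * ri (int m))))"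
    using tri_pair3[of L R "int n"] core_eq_nat[OF assms] by (simp add: L_def)
  also have "\<dots> = beta0 0 n m * qp L ^ 2"
  proof -
    have "L - 2 \<ge> 0"
      by (simp add: L_def)
    then have A: "qp L = (1 - qe L) * qp (L - 1)" and B: "(1 - qe (L - 1)) * qp (L - 2) = qp (L - 1)"
      using qp_Suc[of "L - 2"] qp_Suc[of "L - 1"] by simp_all
    have C: "qe 2 * qe (2 * int n * int m - 2) = qe (2 * int n * int m)"
      by (simp add: qe_add[symmetric])
    have D: "qp (L - 1) * ri (L - 1) = 1"
      by (rule qp_ri) (simp add: L_def)
    have E: "int n + int m + 1 = L - 1"
      by (simp add: L_def)
    have "qe 2 * ((1 - qe L)\<^sup>2 * (1 - qe (L - 1)) * (qe (2 * int n * int m - 2) * (qp (L - 2) * ri (int n) * ri (int m)))) =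
      (qe 2 * qe (2 * int n * int m - 2)) * (1 - qe L)\<^sup>2 * ((1 - qe (L - 1)) * qp (L - 2)) * ri (int n) * ri (int m) * (qp (L - 1) * ri (L - 1))"
      unfolding D by (simp add: mult_ac)
    also have "\<dots> = beta0 0 n m * qp L ^ 2"
      unfolding B C A beta0_def E by (simp add: power2_eq_square mult_ac)
    finally show ?thesis .
  qed
  finally show ?thesis
    by simp
qed

lemma beta0_expansion_aux:
  assumes "4 * (int n + int m) + 20 \<le> R"
  defines "L \<equiv> int n + int m + 1"
  assumes "tri R (vec L (int n + 1) l) (vec L (int n) 0) (vec L (int n) 1) = x * (1 - qe L) * core R (L - 1) (int n)"
    and "qe e * x * qe (2 * int n * int m - 2) = qe (2 * int n * int m + d * int n)"
  shows "beta0 d n m = (\<Sum>(a, b, c)\<in>zero_sum_box R. weight a b c * (qe (c + l * a + e) * psi 1 (a - 1) b c (int n) (int m)))"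
proof -
  have "(\<Sum>(a, b, c)\<in>zero_sum_box R. weight a b c * (qe (c + l * a + e) * psi 1 (a - 1) b c (int n) (int m))) * qp L ^ 2 =
     (\<Sum>(a, b, c)\<in>zero_sum_box R. qe e * (weight a b c * (vec L (int n + 1) l a * vec L (int n) 0 b * vec L (int n) 1 c)))"
    unfolding sum_distrib_right
  proof (intro sum.cong refl, clarify)
    fix a b c
    have "qe (c + l * a + e) = qe e * (qe (l * a) * qe c)"
      by (simp add: qe_add[symmetric] algebra_simps)
    then have "weight a b c * (qe (c + l * a + e) * psi 1 (a - 1) b c (int n) (int m)) * qp L ^ 2 =
      qe e * (qe (l * a) * qe c) * weight a b c * (psi 1 (a - 1) b c (int n) (int m) * qp L ^ 2)"
      by (simp only: mult_ac)
    then show "weight a b c * (qe (c + l * a + e) * psi 1 (a - 1) b c (int n) (int m)) * qp L ^ 2 =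
       qe e * (weight a b c * (vec L (int n + 1) l a * vec L (int n) 0 b * vec L (int n) 1 c))"
      unfolding L_def psi_1_eq vec_def by (simp add: mult_ac)
  qed
  also have "\<dots> = qe e * tri R (vec L (int n + 1) l) (vec L (int n) 0) (vec L (int n) 1)"
    by (simp add: tri_def sum_distrib_left case_prod_unfold)
  also have "\<dots> = qe e * x * qe (2 * int n * int m - 2) * ((1 - qe L) * (qp (L - 1) * ri (int n) * ri (int m)))"
    using assms(3) core_eq_nat[OF assms(1)] by (simp add: L_def)
  also have "\<dots> = beta0 d n m * qp L ^ 2"
  proof -
    have "qp L = (1 - qe L) * qp (L - 1)"
      using qp_Suc[of "L - 1"] by (simp add: L_def)
    moreover have "qp L * ri L = 1"
      by (rule qp_ri) (simp add: L_def)
    ultimately show ?thesis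
      unfolding assms(4) beta0_def by (simp add: power2_eq_square L_def[symmetric] mult_ac)
  qed
  finally show ?thesis
    by (simp add: L_def)
qed

lemma beta0_expansion2:
  assumes "4 * (int n + int m) + 20 \<le> R"
  shows "beta0 0 n m = (\<Sum>(a, b, c)\<in>zero_sum_box R. weight a b c * (qe (c - a + 2) * psi 1 (a - 1) b c (int n) (int m)))"
proof -
  have "qe 2 * 1 * qe (2 * int n * int m - 2) = qe (2 * int n * int m + 0 * int n)"
    by (simp add: qe_add[symmetric])
  from beta0_expansion_aux[OF assms _ this, of "- 1"] show ?thesis
    using tri_pair1[of "int n + int m + 1" R "int n"] by simp
qed

lemma beta0_expansion3:
  assumes "4 * (int n + int m) + 20 \<le> R"
  shows "beta0 1 n m = (\<Sum>(a, b, c)\<in>zero_sum_box R. weight a b c * (qe (c + 1) * psi 1 (a - 1) b c (int n) (int m)))"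
proof -
  have "qe 1 * qe (int n + 1) * qe (2 * int n * int m - 2) = qe (2 * int n * int m + 1 * int n)"
    by (simp add: qe_add[symmetric] algebra_simps)
  from beta0_expansion_aux[OF assms _ this, of 0] show ?thesis
    using tri_pair2[of "int n + int m + 1" R "int n"] by simp
qed

lemma sum_int_nat: "(\<Sum>n\<in>{0..int N}. f n) = (\<Sum>n\<le>N. f (int n))" for f :: "int \<Rightarrow> 'b :: comm_monoid_add"
  by (rule sum.reindex_bij_witness[of _ int nat]) auto

primrec beta :: "int \<Rightarrow> int \<Rightarrow> nat \<Rightarrow> nat \<Rightarrow> nat \<Rightarrow> 'a" where
  "beta \<epsilon> d 0 = beta0 d"
| "beta \<epsilon> d (Suc i) = (\<lambda>N M. \<Sum>n\<le>N. \<Sum>m\<le>M.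
     qe ((int n)\<^sup>2 - int n * int m + (int m)\<^sup>2 + \<epsilon> * int n + int m) *
     (ri (int N - int n) * ri (int M - int m) * beta \<epsilon> d i n m))"

text \<open>A step multiplies the kernel with index y by q^(t y), so i steps multiply it by q^(i t
  y). The assumptions \<open>lin1\<close> and \<open>lin2\<close> match the linear exponents of a
  step with those of \<open>psi_invariance\<close>; together they say \<open>r\<close> = 1 +
  \<open>\<epsilon>\<close>.\<close>

lemma beta_expansion:
  assumes base: "\<And>n m. n \<le> N \<Longrightarrow> m \<le> M \<Longrightarrow>
      beta0 d n m = (\<Sum>y\<in>Y. w y * psi r (x1 y) (x2 y) (x3 y) (int n) (int m))"
    and pos: "\<And>y. y \<in> Y \<Longrightarrow> w y \<noteq> 0 \<Longrightarrow> x1 y \<ge> 0 \<or> x2 y \<ge> 0 \<or> x3 y \<ge> 0"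
    and neg: "\<And>y. y \<in> Y \<Longrightarrow> w y \<noteq> 0 \<Longrightarrow> x1 y \<le> - r \<or> x2 y \<le> - r \<or> x3 y \<le> - r"
    and lin1: "\<And>y. y \<in> Y \<Longrightarrow> x1 y + x2 y + x3 y + r = - \<epsilon>"
    and lin2: "\<And>y. y \<in> Y \<Longrightarrow> 2 * r + x1 y + x2 y + x3 y = 1"
    and t: "\<And>y. y \<in> Y \<Longrightarrow> t y = - (r * (x1 y + x2 y + x3 y) + r\<^sup>2 + x1 y * x2 y + x1 y * x3 y + x2 y * x3 y)"
  shows "n \<le> N \<Longrightarrow> m \<le> M \<Longrightarrow>
     beta \<epsilon> d i n m = (\<Sum>y\<in>Y. w y * qe (int i * t y) * psi r (x1 y) (x2 y) (x3 y) (int n) (int m))"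
proof (induction i arbitrary: n m)
  case 0
  then show ?case
    using base by simp
next
  case (Suc i)
  define A where "A n' m' = qe ((int n')\<^sup>2 - int n' * int m' + (int m')\<^sup>2 + \<epsilon> * int n' + int m') *
     (ri (int n - int n') * ri (int m - int m'))" for n' m'
  have "beta \<epsilon> d (Suc i) n m = (\<Sum>n'\<le>n. \<Sum>m'\<le>m. A n' m' * beta \<epsilon> d i n' m')"
    by (simp add: A_def mult.assoc)
  also have "\<dots> = (\<Sum>n'\<le>n. \<Sum>m'\<le>m. \<Sum>y\<in>Y. w y * qe (int i * t y) * (A n' m' * psi r (x1 y) (x2 y) (x3 y) (int n') (int m')))"
    using Suc.prems by (intro sum.cong refl) (simp add: Suc.IH sum_distrib_left mult_ac)
  also have "\<dots> = (\<Sum>y\<in>Y. \<Sum>n'\<le>n. \<Sum>m'\<le>m. w y * qe (int i * t y) * (A n' m' * psi r (x1 y) (x2 y) (x3 y) (int n') (int m')))"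
    by (subst sum.swap[of _ _ "{..m}"], subst sum.swap[of _ _ "{..n}"]) (rule refl)
  also have "\<dots> = (\<Sum>y\<in>Y. w y * qe (int i * t y) * (\<Sum>n'\<le>n. \<Sum>m'\<le>m. A n' m' * psi r (x1 y) (x2 y) (x3 y) (int n') (int m')))"
    by (simp only: sum_distrib_left)
  also have "\<dots> = (\<Sum>y\<in>Y. w y * qe (int (Suc i) * t y) * psi r (x1 y) (x2 y) (x3 y) (int n) (int m))"
  proof (intro sum.cong refl)
    fix y assume y: "y \<in> Y"
    show "w y * qe (int i * t y) * (\<Sum>n'\<le>n. \<Sum>m'\<le>m. A n' m' * psi r (x1 y) (x2 y) (x3 y) (int n') (int m')) =
       w y * qe (int (Suc i) * t y) * psi r (x1 y) (x2 y) (x3 y) (int n) (int m)"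
    proof (cases "w y = 0")
      case False
      have "(\<Sum>n'\<le>n. \<Sum>m'\<le>m. A n' m' * psi r (x1 y) (x2 y) (x3 y) (int n') (int m')) =
         qe (t y) * psi r (x1 y) (x2 y) (x3 y) (int n) (int m)"
        using psi_invariance[OF pos[OF y False] neg[OF y False], of "int n" "int m"]
        unfolding t[OF y, symmetric] lin1[OF y] lin2[OF y] sum_int_nat A_def
        by (simp add: mult.assoc)
      moreover have "qe (int (Suc i) * t y) = qe (int i * t y) * qe (t y)"
        by (simp add: qe_add[symmetric] algebra_simps)
      ultimately show ?thesis
        by simp
    qed simp
  qed
  finally show ?case .
qed

text \<open>A nonzero weight excludes the zero triple, so some entry is positive and some negative.
  After the shifts by 1 these are the support conditions of \<open>psi_invariance\<close>.\<close>

lemma chi_nonzero_imp: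
  assumes "chi (b - c) \<noteq> 0" "a + b + c = (0 :: int)"
  shows "a \<ge> 1 \<or> b \<ge> 1 \<or> c \<ge> 1" "a \<le> - 1 \<or> b \<le> - 1 \<or> c \<le> - 1"
proof -
  have "b \<noteq> c"
    using assms(1) by (auto simp: chi_def)
  then show "a \<ge> 1 \<or> b \<ge> 1 \<or> c \<ge> 1" "a \<le> - 1 \<or> b \<le> - 1 \<or> c \<le> - 1"
    using assms(2) by auto
qed

lemma beta_expansion1:
  assumes "4 * (int N + int M) + 20 \<le> R"
  shows "beta 1 0 i N M = (\<Sum>(a, b, c)\<in>zero_sum_box R. weight a b c *
     qe (c - a + 2 + int i * (- 1 - (a * b + a * c + b * c))) * psi 2 (a - 1) (b - 1) (c - 1) (int N) (int M))"
proof -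
  have "beta 1 0 i N M = (\<Sum>y\<in>zero_sum_box R. (case y of (a, b, c) \<Rightarrow> weight a b c * qe (c - a + 2)) *
     qe (int i * (case y of (a, b, c) \<Rightarrow> - 1 - (a * b + a * c + b * c))) *
     psi 2 (fst y - 1) (fst (snd y) - 1) (snd (snd y) - 1) (int N) (int M))"
  proof (rule beta_expansion[OF _ _ _ _ _ _ order.refl order.refl])
    fix n m assume "n \<le> N" "m \<le> M"
    then have "int n \<le> int N" "int m \<le> int M"
      by simp_all
    then have "4 * (int n + int m) + 20 \<le> R"
      using assms by simp
    then show "beta0 0 n m = (\<Sum>y\<in>zero_sum_box R. (case y of (a, b, c) \<Rightarrow> weight a b c * qe (c - a + 2)) *
        psi 2 (fst y - 1) (fst (snd y) - 1) (snd (snd y) - 1) (int n) (int m))"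
      by (subst beta0_expansion1) (auto intro!: sum.cong simp: mult.assoc)
  next
    fix y assume y: "y \<in> zero_sum_box R" "(case y of (a, b, c) \<Rightarrow> weight a b c * qe (c - a + 2)) \<noteq> 0"
    obtain a b c where [simp]: "y = (a, b, c)"
      by (cases y)
    have "a + b + c = 0" "chi (b - c) \<noteq> 0"
      using y by (auto simp: zero_sum_box_def weight_def)
    from chi_nonzero_imp[OF this(2,1)]
    show "fst y - 1 \<ge> 0 \<or> fst (snd y) - 1 \<ge> 0 \<or> snd (snd y) - 1 \<ge> 0"
      "fst y - 1 \<le> - 2 \<or> fst (snd y) - 1 \<le> - 2 \<or> snd (snd y) - 1 \<le> - 2"
      by auto
  qed (auto simp: zero_sum_box_def algebra_simps)
  then show ?thesis
    by (simp add: case_prod_unfold qe_add mult.assoc)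
qed

lemma beta_expansion_aux:
  assumes "\<And>n m. n \<le> N \<Longrightarrow> m \<le> M \<Longrightarrow> beta0 d n m =
      (\<Sum>(a, b, c)\<in>zero_sum_box R. weight a b c * (qe (l a c) * psi 1 (a - 1) b c (int n) (int m)))"
  shows "beta 0 d i N M = (\<Sum>(a, b, c)\<in>zero_sum_box R. weight a b c *
     qe (l a c + int i * (- a - (a * b + a * c + b * c))) * psi 1 (a - 1) b c (int N) (int M))"
proof -
  have "beta 0 d i N M = (\<Sum>y\<in>zero_sum_box R. (case y of (a, b, c) \<Rightarrow> weight a b c * qe (l a c)) *
     qe (int i * (case y of (a, b, c) \<Rightarrow> - a - (a * b + a * c + b * c))) *
     psi 1 (fst y - 1) (fst (snd y)) (snd (snd y)) (int N) (int M))"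
  proof (rule beta_expansion[OF _ _ _ _ _ _ order.refl order.refl])
    fix n m assume "n \<le> N" "m \<le> M"
    then show "beta0 d n m = (\<Sum>y\<in>zero_sum_box R. (case y of (a, b, c) \<Rightarrow> weight a b c * qe (l a c)) *
        psi 1 (fst y - 1) (fst (snd y)) (snd (snd y)) (int n) (int m))"
      by (subst assms) (auto intro!: sum.cong simp: mult.assoc)
  next
    fix y assume y: "y \<in> zero_sum_box R" "(case y of (a, b, c) \<Rightarrow> weight a b c * qe (l a c)) \<noteq> 0"
    obtain a b c where [simp]: "y = (a, b, c)"
      by (cases y)
    have "a + b + c = 0" "chi (b - c) \<noteq> 0"
      using y by (auto simp: zero_sum_box_def weight_def)
    from chi_nonzero_imp[OF this(2,1)]
    show "fst y - 1 \<ge> 0 \<or> fst (snd y) \<ge> 0 \<or> snd (snd y) \<ge> 0"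
      "fst y - 1 \<le> - 1 \<or> fst (snd y) \<le> - 1 \<or> snd (snd y) \<le> - 1"
      by auto
  next
    fix y assume "y \<in> zero_sum_box R"
    then show "(case y of (a, b, c) \<Rightarrow> - a - (a * b + a * c + b * c)) =
      - (1 * (fst y - 1 + fst (snd y) + snd (snd y)) + 1\<^sup>2 + (fst y - 1) * fst (snd y) +
         (fst y - 1) * snd (snd y) + fst (snd y) * snd (snd y))"
      by (auto simp: zero_sum_box_def algebra_simps)
  qed (auto simp: zero_sum_box_def algebra_simps)
  then show ?thesis
    by (simp add: case_prod_unfold qe_add mult.assoc)
qed

lemma beta_expansion2:
  assumes "4 * (int N + int M) + 20 \<le> R"
  shows "beta 0 0 i N M = (\<Sum>(a, b, c)\<in>zero_sum_box R. weight a b c *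
     qe (c - a + 2 + int i * (- a - (a * b + a * c + b * c))) * psi 1 (a - 1) b c (int N) (int M))"
proof (rule beta_expansion_aux)
  fix n m assume "n \<le> N" "m \<le> M"
  then have "int n \<le> int N" "int m \<le> int M"
    by simp_all
  then have "4 * (int n + int m) + 20 \<le> R"
    using assms by simp
  from beta0_expansion2[OF this] show "beta0 0 n m = (\<Sum>(a, b, c)\<in>zero_sum_box R. weight a b c *
      (qe (c - a + 2) * psi 1 (a - 1) b c (int n) (int m)))" .
qed

lemma beta_expansion3:
  assumes "4 * (int N + int M) + 20 \<le> R"
  shows "beta 0 1 i N M = (\<Sum>(a, b, c)\<in>zero_sum_box R. weight a b c *
     qe (c + 1 + int i * (- a - (a * b + a * c + b * c))) * psi 1 (a - 1) b c (int N) (int M))"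
proof (rule beta_expansion_aux)
  fix n m assume "n \<le> N" "m \<le> M"
  then have "int n \<le> int N" "int m \<le> int M"
    by simp_all
  then have "4 * (int n + int m) + 20 \<le> R"
    using assms by simp
  from beta0_expansion3[OF this] show "beta0 1 n m = (\<Sum>(a, b, c)\<in>zero_sum_box R. weight a b c *
      (qe (c + 1) * psi 1 (a - 1) b c (int n) (int m)))" .
qed

end

section \<open>From the Bailey chain to the multisum\<close>

lemma sum_PiE_insert:
  assumes "r \<notin> S"
  shows "(\<Sum>f\<in>PiE (insert r S) T. F f) = (\<Sum>x\<in>T r. \<Sum>g\<in>PiE S T. F (g(r := x)))"
proof -
  have "(\<Sum>f\<in>PiE (insert r S) T. F f) = (\<Sum>(x, g)\<in>T r \<times> PiE S T. F (g(r := x)))"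
    by (rule sum.reindex_bij_witness[of _ "\<lambda>(x, g). g(r := x)" "\<lambda>f. (f r, f(r := undefined))"])
      (use assms in \<open>auto simp: PiE_def Pi_def extensional_def fun_eq_iff\<close>)
  then show ?thesis
    by (simp add: sum.cartesian_product)
qed

lemma sum_swap3: "(\<Sum>x\<in>A. \<Sum>y\<in>B x. \<Sum>z\<in>C. f x y z) = (\<Sum>z\<in>C. \<Sum>x\<in>A. \<Sum>y\<in>B x. f x y z)"
proof -
  have "(\<Sum>x\<in>A. \<Sum>y\<in>B x. \<Sum>z\<in>C. f x y z) = (\<Sum>x\<in>A. \<Sum>z\<in>C. \<Sum>y\<in>B x. f x y z)"
    by (intro sum.cong refl sum.swap)
  then show ?thesis
    by (simp add: sum.swap[of _ _ A])
qed

context qfield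
begin

text \<open>Trades the variable m of a chain step for the variable j that becomes some m_i of the
  theorem, and creates the q-binomial coefficient containing it. Induction on \<open>L\<close> = n +
  p; for \<open>L = 0\<close> it is \<open>vandermonde_limit\<close>.\<close>

lemma heine_sum:
  assumes "n + p = int L"
  shows "(\<Sum>m\<in>{0..M}. qe (m\<^sup>2 - n * m) * (ri (M - m) * ri m * ri (m + p))) =
    ri M * (\<Sum>j\<le>L. qe ((int j)\<^sup>2 - n * int j) * qb (int L) (int j) * ri (M - n + int j))"
  using assms
proof (induction L arbitrary: n p M)
  case 0
  then show ?case
    using vandermonde_limit[of 0 0 n M] by (simp add: qb_def eq_neg_iff_add_eq_0[symmetric])
next
  case (Suc L)
  define X where "X M n p = (\<Sum>m\<in>{0..M}. qe (m\<^sup>2 - n * m) * (ri (M - m) * ri m * ri (m + p)))" for M n p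
  define Z where "Z = (\<Sum>j\<le>L. qe ((int j)\<^sup>2 - (n - 2) * int j) * qb (int L) (int j) * ri (M - n + 1 + int j))"
  define Y where "Y = (\<Sum>j\<le>L. qe ((int j)\<^sup>2 - (n - 1) * int j) * qb (int L) (int j) * ri (M - n + 1 + int j))"
  have X1: "X M (n - 1) p = ri M * Y"
    using Suc.IH[of "n - 1" p M] Suc.prems by (simp add: X_def Y_def algebra_simps)
  have X2: "X (M - 1) (n - 2) (p + 1) = ri (M - 1) * Z"
    using Suc.IH[of "n - 2" "p + 1" "M - 1"] Suc.prems by (simp add: X_def Z_def algebra_simps)
  \<comment> \<open>Inserts 1 = q^m + (1 - q^m). The first part lowers n, and in the second
    \<open>ri_pred\<close> allows a shift of m.\<close>
  have "X M n p = X M (n - 1) p + (\<Sum>m\<in>{0..M}. qe (m\<^sup>2 - n * m) * (ri (M - m) * ri (m - 1) * ri (m + p)))"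
    unfolding X_def sum.distrib[symmetric]
  proof (intro sum.cong refl)
    fix m
    have e: "qe (m\<^sup>2 - (n - 1) * m) = qe (m\<^sup>2 - n * m) * qe m"
      by (simp add: qe_add[symmetric] algebra_simps)
    show "qe (m\<^sup>2 - n * m) * (ri (M - m) * ri m * ri (m + p)) =
         qe (m\<^sup>2 - (n - 1) * m) * (ri (M - m) * ri m * ri (m + p)) +
         qe (m\<^sup>2 - n * m) * (ri (M - m) * ri (m - 1) * ri (m + p))"
      unfolding e ri_pred[of m] by (simp add: algebra_simps)
  qed
  also have "(\<Sum>m\<in>{0..M}. qe (m\<^sup>2 - n * m) * (ri (M - m) * ri (m - 1) * ri (m + p))) = qe (1 - n) * X (M - 1) (n - 2) (p + 1)"
  proof -
    have "(\<Sum>m\<in>{0..M}. qe (m\<^sup>2 - n * m) * (ri (M - m) * ri (m - 1) * ri (m + p))) =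
       (\<Sum>m\<in>{1..M}. qe (m\<^sup>2 - n * m) * (ri (M - m) * ri (m - 1) * ri (m + p)))"
      by (rule sum.mono_neutral_right) auto
    also have "\<dots> = (\<Sum>m\<in>{0..M - 1}. qe ((m + 1)\<^sup>2 - n * (m + 1)) * (ri (M - (m + 1)) * ri (m + 1 - 1) * ri (m + 1 + p)))"
      by (rule sum.reindex_bij_witness[of _ "\<lambda>m. m + 1" "\<lambda>m. m - 1"]) auto
    also have "\<dots> = qe (1 - n) * X (M - 1) (n - 2) (p + 1)"
      unfolding X_def sum_distrib_left
    proof (intro sum.cong refl)
      fix m
      have "qe ((m + 1)\<^sup>2 - n * (m + 1)) = qe (1 - n) * qe (m\<^sup>2 - (n - 2) * m)"
        by (simp add: qe_add[symmetric] power2_eq_square algebra_simps)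
      then show "qe ((m + 1)\<^sup>2 - n * (m + 1)) * (ri (M - (m + 1)) * ri (m + 1 - 1) * ri (m + 1 + p)) =
         qe (1 - n) * (qe (m\<^sup>2 - (n - 2) * m) * (ri (M - 1 - m) * ri m * ri (m + (p + 1))))"
        by (simp add: algebra_simps)
    qed
    finally show ?thesis .
  qed
  finally have lhs: "X M n p = ri M * (Y + (qe (1 - n) - qe (M - n + 1)) * Z)"
  proof -
    have e: "qe (M - n + 1) = qe (1 - n) * qe M"
      by (simp add: qe_add[symmetric] algebra_simps)
    assume "X M n p = X M (n - 1) p + qe (1 - n) * X (M - 1) (n - 2) (p + 1)"
    then show ?thesis
      unfolding X1 X2 ri_pred[of M] e by (simp add: algebra_simps)
  qed
  have "(\<Sum>j\<le>Suc L. qe ((int j)\<^sup>2 - n * int j) * qb (int (Suc L)) (int j) * ri (M - n + int j)) =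
      (\<Sum>j\<le>Suc L. qe ((int j)\<^sup>2 - n * int j) * qb (int L) (int j - 1) * ri (M - n + int j)) +
      (\<Sum>j\<le>Suc L. qe ((int j)\<^sup>2 - n * int j) * qe (int j) * qb (int L) (int j) * ri (M - n + int j))"
    unfolding sum.distrib[symmetric]
  proof (intro sum.cong refl)
    fix j
    have "qb (int (Suc L)) (int j) = qb (int L) (int j - 1) + qe (int j) * qb (int L) (int j)"
      using qb_pascal2[of "int L" "int j"] by (simp add: add.commute)
    then show "qe ((int j)\<^sup>2 - n * int j) * qb (int (Suc L)) (int j) * ri (M - n + int j) =
         qe ((int j)\<^sup>2 - n * int j) * qb (int L) (int j - 1) * ri (M - n + int j) +
         qe ((int j)\<^sup>2 - n * int j) * qe (int j) * qb (int L) (int j) * ri (M - n + int j)"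
      by (simp only:) (simp add: algebra_simps)
  qed
  also have "(\<Sum>j\<le>Suc L. qe ((int j)\<^sup>2 - n * int j) * qb (int L) (int j - 1) * ri (M - n + int j)) = qe (1 - n) * Z"
    unfolding Z_def sum_distrib_left
  proof (subst sum.atMost_Suc_shift, simp add: qb_eq_0, intro sum.cong refl)
    fix j
    have "qe ((1 + int j)\<^sup>2 - n * (1 + int j)) = qe (1 - n) * qe ((int j)\<^sup>2 - (n - 2) * int j)"
      by (simp add: qe_add[symmetric] power2_eq_square algebra_simps)
    then show "qe ((1 + int j)\<^sup>2 - n * (1 + int j)) * qb (int L) (int j) * ri (M - n + (1 + int j)) =
         qe (1 - n) * (qe ((int j)\<^sup>2 - (n - 2) * int j) * qb (int L) (int j) * ri (M - n + 1 + int j))"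
      by (simp add: algebra_simps)
  qed
  also have "(\<Sum>j\<le>Suc L. qe ((int j)\<^sup>2 - n * int j) * qe (int j) * qb (int L) (int j) * ri (M - n + int j)) =
     Y - qe (M - n + 1) * Z"
  proof -
    have "(\<Sum>j\<le>Suc L. qe ((int j)\<^sup>2 - n * int j) * qe (int j) * qb (int L) (int j) * ri (M - n + int j)) =
      (\<Sum>j\<le>L. qe ((int j)\<^sup>2 - n * int j) * qe (int j) * qb (int L) (int j) * ri (M - n + int j))"
      by (simp add: qb_eq_0)
    also have "\<dots> = Y - qe (M - n + 1) * Z"
      unfolding Y_def Z_def sum_distrib_left sum_subtractf[symmetric]
    proof (intro sum.cong refl)
      fix j
      have 1: "qe ((int j)\<^sup>2 - n * int j) * qe (int j) = qe ((int j)\<^sup>2 - (n - 1) * int j)"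
        by (simp add: qe_add[symmetric] algebra_simps)
      have 2: "qe (M - n + 1) * qe ((int j)\<^sup>2 - (n - 2) * int j) = qe ((int j)\<^sup>2 - (n - 1) * int j) * qe (M - n + 1 + int j)"
        by (simp add: qe_add[symmetric] algebra_simps)
      have 3: "ri (M - n + int j) = (1 - qe (M - n + 1 + int j)) * ri (M - n + 1 + int j)"
        using ri_Suc[of "M - n + int j"] by (simp add: algebra_simps)
      show "qe ((int j)\<^sup>2 - n * int j) * qe (int j) * qb (int L) (int j) * ri (M - n + int j) =
         qe ((int j)\<^sup>2 - (n - 1) * int j) * qb (int L) (int j) * ri (M - n + 1 + int j) -
         qe (M - n + 1) * (qe ((int j)\<^sup>2 - (n - 2) * int j) * qb (int L) (int j) * ri (M - n + 1 + int j))"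
        unfolding 1 3 mult.assoc[symmetric] 2 by (simp add: right_diff_distrib left_diff_distrib mult_ac)
    qed
    finally show ?thesis .
  qed
  finally have rhs: "(\<Sum>j\<le>Suc L. qe ((int j)\<^sup>2 - n * int j) * qb (int (Suc L)) (int j) * ri (M - n + int j)) =
      qe (1 - n) * Z + (Y - qe (M - n + 1) * Z)" .
  show ?case
    unfolding rhs X_def[symmetric] lhs by (simp add: algebra_simps)
qed

text \<open>The partial multisum over the levels from k - i on, with n_(k-i) and m_(k-i) fixed at n
  and j. The base case encodes m_k = 2 n_k, and \<open>e\<close> is the linear coefficient on level
  k. The q-binomial coefficients in the n_i have been telescoped into the denominators (q) of n -
  n'.\<close>

primrec chain :: "int \<Rightarrow> int \<Rightarrow> nat \<Rightarrow> nat \<Rightarrow> nat \<Rightarrow> 'a" where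
  "chain \<epsilon> e 0 = (\<lambda>n j. if j = 2 * n then qe ((int n)\<^sup>2 + e * int n) * ri (int n) else 0)"
| "chain \<epsilon> e (Suc i) = (\<lambda>n j. qe ((int n)\<^sup>2 - int n * int j + (int j)\<^sup>2 + int j + \<epsilon> * int n) *
     (\<Sum>n'\<le>n. \<Sum>j'\<le>2 * n'. ri (int n - int n') * qb (int n - int n' + int j') (int j) * chain \<epsilon> e i n' j'))"

text \<open>A nonzero term has j <= n - n' + j' with j' <= 2 n' and n' <= n, hence j <= 2 n. This
  explains the ranges up to 2 N for the m_i.\<close>

lemma chain_eq_0: "j > 2 * n \<Longrightarrow> chain \<epsilon> e i n j = 0"
  by (cases i) (auto intro!: sum.neutral qb_eq_0)

text \<open>In each step the sum over m can be carried out. What remains has the factors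
  \<open>ri M\<close> and \<open>ri (M + 1 - n + j)\<close>, which is the shape that
  \<open>heine_sum\<close> accepts in the following step.\<close>

lemma beta_chain:
  "beta \<epsilon> d (Suc i) N M = ri (int M) *
    (\<Sum>n\<le>N. \<Sum>j\<le>2 * n. ri (int N - int n) * ri (int M + 1 - int n + int j) * chain \<epsilon> (\<epsilon> + d) i n j)"
proof (induction i arbitrary: N M)
  case 0
  \<comment> \<open>The factor q^(2 n m) of the starting point turns - n m into + n m, so this is
    \<open>vandermonde_limit\<close> with u = 0 and v = - n - 1.\<close>
  have "beta \<epsilon> d (Suc 0) N M = (\<Sum>n\<le>N. qe ((int n)\<^sup>2 + (\<epsilon> + d) * int n) * ri (int N - int n) * ri (int n) *
      (\<Sum>m\<in>{0..int M}. qe (m\<^sup>2 - (0 + (- int n - 1)) * m) * (ri (int M - m) * ri (m - 0) * ri (m - (- int n - 1)))))"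
    unfolding sum_int_nat beta.simps sum_distrib_left
  proof (intro sum.cong refl)
    fix n m
    have e: "qe ((int n)\<^sup>2 - int n * int m + (int m)\<^sup>2 + \<epsilon> * int n + int m) * qe (2 * int n * int m + d * int n) =
       qe ((int n)\<^sup>2 + (\<epsilon> + d) * int n) * qe ((int m)\<^sup>2 - (0 + (- int n - 1)) * int m)"
      by (simp add: qe_add[symmetric] algebra_simps)
    have a: "int m - (- int n - 1) = int n + int m + 1"
      by simp
    have "qe ((int n)\<^sup>2 - int n * int m + (int m)\<^sup>2 + \<epsilon> * int n + int m) *
          (ri (int N - int n) * ri (int M - int m) * beta0 d n m) =
        (qe ((int n)\<^sup>2 - int n * int m + (int m)\<^sup>2 + \<epsilon> * int n + int m) * qe (2 * int n * int m + d * int n)) *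
          (ri (int N - int n) * ri (int M - int m) * (ri (int n) * ri (int m) * ri (int n + int m + 1)))"
      unfolding beta0_def by (simp only: mult_ac)
    then show "qe ((int n)\<^sup>2 - int n * int m + (int m)\<^sup>2 + \<epsilon> * int n + int m) *
          (ri (int N - int n) * ri (int M - int m) * beta0 d n m) =
       qe ((int n)\<^sup>2 + (\<epsilon> + d) * int n) * ri (int N - int n) * ri (int n) *
        (qe ((int m)\<^sup>2 - (0 + (- int n - 1)) * int m) * (ri (int M - int m) * ri (int m - 0) * ri (int m - (- int n - 1))))"
      unfolding e a diff_zero by (simp only: mult_ac)
  qed
  also have "\<dots> = (\<Sum>n\<le>N. qe ((int n)\<^sup>2 + (\<epsilon> + d) * int n) * ri (int N - int n) * ri (int n) * (ri (int M) * ri (int M + 1 + int n)))"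
    by (subst vandermonde_limit) (simp_all add: algebra_simps)
  also have "\<dots> = ri (int M) * (\<Sum>n\<le>N. \<Sum>j\<le>2 * n. ri (int N - int n) * ri (int M + 1 - int n + int j) * chain \<epsilon> (\<epsilon> + d) 0 n j)"
    unfolding sum_distrib_left
  proof (intro sum.cong refl)
    fix n
    have "(\<Sum>j\<le>2 * n. ri (int M) * (ri (int N - int n) * ri (int M + 1 - int n + int j) * chain \<epsilon> (\<epsilon> + d) 0 n j)) =
      (\<Sum>j\<in>{2 * n}. ri (int M) * (ri (int N - int n) * ri (int M + 1 - int n + int j) * chain \<epsilon> (\<epsilon> + d) 0 n j))"
      by (rule sum.mono_neutral_right) auto
    then show "qe ((int n)\<^sup>2 + (\<epsilon> + d) * int n) * ri (int N - int n) * ri (int n) * (ri (int M) * ri (int M + 1 + int n)) =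
      (\<Sum>j\<le>2 * n. ri (int M) * (ri (int N - int n) * ri (int M + 1 - int n + int j) * chain \<epsilon> (\<epsilon> + d) 0 n j))"
      by (simp add: ac_simps)
  qed
  finally show ?case .
next
  case (Suc i)
  define C where "C = chain \<epsilon> (\<epsilon> + d) i"
  define B where "B n = (\<lambda>n' j'. ri (int n - int n') * C n' j')" for n
  have inner: "(\<Sum>m\<le>M. qe ((int n)\<^sup>2 - int n * int m + (int m)\<^sup>2 + \<epsilon> * int n + int m) *
        (ri (int N - int n) * ri (int M - int m) * (ri (int m) * ri (int m + 1 - int n' + int j')))) =
     ri (int M) * (\<Sum>j\<le>2 * n. ri (int N - int n) * ri (int M + 1 - int n + int j) *
       (qe ((int n)\<^sup>2 - int n * int j + (int j)\<^sup>2 + int j + \<epsilon> * int n) * qb (int n - int n' + int j') (int j)))"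
    if "n' \<le> n" "j' \<le> 2 * n'" for n n' j'
  proof -
    define L where "L = n - n' + j'"
    have L: "int L = int n - int n' + int j'" "L \<le> 2 * n"
      using that by (simp_all add: L_def)
    have "(\<Sum>m\<le>M. qe ((int n)\<^sup>2 - int n * int m + (int m)\<^sup>2 + \<epsilon> * int n + int m) *
        (ri (int N - int n) * ri (int M - int m) * (ri (int m) * ri (int m + 1 - int n' + int j')))) =
      qe ((int n)\<^sup>2 + \<epsilon> * int n) * ri (int N - int n) *
       (\<Sum>m\<in>{0..int M}. qe (m\<^sup>2 - (int n - 1) * m) * (ri (int M - m) * ri m * ri (m + (1 - int n' + int j'))))"
      unfolding sum_int_nat sum_distrib_left
    proof (intro sum.cong refl)
      fix m
      have "qe ((int n)\<^sup>2 - int n * int m + (int m)\<^sup>2 + \<epsilon> * int n + int m) =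
         qe ((int n)\<^sup>2 + \<epsilon> * int n) * qe ((int m)\<^sup>2 - (int n - 1) * int m)"
        by (simp add: qe_add[symmetric] algebra_simps)
      moreover have "int m + (1 - int n' + int j') = int m + 1 - int n' + int j'"
        by simp
      ultimately show "qe ((int n)\<^sup>2 - int n * int m + (int m)\<^sup>2 + \<epsilon> * int n + int m) *
          (ri (int N - int n) * ri (int M - int m) * (ri (int m) * ri (int m + 1 - int n' + int j'))) =
        qe ((int n)\<^sup>2 + \<epsilon> * int n) * ri (int N - int n) *
          (qe ((int m)\<^sup>2 - (int n - 1) * int m) * (ri (int M - int m) * ri (int m) * ri (int m + (1 - int n' + int j'))))"
        by (simp only: mult_ac)
    qed
    also have "(\<Sum>m\<in>{0..int M}. qe (m\<^sup>2 - (int n - 1) * m) * (ri (int M - m) * ri m * ri (m + (1 - int n' + int j')))) =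
       ri (int M) * (\<Sum>j\<le>L. qe ((int j)\<^sup>2 - (int n - 1) * int j) * qb (int L) (int j) * ri (int M - (int n - 1) + int j))"
      by (rule heine_sum) (simp add: L)
    also have "(\<Sum>j\<le>L. qe ((int j)\<^sup>2 - (int n - 1) * int j) * qb (int L) (int j) * ri (int M - (int n - 1) + int j)) =
      (\<Sum>j\<le>2 * n. qe ((int j)\<^sup>2 - (int n - 1) * int j) * qb (int L) (int j) * ri (int M - (int n - 1) + int j))"
      by (rule sum.mono_neutral_left) (use L(2) in \<open>auto simp: qb_eq_0\<close>)
    finally have *: "(\<Sum>m\<le>M. qe ((int n)\<^sup>2 - int n * int m + (int m)\<^sup>2 + \<epsilon> * int n + int m) *
        (ri (int N - int n) * ri (int M - int m) * (ri (int m) * ri (int m + 1 - int n' + int j')))) =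
       qe ((int n)\<^sup>2 + \<epsilon> * int n) * ri (int N - int n) * (ri (int M) *
       (\<Sum>j\<le>2 * n. qe ((int j)\<^sup>2 - (int n - 1) * int j) * qb (int L) (int j) * ri (int M - (int n - 1) + int j)))" .
    show ?thesis
      unfolding * unfolding sum_distrib_left
    proof (intro sum.cong refl)
      fix j
      have "qe ((int n)\<^sup>2 - int n * int j + (int j)\<^sup>2 + int j + \<epsilon> * int n) =
         qe ((int n)\<^sup>2 + \<epsilon> * int n) * qe ((int j)\<^sup>2 - (int n - 1) * int j)"
        by (simp add: qe_add[symmetric] algebra_simps)
      moreover have "int M - (int n - 1) + int j = int M + 1 - int n + int j"
        by simp
      ultimately show "qe ((int n)\<^sup>2 + \<epsilon> * int n) * ri (int N - int n) *
          (ri (int M) * (qe ((int j)\<^sup>2 - (int n - 1) * int j) * qb (int L) (int j) * ri (int M - (int n - 1) + int j))) =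
        ri (int M) * (ri (int N - int n) * ri (int M + 1 - int n + int j) *
          (qe ((int n)\<^sup>2 - int n * int j + (int j)\<^sup>2 + int j + \<epsilon> * int n) * qb (int n - int n' + int j') (int j)))"
        unfolding L by (simp only: mult_ac)
    qed
  qed
  have "beta \<epsilon> d (Suc (Suc i)) N M = (\<Sum>n\<le>N. \<Sum>m\<le>M. \<Sum>n'\<le>n. \<Sum>j'\<le>2 * n'. B n n' j' *
     (qe ((int n)\<^sup>2 - int n * int m + (int m)\<^sup>2 + \<epsilon> * int n + int m) *
        (ri (int N - int n) * ri (int M - int m) * (ri (int m) * ri (int m + 1 - int n' + int j')))))"
    unfolding beta.simps(2)[of _ _ "Suc i"] Suc.IH sum_distrib_left B_def C_def by (intro sum.cong refl) (simp only: mult_ac)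
  also have "\<dots> = (\<Sum>n\<le>N. \<Sum>n'\<le>n. \<Sum>j'\<le>2 * n'. \<Sum>m\<le>M. B n n' j' *
     (qe ((int n)\<^sup>2 - int n * int m + (int m)\<^sup>2 + \<epsilon> * int n + int m) *
        (ri (int N - int n) * ri (int M - int m) * (ri (int m) * ri (int m + 1 - int n' + int j')))))"
    by (subst sum.swap[of _ _ "{..M}"], subst sum.swap[of _ _ "{..M}"]) (rule refl)
  also have "\<dots> = (\<Sum>n\<le>N. \<Sum>n'\<le>n. \<Sum>j'\<le>2 * n'. B n n' j' *
      (ri (int M) * (\<Sum>j\<le>2 * n. ri (int N - int n) * ri (int M + 1 - int n + int j) *
       (qe ((int n)\<^sup>2 - int n * int j + (int j)\<^sup>2 + int j + \<epsilon> * int n) * qb (int n - int n' + int j') (int j)))))"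
    unfolding sum_distrib_left[symmetric] by (intro sum.cong refl arg_cong2[of _ _ _ _ "(*)"] inner) auto
  also have "\<dots> = (\<Sum>n\<le>N. \<Sum>n'\<le>n. \<Sum>j'\<le>2 * n'. \<Sum>j\<le>2 * n. ri (int M) * (ri (int N - int n) * ri (int M + 1 - int n + int j) *
       (qe ((int n)\<^sup>2 - int n * int j + (int j)\<^sup>2 + int j + \<epsilon> * int n) *
         (ri (int n - int n') * qb (int n - int n' + int j') (int j) * C n' j'))))"
    unfolding sum_distrib_left B_def by (intro sum.cong refl) (simp only: mult_ac)
  also have "\<dots> = (\<Sum>n\<le>N. \<Sum>j\<le>2 * n. \<Sum>n'\<le>n. \<Sum>j'\<le>2 * n'. ri (int M) * (ri (int N - int n) * ri (int M + 1 - int n + int j) *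
       (qe ((int n)\<^sup>2 - int n * int j + (int j)\<^sup>2 + int j + \<epsilon> * int n) *
         (ri (int n - int n') * qb (int n - int n' + int j') (int j) * C n' j'))))"
    by (intro sum.cong refl sum_swap3)
  also have "\<dots> = ri (int M) * (\<Sum>n\<le>N. \<Sum>j\<le>2 * n. ri (int N - int n) * ri (int M + 1 - int n + int j) * chain \<epsilon> (\<epsilon> + d) (Suc i) n j)"
    unfolding C_def chain.simps(2) sum_distrib_left ..
  finally show ?case .
qed

text \<open>The part of the summand that belongs to the levels from \<open>r\<close> on, with the
  denominator of the outermost index; for r = 1 it is the full summand.\<close>

definition gterm :: "nat \<Rightarrow> nat \<Rightarrow> nat \<Rightarrow> (nat \<Rightarrow> nat) \<Rightarrow> (nat \<Rightarrow> nat) \<Rightarrow> 'a" where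
  "gterm k s r n m = q ^ ((n k)\<^sup>2 + (\<Sum>i=max s r..k. n i)) * ri (int (n r)) *
     (\<Prod>i=r..k - 1. q ^ qexponent (n i) (m i) * qb (int (n i)) (int (n (i + 1))) *
        qb (int (n i) - int (n (i + 1)) + int (m (i + 1))) (int (m i)))"

lemma gterm_step:
  assumes "r < k" and "\<epsilon> = (if s \<le> r then 1 else 0)"
  shows "gterm k s r (n(r := x)) (m(r := j)) =
    qe ((int x)\<^sup>2 - int x * int j + (int j)\<^sup>2 + int j + \<epsilon> * int x) *
     (ri (int x - int (n (Suc r))) * qb (int x - int (n (Suc r)) + int (m (Suc r))) (int j) * gterm k s (Suc r) n m)"
proof -
  define P where "P = (\<Prod>i=Suc r..k - 1. q ^ qexponent (n i) (m i) * qb (int (n i)) (int (n (i + 1))) *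
        qb (int (n i) - int (n (i + 1)) + int (m (i + 1))) (int (m i)))"
  have "{r..k - 1} = insert r {Suc r..k - 1}"
    using assms(1) by auto
  then have prod: "(\<Prod>i=r..k - 1. q ^ qexponent ((n(r := x)) i) ((m(r := j)) i) * qb (int ((n(r := x)) i)) (int ((n(r := x)) (i + 1))) *
        qb (int ((n(r := x)) i) - int ((n(r := x)) (i + 1)) + int ((m(r := j)) (i + 1))) (int ((m(r := j)) i))) =
     q ^ qexponent x j * qb (int x) (int (n (Suc r))) * qb (int x - int (n (Suc r)) + int (m (Suc r))) (int j) * P"
    by (simp add: P_def)
  have sum: "(\<Sum>i=max s r..k. (n(r := x)) i) = (if s \<le> r then x else 0) + (\<Sum>i=max s (Suc r)..k. n i)"
  proof (cases "s \<le> r")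
    case True
    then have "{max s r..k} = insert r {max s (Suc r)..k}"
      using assms(1) by auto
    then show ?thesis
      using True by simp
  next
    case False
    then show ?thesis
      by (auto intro!: sum.cong)
  qed
  have pow: "q ^ qexponent x j * q ^ (if s \<le> r then x else 0) = qe ((int x)\<^sup>2 - int x * int j + (int j)\<^sup>2 + int j + \<epsilon> * int x)"
    by (simp add: qe_of_nat[symmetric] qe_add[symmetric] int_qexponent assms(2))
  have k: "(n(r := x)) k = n k"
    using assms(1) by simp
  \<comment> \<open>This telescoping moves the denominator from level r to level r + 1.\<close>
  have binom: "ri (int x) * qb (int x) (int (n (Suc r))) = ri (int x - int (n (Suc r))) * ri (int (n (Suc r)))"
    using qp_ri[of "int x"] by (simp add: qb_def mult_ac)
  have "gterm k s r (n(r := x)) (m(r := j)) =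
     (q ^ qexponent x j * q ^ (if s \<le> r then x else 0)) * (ri (int x) * qb (int x) (int (n (Suc r)))) *
     (qb (int x - int (n (Suc r)) + int (m (Suc r))) (int j) * (q ^ (n k)\<^sup>2 * q ^ (\<Sum>i=max s (Suc r)..k. n i)) * P)"
    unfolding gterm_def prod sum k power_add fun_upd_same by (simp only: mult_ac)
  also have "\<dots> = qe ((int x)\<^sup>2 - int x * int j + (int j)\<^sup>2 + int j + \<epsilon> * int x) *
     (ri (int x - int (n (Suc r))) * qb (int x - int (n (Suc r)) + int (m (Suc r))) (int j) * gterm k s (Suc r) n m)"
    unfolding gterm_def P_def[symmetric] pow binom power_add by (simp only: mult_ac)
  finally show ?thesis .
qed

text \<open>The test function \<open>f\<close> is arbitrary because the induction needs it: the
  factors coupling level r to level r + 1 depend only on n and m at level r + 1, and serve as the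
  test function there.\<close>

lemma gterm_sum:
  assumes "i < k" and "\<And>r. r < k \<Longrightarrow> r \<ge> k - i \<Longrightarrow> \<epsilon> = (if s \<le> r then 1 else 0)" and "e = (if s \<le> k then 1 else 0)"
  shows "(\<Sum>n\<in>{k - i..k} \<rightarrow>\<^sub>E {..N}. \<Sum>m\<in>{k - i..k - 1} \<rightarrow>\<^sub>E {..2 * N}.
      gterm k s (k - i) n (m(k := 2 * n k)) * f (n (k - i)) ((m(k := 2 * n k)) (k - i))) =
    (\<Sum>n\<le>N. \<Sum>j\<le>2 * N. chain \<epsilon> e i n j * f n j)"
  using assms(1,2)
proof (induction i arbitrary: f)
  case 0
  have k: "{k..k} = insert k {}" "{k..k - Suc 0} = {}"
    using 0 by auto
  have "(\<Sum>n\<in>{k..k} \<rightarrow>\<^sub>E {..N}. \<Sum>m\<in>{k..k - 1} \<rightarrow>\<^sub>E {..2 * N}. gterm k s k n (m(k := 2 * n k)) * f (n k) ((m(k := 2 * n k)) k)) =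
     (\<Sum>x\<le>N. q ^ (x\<^sup>2 + (if s \<le> k then x else 0)) * ri (int x) * f x (2 * x))"
    using k(2) unfolding k(1) by (subst sum_PiE_insert) (auto simp: gterm_def max_def intro!: sum.cong)
  also have "\<dots> = (\<Sum>n\<le>N. \<Sum>j\<le>2 * N. chain \<epsilon> e 0 n j * f n j)"
  proof (intro sum.cong refl)
    fix n assume "n \<in> {..N}"
    then have *: "(\<Sum>j\<le>2 * N. chain \<epsilon> e 0 n j * f n j) = (\<Sum>j\<in>{2 * n}. chain \<epsilon> e 0 n j * f n j)"
      by (intro sum.mono_neutral_right) auto
    have "q ^ (n\<^sup>2 + (if s \<le> k then n else 0)) = qe ((int n)\<^sup>2 + e * int n)"
      using assms(3) by (simp add: qe_of_nat[symmetric])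
    then show "q ^ (n\<^sup>2 + (if s \<le> k then n else 0)) * ri (int n) * f n (2 * n) = (\<Sum>j\<le>2 * N. chain \<epsilon> e 0 n j * f n j)"
      unfolding * by simp
  qed
  finally show ?case
    unfolding diff_zero .
next
  case (Suc i)
  define r where "r = k - Suc i"
  have r: "k - i = Suc r" "r < k" "k \<noteq> r" "Suc r \<le> k"
    using Suc.prems(1) by (auto simp: r_def)
  have eps: "\<epsilon> = (if s \<le> r then 1 else 0)"
    using Suc.prems(2)[of r] r by (simp add: r_def)
  have IH: "(\<Sum>n\<in>{Suc r..k} \<rightarrow>\<^sub>E {..N}. \<Sum>m\<in>{Suc r..k - 1} \<rightarrow>\<^sub>E {..2 * N}.
      gterm k s (Suc r) n (m(k := 2 * n k)) * g (n (Suc r)) ((m(k := 2 * n k)) (Suc r))) =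
    (\<Sum>n\<le>N. \<Sum>j\<le>2 * N. chain \<epsilon> e i n j * g n j)" for g
  proof -
    have "i < k" "\<And>r. r < k \<Longrightarrow> r \<ge> k - i \<Longrightarrow> \<epsilon> = (if s \<le> r then 1 else 0)"
      using Suc.prems by auto
    from Suc.IH[OF this, where f = g] show ?thesis
      unfolding r(1) .
  qed
  define E where "E x j = qe ((int x)\<^sup>2 - int x * int j + (int j)\<^sup>2 + int j + \<epsilon> * int x)" for x j
  have s1: "{r..k} = insert r {Suc r..k}" "{r..k - 1} = insert r {Suc r..k - 1}"
    using r by auto
  have "(\<Sum>n\<in>{r..k} \<rightarrow>\<^sub>E {..N}. \<Sum>m\<in>{r..k - 1} \<rightarrow>\<^sub>E {..2 * N}.
      gterm k s r n (m(k := 2 * n k)) * f (n r) ((m(k := 2 * n k)) r)) =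
     (\<Sum>x\<le>N. \<Sum>n\<in>{Suc r..k} \<rightarrow>\<^sub>E {..N}. \<Sum>j\<le>2 * N. \<Sum>m\<in>{Suc r..k - 1} \<rightarrow>\<^sub>E {..2 * N}.
       E x j * f x j * (gterm k s (Suc r) n (m(k := 2 * n k)) *
         (ri (int x - int (n (Suc r))) * qb (int x - int (n (Suc r)) + int ((m(k := 2 * n k)) (Suc r))) (int j))))"
    unfolding s1
  proof (subst sum_PiE_insert, simp, subst sum_PiE_insert, simp, intro sum.cong refl)
    fix x j :: nat and n m :: "nat \<Rightarrow> nat"
    have "(m(r := j, k := 2 * (n(r := x)) k)) = (m(k := 2 * n k))(r := j)"
      using r by (auto simp: fun_eq_iff)
    moreover have "((m(k := 2 * n k))(r := j)) r = j" "(n(r := x)) r = x"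
      by simp_all
    ultimately show "gterm k s r (n(r := x)) (m(r := j, k := 2 * (n(r := x)) k)) * f ((n(r := x)) r) ((m(r := j, k := 2 * (n(r := x)) k)) r) =
       E x j * f x j * (gterm k s (Suc r) n (m(k := 2 * n k)) *
         (ri (int x - int (n (Suc r))) * qb (int x - int (n (Suc r)) + int ((m(k := 2 * n k)) (Suc r))) (int j)))"
      unfolding E_def by (simp only: gterm_step[OF r(2) eps] mult_ac)
  qed
  also have "\<dots> = (\<Sum>x\<le>N. \<Sum>j\<le>2 * N. E x j * f x j * (\<Sum>n\<in>{Suc r..k} \<rightarrow>\<^sub>E {..N}. \<Sum>m\<in>{Suc r..k - 1} \<rightarrow>\<^sub>E {..2 * N}.
       gterm k s (Suc r) n (m(k := 2 * n k)) *
         (ri (int x - int (n (Suc r))) * qb (int x - int (n (Suc r)) + int ((m(k := 2 * n k)) (Suc r))) (int j))))"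
    unfolding sum_distrib_left by (intro sum.cong refl) (rule sum.swap)
  also have "\<dots> = (\<Sum>x\<le>N. \<Sum>j\<le>2 * N. E x j * f x j * (\<Sum>n'\<le>N. \<Sum>j'\<le>2 * N. chain \<epsilon> e i n' j' *
         (ri (int x - int n') * qb (int x - int n' + int j') (int j))))"
    by (simp only: IH[of "\<lambda>n' j'. ri (int x - int n') * qb (int x - int n' + int j') (int j)" for x j])
  also have "\<dots> = (\<Sum>x\<le>N. \<Sum>j\<le>2 * N. chain \<epsilon> e (Suc i) x j * f x j)"
  proof (intro sum.cong refl)
    fix x j assume "x \<in> {..N}"
    then have "(\<Sum>n'\<le>N. \<Sum>j'\<le>2 * N. chain \<epsilon> e i n' j' * (ri (int x - int n') * qb (int x - int n' + int j') (int j))) =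
      (\<Sum>n'\<le>x. \<Sum>j'\<le>2 * N. chain \<epsilon> e i n' j' * (ri (int x - int n') * qb (int x - int n' + int j') (int j)))"
      by (intro sum.mono_neutral_right) auto
    also have "\<dots> = (\<Sum>n'\<le>x. \<Sum>j'\<le>2 * n'. ri (int x - int n') * qb (int x - int n' + int j') (int j) * chain \<epsilon> e i n' j')"
      using \<open>x \<in> {..N}\<close> by (intro sum.cong refl sum.mono_neutral_cong_right) (auto simp: chain_eq_0)
    finally show "E x j * f x j * (\<Sum>n'\<le>N. \<Sum>j'\<le>2 * N. chain \<epsilon> e i n' j' *
         (ri (int x - int n') * qb (int x - int n' + int j') (int j))) = chain \<epsilon> e (Suc i) x j * f x j"
      by (simp add: E_def)
  qed
  finally show ?case
    unfolding r_def .
qed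

end

subsection \<open>Locally finite sums of formal power series\<close>

unbundle no vec_syntax
unbundle fps_syntax

text \<open>A coefficientwise notion of summability: each coefficient is a finite sum. Products and
  regrouping thus reduce to finite sums; \<open>fps_sums_imp_has_sum\<close> returns to X-adic
  convergence.\<close>

definition fps_sums :: "('i \<Rightarrow> 'a :: comm_ring_1 fps) \<Rightarrow> 'i set \<Rightarrow> 'a fps \<Rightarrow> bool" where
  "fps_sums f A S \<longleftrightarrow> (\<forall>d. finite {x \<in> A. f x $ d \<noteq> 0} \<and> S $ d = (\<Sum>x | x \<in> A \<and> f x $ d \<noteq> 0. f x $ d))"

lemma fps_sums_finite: "fps_sums f A S \<Longrightarrow> finite {x \<in> A. f x $ d \<noteq> 0}"
  by (simp add: fps_sums_def)

lemma fps_sums_finite_le: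
  assumes "fps_sums f A S"
  shows "finite {x \<in> A. \<exists>e\<le>d. f x $ e \<noteq> 0}"
proof -
  have "{x \<in> A. \<exists>e\<le>d. f x $ e \<noteq> 0} = (\<Union>e\<le>d. {x \<in> A. f x $ e \<noteq> 0})"
    by auto
  then show ?thesis
    using fps_sums_finite[OF assms] by simp
qed

lemma fps_sums_nth:
  assumes "fps_sums f A S" "finite B" "B \<subseteq> A" "\<And>x. x \<in> A - B \<Longrightarrow> f x $ d = 0"
  shows "S $ d = (\<Sum>x\<in>B. f x $ d)"
proof -
  have "S $ d = (\<Sum>x | x \<in> A \<and> f x $ d \<noteq> 0. f x $ d)"
    using assms(1) by (simp add: fps_sums_def)
  also have "\<dots> = (\<Sum>x\<in>B. f x $ d)"
    using assms by (intro sum.mono_neutral_left) auto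
  finally show ?thesis .
qed

lemma fps_sumsI:
  assumes "\<And>d. \<exists>B. finite B \<and> B \<subseteq> A \<and> (\<forall>x \<in> A - B. f x $ d = 0) \<and> S $ d = (\<Sum>x\<in>B. f x $ d)"
  shows "fps_sums f A S"
  unfolding fps_sums_def
proof
  fix d
  obtain B where B: "finite B" "B \<subseteq> A" "\<And>x. x \<in> A - B \<Longrightarrow> f x $ d = 0" "S $ d = (\<Sum>x\<in>B. f x $ d)"
    using assms[of d] by blast
  have sub: "{x \<in> A. f x $ d \<noteq> 0} \<subseteq> B"
    using B(3) by auto
  have "(\<Sum>x | x \<in> A \<and> f x $ d \<noteq> 0. f x $ d) = (\<Sum>x\<in>B. f x $ d)"
    using B sub by (intro sum.mono_neutral_left) auto
  then show "finite {x \<in> A. f x $ d \<noteq> 0} \<and> S $ d = (\<Sum>x | x \<in> A \<and> f x $ d \<noteq> 0. f x $ d)"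
    using B sub by (auto intro: finite_subset)
qed

lemma fps_sums_exists:
  assumes "\<And>d. finite {x \<in> A. f x $ d \<noteq> 0}"
  obtains S where "fps_sums f A S"
  using assms that[of "Abs_fps (\<lambda>d. \<Sum>x | x \<in> A \<and> f x $ d \<noteq> 0. f x $ d)"] by (simp add: fps_sums_def)

lemma fps_sums_unique: "fps_sums f A S \<Longrightarrow> fps_sums f A T \<Longrightarrow> S = T"
  by (simp add: fps_sums_def fps_eq_iff)

lemma fps_sums_imp_has_sum:
  assumes "fps_sums f A S"
  shows "(f has_sum S) A"
  unfolding has_sum_def
proof (rule tendsto_fpsI)
  fix d
  have "eventually (\<lambda>F. finite F \<and> {x \<in> A. f x $ d \<noteq> 0} \<subseteq> F \<and> F \<subseteq> A) (finite_subsets_at_top A)"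
    using fps_sums_finite[OF assms, of d] unfolding eventually_finite_subsets_at_top by (intro exI[of _ "{x \<in> A. f x $ d \<noteq> 0}"]) auto
  then show "eventually (\<lambda>F. sum f F $ d = S $ d) (finite_subsets_at_top A)"
  proof eventually_elim
    case (elim F)
    then have "S $ d = (\<Sum>x\<in>F. f x $ d)"
      by (intro fps_sums_nth[OF assms]) auto
    then show ?case
      by (simp add: fps_sum_nth)
  qed
qed

lemma fps_sums_reindex:
  assumes "bij_betw h B A" "fps_sums f A S"
  shows "fps_sums (\<lambda>x. f (h x)) B S"
proof (rule fps_sumsI)
  fix d
  define C where "C = {x \<in> A. f x $ d \<noteq> 0}"
  define D where "D = {x \<in> B. f (h x) $ d \<noteq> 0}"
  have bij: "bij_betw h D C"
    using assms(1) unfolding C_def D_def bij_betw_def by (auto intro: inj_on_subset)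
  have "finite C"
    unfolding C_def by (rule fps_sums_finite[OF assms(2)])
  then have "finite D"
    using bij_betw_finite[OF bij] by simp
  moreover have "S $ d = (\<Sum>x\<in>C. f x $ d)"
    using assms(2) by (simp add: fps_sums_def C_def)
  then have "S $ d = (\<Sum>x\<in>D. f (h x) $ d)"
    using sum.reindex_bij_betw[OF bij, of "\<lambda>x. f x $ d"] by simp
  ultimately show "\<exists>D. finite D \<and> D \<subseteq> B \<and> (\<forall>x\<in>B - D. f (h x) $ d = 0) \<and> S $ d = (\<Sum>x\<in>D. f (h x) $ d)"
    by (intro exI[of _ D]) (auto simp: D_def)
qed

lemma fps_sums_mult:
  assumes "fps_sums f A S" "fps_sums g B T"
  shows "fps_sums (\<lambda>(x, y). f x * g y) (A \<times> B) (S * T)"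
proof (rule fps_sumsI)
  fix d
  define C where "C = {x \<in> A. \<exists>e\<le>d. f x $ e \<noteq> 0}"
  define D where "D = {x \<in> B. \<exists>e\<le>d. g x $ e \<noteq> 0}"
  have fin: "finite C" "finite D"
    unfolding C_def D_def by (rule fps_sums_finite_le[OF assms(1)], rule fps_sums_finite_le[OF assms(2)])
  have "(S * T) $ d = (\<Sum>i=0..d. (\<Sum>x\<in>C. f x $ i) * (\<Sum>y\<in>D. g y $ (d - i)))"
    unfolding fps_mult_nth
  proof (intro sum.cong refl)
    fix i assume "i \<in> {0..d}"
    then show "S $ i * T $ (d - i) = (\<Sum>x\<in>C. f x $ i) * (\<Sum>y\<in>D. g y $ (d - i))"
      using fps_sums_nth[OF assms(1) fin(1), of i] fps_sums_nth[OF assms(2) fin(2), of "d - i"]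
      by (simp add: C_def D_def)
  qed
  also have "\<dots> = (\<Sum>i=0..d. \<Sum>(x, y)\<in>C \<times> D. f x $ i * g y $ (d - i))"
    by (simp add: sum_product sum.cartesian_product)
  also have "\<dots> = (\<Sum>(x, y)\<in>C \<times> D. (f x * g y) $ d)"
    by (subst sum.swap) (simp add: fps_mult_nth case_prod_unfold)
  finally have "(S * T) $ d = (\<Sum>z\<in>C \<times> D. (case z of (x, y) \<Rightarrow> f x * g y) $ d)"
    by (simp add: case_prod_unfold)
  moreover have "(f x * g y) $ d = 0" if "x \<in> A" "y \<in> B" "\<not> (x \<in> C \<and> y \<in> D)" for x y
    using that unfolding fps_mult_nth C_def D_def by (intro sum.neutral) auto
  then have "\<forall>z \<in> A \<times> B - C \<times> D. (case z of (x, y) \<Rightarrow> f x * g y) $ d = 0"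
    by auto
  moreover have "C \<times> D \<subseteq> A \<times> B"
    by (auto simp: C_def D_def)
  ultimately show "\<exists>E. finite E \<and> E \<subseteq> A \<times> B \<and> (\<forall>z \<in> A \<times> B - E. (case z of (x, y) \<Rightarrow> f x * g y) $ d = 0) \<and>
     (S * T) $ d = (\<Sum>z\<in>E. (case z of (x, y) \<Rightarrow> f x * g y) $ d)"
    using fin by (intro exI[of _ "C \<times> D"]) simp
qed

lemma fps_sums_singleton: "fps_sums (\<lambda>_. c) {x} c"
  by (rule fps_sumsI) (auto intro!: exI[of _ "{x}"])

lemma fps_sums_mult_right:
  assumes "fps_sums f A S"
  shows "fps_sums (\<lambda>x. f x * c) A (S * c)"
proof -
  have "bij_betw (\<lambda>x. (x, ())) A (A \<times> {()})"
    by (auto simp: bij_betw_def inj_on_def)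
  from fps_sums_reindex[OF this fps_sums_mult[OF assms fps_sums_singleton]] show ?thesis
    by simp
qed

lemma fps_sums_Sigma:
  assumes "fps_sums F (A \<times> B) S" "\<And>x. x \<in> A \<Longrightarrow> fps_sums (\<lambda>y. F (x, y)) B (G x)"
  shows "fps_sums G A S"
proof (rule fps_sumsI)
  fix d
  define E where "E = {z \<in> A \<times> B. F z $ d \<noteq> 0}"
  define C where "C = fst ` E"
  define D where "D = snd ` E"
  have fin: "finite C" "finite D"
    using fps_sums_finite[OF assms(1), of d] by (simp_all add: C_def D_def E_def)
  have sub: "C \<subseteq> A" "D \<subseteq> B"
    by (auto simp: C_def D_def E_def)
  have G: "G x $ d = (\<Sum>y\<in>D. F (x, y) $ d)" if "x \<in> A" for x
    using fps_sums_nth[OF assms(2)[OF that] fin(2) sub(2), of d] that by (force simp: D_def E_def image_iff)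
  have "S $ d = (\<Sum>z\<in>C \<times> D. F z $ d)"
    using fps_sums_nth[OF assms(1), of "C \<times> D" d] fin sub by (force simp: C_def D_def E_def image_iff)
  also have "\<dots> = (\<Sum>x\<in>C. \<Sum>y\<in>D. F (x, y) $ d)"
    by (simp add: sum.cartesian_product case_prod_unfold)
  also have "\<dots> = (\<Sum>x\<in>C. G x $ d)"
    using sub by (intro sum.cong refl) (auto simp: G)
  finally have "S $ d = (\<Sum>x\<in>C. G x $ d)" .
  moreover have "G x $ d = 0" if "x \<in> A - C" for x
    using that by (subst G) (auto intro!: sum.neutral simp: C_def D_def E_def image_iff)
  ultimately show "\<exists>C. finite C \<and> C \<subseteq> A \<and> (\<forall>x \<in> A - C. G x $ d = 0) \<and> S $ d = (\<Sum>x\<in>C. G x $ d)"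
    using fin sub by blast
qed

lemma tendsto_mult_fps:
  fixes a b :: "'a :: comm_ring_1 fps"
  assumes "(f \<longlongrightarrow> a) F" "(g \<longlongrightarrow> b) F"
  shows "((\<lambda>x. f x * g x) \<longlongrightarrow> a * b) F"
proof (rule tendsto_fpsI)
  fix d
  have "eventually (\<lambda>x. \<forall>i\<in>{0..d}. f x $ i = a $ i \<and> g x $ i = b $ i) F"
    using assms unfolding tendsto_fps_iff by (intro eventually_ball_finite) (auto intro: eventually_conj)
  then show "eventually (\<lambda>x. (f x * g x) $ d = (a * b) $ d) F"
    by eventually_elim (auto simp: fps_mult_nth intro!: sum.cong)
qed

text \<open>Local finiteness takes the place of domination: only finitely many i influence the
  coefficients up to d, whatever the power series \<open>g n i\<close> are.\<close>

lemma tannery_fps: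
  fixes f :: "'i \<Rightarrow> 'a :: comm_ring_1 fps"
  assumes "fps_sums f A S"
    and "\<And>i. i \<in> A \<Longrightarrow> (\<lambda>n. g n i) \<longlonglongrightarrow> c"
    and "\<And>i. i \<in> A \<Longrightarrow> eventually (\<lambda>n. i \<in> I n) sequentially"
    and "\<And>n. finite (I n)" "\<And>n. I n \<subseteq> A"
  shows "(\<lambda>n. \<Sum>i\<in>I n. f i * g n i) \<longlonglongrightarrow> S * c"
proof (rule tendsto_fpsI)
  fix d
  define B where "B = {x \<in> A. \<exists>e\<le>d. f x $ e \<noteq> 0}"
  have fin: "finite B"
    unfolding B_def by (rule fps_sums_finite_le[OF assms(1)])
  have "eventually (\<lambda>n. \<forall>i\<in>B. i \<in> I n \<and> (\<forall>e\<in>{0..d}. g n i $ e = c $ e)) sequentially"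
  proof (intro eventually_ball_finite fin ballI eventually_conj)
    fix i assume i: "i \<in> B"
    then show "eventually (\<lambda>n. i \<in> I n) sequentially"
      using assms(3) by (simp add: B_def)
    fix e
    show "eventually (\<lambda>n. g n i $ e = c $ e) sequentially"
      using assms(2)[of i] i unfolding tendsto_fps_iff by (simp add: B_def)
  qed simp
  then show "eventually (\<lambda>n. (\<Sum>i\<in>I n. f i * g n i) $ d = (S * c) $ d) sequentially"
  proof eventually_elim
    case (elim n)
    have "(\<Sum>i\<in>I n. f i * g n i) $ d = (\<Sum>i\<in>B. (f i * g n i) $ d)"
      unfolding fps_sum_nth
    proof (rule sum.mono_neutral_right)
      show "\<forall>i\<in>I n - B. (f i * g n i) $ d = 0"
        using assms(5)[of n] unfolding B_def fps_mult_nth by (intro ballI sum.neutral) auto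
    qed (use elim assms(4) in auto)
    also have "\<dots> = (\<Sum>i\<in>B. \<Sum>e=0..d. f i $ e * c $ (d - e))"
      unfolding fps_mult_nth using elim by (intro sum.cong refl) auto
    also have "\<dots> = (\<Sum>e=0..d. (\<Sum>i\<in>B. f i $ e) * c $ (d - e))"
      by (subst sum.swap) (simp add: sum_distrib_right)
    also have "\<dots> = (S * c) $ d"
      unfolding fps_mult_nth
    proof (intro sum.cong refl)
      fix e assume "e \<in> {0..d}"
      then show "(\<Sum>i\<in>B. f i $ e) * c $ (d - e) = S $ e * c $ (d - e)"
        using fps_sums_nth[OF assms(1) fin, of e] by (simp add: B_def)
    qed
    finally show ?case .
  qed
qed

lemma prodinf_fps:
  fixes f :: "nat \<Rightarrow> 'a :: idom fps"
  assumes "\<And>i. f i $ 0 = 1" "\<And>i e. 0 < e \<Longrightarrow> e \<le> i \<Longrightarrow> f i $ e = 0"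
  shows "(\<lambda>n. \<Prod>i<n. f i) \<longlonglongrightarrow> (\<Prod>i. f i)" "(\<Prod>i. f i) $ 0 = 1"
proof -
  define P where "P = Abs_fps (\<lambda>d. (\<Prod>i<Suc d. f i) $ d)"
  have step: "((\<Prod>i<n. f i) * f n) $ d = (\<Prod>i<n. f i) $ d" if "d \<le> n" for n d
  proof -
    have "((\<Prod>i<n. f i) * f n) $ d = (\<Sum>i\<in>{0..d}. (\<Prod>i<n. f i) $ i * f n $ (d - i))"
      by (rule fps_mult_nth)
    also have "\<dots> = (\<Sum>i\<in>{d}. (\<Prod>i<n. f i) $ i * f n $ (d - i))"
      using that assms(2) by (intro sum.mono_neutral_right) auto
    finally show ?thesis
      using assms(1) by simp
  qed
  have eq: "(\<Prod>i<n. f i) $ d = P $ d" if "d < n" for n d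
    using that
  proof (induction n)
    case (Suc n)
    then show ?case
      by (cases "d = n") (auto simp: step P_def)
  qed simp
  have lim: "(\<lambda>n. \<Prod>i<n. f i) \<longlonglongrightarrow> P"
  proof (rule tendsto_fpsI)
    fix d
    show "eventually (\<lambda>n. (\<Prod>i<n. f i) $ d = P $ d) sequentially"
      by (rule eventually_sequentiallyI[of "Suc d"]) (simp add: eq)
  qed
  \<comment> \<open>Convergence of an infinite product includes that the limit is nonzero.\<close>
  have P0: "P $ 0 = 1"
    by (simp add: P_def assms)
  then have "P \<noteq> 0"
    by auto
  moreover have "(\<lambda>n. \<Prod>i\<le>n. f i) \<longlonglongrightarrow> P"
    using LIMSEQ_Suc[OF lim] by (simp add: lessThan_Suc_atMost)
  ultimately have "f has_prod P"
    by (simp add: has_prod_def raw_has_prod_def)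
  then have "(\<Prod>i. f i) = P"
    using has_prod_unique by metis
  then show "(\<lambda>n. \<Prod>i<n. f i) \<longlonglongrightarrow> (\<Prod>i. f i)" "(\<Prod>i. f i) $ 0 = 1"
    using lim P0 by simp_all
qed

subsection \<open>The Jacobi triple product\<close>

definition c2 :: "int \<Rightarrow> int" where "c2 i = i * (i - 1) div 2"

lemma two_c2: "2 * c2 i = i * (i - 1)"
  by (simp add: c2_def)

lemma c2_shift: "c2 (i - 1) = c2 i - i + 1" "c2 (i + 1) = c2 i + i"
  using two_c2[of i] two_c2[of "i - 1"] two_c2[of "i + 1"] by (simp_all add: algebra_simps)

definition sg :: "int \<Rightarrow> 'a :: comm_ring_1" where "sg i = (if even i then 1 else - 1)"

lemma sg_0 [simp]: "sg 0 = 1"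
  by (simp add: sg_def)

lemma sg_pred: "sg (i - 1) = - sg i" and sg_Suc: "sg (i + 1) = - sg i"
  by (auto simp: sg_def)

context qfield
begin

definition jtp_sum :: "'a \<Rightarrow> nat \<Rightarrow> nat \<Rightarrow> 'a" where
  "jtp_sum z a b = (\<Sum>i\<in>{- int b..int a}. sg i * qe (c2 i) * z powi i * qb (int (a + b)) (int b + i))"

lemma jtp_sum_Suc1:
  assumes "z \<noteq> 0"
  shows "jtp_sum z (Suc a) b = jtp_sum z a b * (1 - z * q ^ a)"
proof -
  have "jtp_sum z a b * (z * q ^ a) = (\<Sum>i\<in>{- int b..int a}. sg i * qe (c2 i) * z powi (i + 1) * q ^ a * qb (int (a + b)) (int b + i))"
    unfolding jtp_sum_def sum_distrib_right using assms by (intro sum.cong refl) (simp add: power_int_add_1 mult_ac)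
  also have "\<dots> = (\<Sum>i\<in>{- int b + 1..int a + 1}. - sg i * qe (c2 (i - 1)) * z powi i * q ^ a * qb (int (a + b)) (int b + i - 1))"
    by (rule sum.reindex_bij_witness[of _ "\<lambda>i. i - 1" "\<lambda>i. i + 1"]) (auto simp: sg_Suc add_ac)
  also have "\<dots> = (\<Sum>i\<in>{- int b..int (Suc a)}. - sg i * qe (c2 (i - 1)) * z powi i * q ^ a * qb (int (a + b)) (int b + i - 1))"
    by (rule sum.mono_neutral_left) (auto simp: qb_eq_0)
  finally have 1: "jtp_sum z a b * (z * q ^ a) =
    (\<Sum>i\<in>{- int b..int (Suc a)}. - sg i * qe (c2 (i - 1)) * z powi i * q ^ a * qb (int (a + b)) (int b + i - 1))" .
  have 2: "jtp_sum z a b = (\<Sum>i\<in>{- int b..int (Suc a)}. sg i * qe (c2 i) * z powi i * qb (int (a + b)) (int b + i))"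
    unfolding jtp_sum_def by (rule sum.mono_neutral_left) (auto simp: qb_eq_0)
  have "jtp_sum z a b * (1 - z * q ^ a) = jtp_sum z a b - jtp_sum z a b * (z * q ^ a)"
    by (simp add: algebra_simps)
  also have "\<dots> = (\<Sum>i\<in>{- int b..int (Suc a)}. sg i * qe (c2 i) * z powi i * qb (int (a + b)) (int b + i) -
      - sg i * qe (c2 (i - 1)) * z powi i * q ^ a * qb (int (a + b)) (int b + i - 1))"
    unfolding 1 unfolding 2 by (simp only: sum_subtractf)
  also have "\<dots> = jtp_sum z (Suc a) b"
    unfolding jtp_sum_def
  proof (intro sum.cong refl)
    fix i
    have b: "qb (int (Suc a + b)) (int b + i) = qb (int (a + b)) (int b + i) + qe (int (a + b) + 1 - (int b + i)) * qb (int (a + b)) (int b + i - 1)"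
      using qb_pascal1[of "int (a + b)" "int b + i"] by (simp add: algebra_simps)
    have c: "qe (c2 (i - 1)) * q ^ a = qe (c2 i) * qe (int (a + b) + 1 - (int b + i))"
      by (simp add: qe_of_nat[symmetric] qe_add[symmetric] c2_shift algebra_simps)
    have "sg i * qe (c2 i) * z powi i * qb (int (a + b)) (int b + i) -
      - sg i * qe (c2 (i - 1)) * z powi i * q ^ a * qb (int (a + b)) (int b + i - 1) =
      sg i * z powi i * (qe (c2 i) * qb (int (a + b)) (int b + i) + (qe (c2 (i - 1)) * q ^ a) * qb (int (a + b)) (int b + i - 1))"
      by (simp only: distrib_left mult_minus_left mult_minus_right diff_minus_eq_add mult_ac)
    also have "\<dots> =
      sg i * qe (c2 i) * z powi i * qb (int (Suc a + b)) (int b + i)"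
      unfolding b c by (simp only: distrib_left mult_ac)
    finally show "sg i * qe (c2 i) * z powi i * qb (int (a + b)) (int b + i) -
      - sg i * qe (c2 (i - 1)) * z powi i * q ^ a * qb (int (a + b)) (int b + i - 1) =
      sg i * qe (c2 i) * z powi i * qb (int (Suc a + b)) (int b + i)" .
  qed
  finally show ?thesis ..
qed

lemma jtp_sum_Suc2:
  assumes "z \<noteq> 0"
  shows "jtp_sum z a (Suc b) = jtp_sum z a b * (1 - q ^ Suc b / z)"
proof -
  have "jtp_sum z a b * (q ^ Suc b / z) = (\<Sum>i\<in>{- int b..int a}. sg i * qe (c2 i) * z powi (i - 1) * q ^ Suc b * qb (int (a + b)) (int b + i))"
    unfolding jtp_sum_def sum_distrib_right using assms by (intro sum.cong refl) (simp add: power_int_diff mult_ac)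
  also have "\<dots> = (\<Sum>i\<in>{- int b - 1..int a - 1}. - sg i * qe (c2 (i + 1)) * z powi i * q ^ Suc b * qb (int (a + b)) (int b + i + 1))"
    by (rule sum.reindex_bij_witness[of _ "\<lambda>i. i + 1" "\<lambda>i. i - 1"]) (auto simp: sg_pred add_ac)
  also have "\<dots> = (\<Sum>i\<in>{- int (Suc b)..int a}. - sg i * qe (c2 (i + 1)) * z powi i * q ^ Suc b * qb (int (a + b)) (int b + i + 1))"
    by (rule sum.mono_neutral_left) (auto simp: qb_eq_0)
  finally have 1: "jtp_sum z a b * (q ^ Suc b / z) =
    (\<Sum>i\<in>{- int (Suc b)..int a}. - sg i * qe (c2 (i + 1)) * z powi i * q ^ Suc b * qb (int (a + b)) (int b + i + 1))" .
  have 2: "jtp_sum z a b = (\<Sum>i\<in>{- int (Suc b)..int a}. sg i * qe (c2 i) * z powi i * qb (int (a + b)) (int b + i))"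
    unfolding jtp_sum_def by (rule sum.mono_neutral_left) (auto simp: qb_eq_0)
  have "jtp_sum z a b * (1 - q ^ Suc b / z) = jtp_sum z a b - jtp_sum z a b * (q ^ Suc b / z)"
    by (simp add: algebra_simps)
  also have "\<dots> = (\<Sum>i\<in>{- int (Suc b)..int a}. sg i * qe (c2 i) * z powi i * qb (int (a + b)) (int b + i) -
      - sg i * qe (c2 (i + 1)) * z powi i * q ^ Suc b * qb (int (a + b)) (int b + i + 1))"
    unfolding 1 unfolding 2 by (simp only: sum_subtractf)
  also have "\<dots> = jtp_sum z a (Suc b)"
    unfolding jtp_sum_def
  proof (intro sum.cong refl)
    fix i
    have b: "qb (int (a + Suc b)) (int (Suc b) + i) = qb (int (a + b)) (int b + i) + qe (int b + i + 1) * qb (int (a + b)) (int b + i + 1)"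
      using qb_pascal2[of "int (a + b)" "int b + i + 1"] by (simp add: algebra_simps)
    have c: "qe (c2 (i + 1)) * q ^ Suc b = qe (c2 i) * qe (int b + i + 1)"
      unfolding qe_of_nat[symmetric] c2_shift by (simp add: qe_add[symmetric] algebra_simps)
    have "sg i * qe (c2 i) * z powi i * qb (int (a + b)) (int b + i) -
      - sg i * qe (c2 (i + 1)) * z powi i * q ^ Suc b * qb (int (a + b)) (int b + i + 1) =
      sg i * z powi i * (qe (c2 i) * qb (int (a + b)) (int b + i) + (qe (c2 (i + 1)) * q ^ Suc b) * qb (int (a + b)) (int b + i + 1))"
      by (simp only: distrib_left mult_minus_left mult_minus_right diff_minus_eq_add mult_ac)
    also have "\<dots> =
      sg i * qe (c2 i) * z powi i * qb (int (a + Suc b)) (int (Suc b) + i)"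
      unfolding b c by (simp only: distrib_left mult_ac)
    finally show "sg i * qe (c2 i) * z powi i * qb (int (a + b)) (int b + i) -
      - sg i * qe (c2 (i + 1)) * z powi i * q ^ Suc b * qb (int (a + b)) (int b + i + 1) =
      sg i * qe (c2 i) * z powi i * qb (int (a + Suc b)) (int (Suc b) + i)" .
  qed
  finally show ?thesis ..
qed

text \<open>Cauchy's finite form of the triple product. A further factor on either side amounts to
  one of the two Pascal rules.\<close>

lemma finite_jtp:
  assumes "z \<noteq> 0"
  shows "(\<Prod>i<a. 1 - z * q ^ i) * (\<Prod>i<b. 1 - q ^ Suc i / z) = jtp_sum z a b"
proof (induction b)
  case 0
  show ?case
  proof (induction a)
    case 0
    show ?case
      by (simp add: jtp_sum_def qb_def c2_def)
  next
    case (Suc a)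
    then show ?case
      by (simp add: jtp_sum_Suc1[OF assms])
  qed
next
  case (Suc b)
  have "(\<Prod>i<a. 1 - z * q ^ i) * (\<Prod>i<Suc b. 1 - q ^ Suc i / z) =
    ((\<Prod>i<a. 1 - z * q ^ i) * (\<Prod>i<b. 1 - q ^ Suc i / z)) * (1 - q ^ Suc b / z)"
    by (simp only: prod.lessThan_Suc mult.assoc)
  then show ?case
    by (simp only: Suc.IH jtp_sum_Suc2[OF assms])
qed

end

section \<open>Transfer between power series and Laurent series\<close>

lemma fps_to_fls_sum: "fps_to_fls (\<Sum>x\<in>A. f x) = (\<Sum>x\<in>A. fps_to_fls (f x :: 'a :: comm_ring_1 fps))"
  by (induction A rule: infinite_finite_induct) auto

lemma fps_to_fls_prod: "fps_to_fls (\<Prod>x\<in>A. f x) = (\<Prod>x\<in>A. fps_to_fls (f x :: 'a :: comm_ring_1 fps))"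
  by (induction A rule: infinite_finite_induct) (auto simp: fls_times_fps_to_fls)

lemma fps_to_fls_inverse: "f $ 0 \<noteq> 0 \<Longrightarrow> fps_to_fls (inverse (f :: 'a :: field fps)) = inverse (fps_to_fls f)"
  by (rule fls_inverse_fps_to_fls[symmetric]) (simp add: subdegree_eq_0_iff)

lemma qfield_fls:
  assumes "K > 0"
  shows "qfield (fls_X ^ K :: rat fls)"
proof
  show "(fls_X ^ K :: rat fls) \<noteq> 0"
    by simp
  fix n :: nat assume "n > 0"
  then have "(fps_X ^ (K * n) :: rat fps) $ 0 \<noteq> 1 $ 0"
    using assms by (simp add: fps_X_power_nth)
  then have "(fps_X ^ (K * n) :: rat fps) \<noteq> 1"
    by metis
  moreover have "(fls_X ^ K :: rat fls) ^ n = fps_to_fls (fps_X ^ (K * n))"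
    by (simp only: fps_to_fls_power fps_X_to_fls power_mult)
  ultimately show "(fls_X ^ K :: rat fls) ^ n \<noteq> 1"
    by (simp only: fps_to_fls_eq_1_iff not_False_eq_True)
qed

lemma
  assumes "s > 0" "K > 0"
  shows qpoch_inf_LIMSEQ: "(\<lambda>n. \<Prod>i<n. 1 - fps_X ^ s * (fps_X ^ K) ^ i) \<longlonglongrightarrow> qpoch_inf (fps_X ^ s) (fps_X ^ K)"
    and qpoch_inf_nth_0: "qpoch_inf (fps_X ^ s) (fps_X ^ K) $ 0 = 1"
proof -
  define f :: "nat \<Rightarrow> rat fps" where "f i = 1 - fps_X ^ s * (fps_X ^ K) ^ i" for i
  have f: "f i = 1 - fps_X ^ (s + K * i)" for i
    by (simp add: f_def power_add power_mult)
  have "f i $ e = 0" if "0 < e" "e \<le> i" for i e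
  proof -
    have "i \<le> K * i"
      using assms by simp
    then have "e < s + K * i"
      using that assms by linarith
    then show ?thesis
      using that by (simp add: f fps_X_power_nth)
  qed
  moreover have "f i $ 0 = 1" for i
    using assms by (simp add: f fps_X_power_nth)
  ultimately show "(\<lambda>n. \<Prod>i<n. 1 - fps_X ^ s * (fps_X ^ K) ^ i) \<longlonglongrightarrow> qpoch_inf (fps_X ^ s) (fps_X ^ K)"
    "qpoch_inf (fps_X ^ s) (fps_X ^ K) $ 0 = 1"
    using prodinf_fps[of f] unfolding qpoch_inf_def f_def by blast+
qed

definition qfin :: "nat \<Rightarrow> nat \<Rightarrow> rat fps" where
  "qfin K n = (\<Prod>i<n. 1 - fps_X ^ K * (fps_X ^ K) ^ i)"

lemma qfin_nth_0: "K > 0 \<Longrightarrow> qfin K n $ 0 = 1"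
  by (induction n) (auto simp: qfin_def fps_X_power_nth power_mult[symmetric] power_add[symmetric])

lemma qfin_LIMSEQ: "K > 0 \<Longrightarrow> qfin K \<longlonglongrightarrow> qpoch_inf (fps_X ^ K) (fps_X ^ K)"
  using qpoch_inf_LIMSEQ[of K K] by (simp add: qfin_def[abs_def])

lemma qfin_shift_LIMSEQ:
  assumes "K > 0" "filterlim h sequentially sequentially"
  shows "(\<lambda>n. qfin K (h n)) \<longlonglongrightarrow> qpoch_inf (fps_X ^ K) (fps_X ^ K)"
  using filterlim_compose[OF qfin_LIMSEQ[OF assms(1)] assms(2)] .

lemma qfin_inverse_LIMSEQ:
  assumes "K > 0" "filterlim h sequentially sequentially"
  shows "(\<lambda>n. inverse (qfin K (h n))) \<longlonglongrightarrow> inverse (qpoch_inf (fps_X ^ K) (fps_X ^ K))"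
  by (rule tendsto_inverse_fps[OF qfin_shift_LIMSEQ[OF assms]]) (simp add: qpoch_inf_nth_0 assms)

lemma filterlim_sequentially_shift:
  fixes h :: "nat \<Rightarrow> nat"
  assumes "\<And>n. n \<le> h n + c"
  shows "filterlim h sequentially sequentially"
  unfolding filterlim_at_top
proof
  fix Z
  show "eventually (\<lambda>n. Z \<le> h n) sequentially"
    by (rule eventually_sequentiallyI[of "Z + c"]) (use assms in \<open>metis add_le_cancel_right le_trans\<close>)
qed

definition jtp_exp :: "nat \<Rightarrow> nat \<Rightarrow> int \<Rightarrow> int" where
  "jtp_exp K s i = int K * c2 i + int s * i"

text \<open>A linear bound suffices: it makes the theta series locally finite and, in
  \<open>fps_finite_jtp\<close>, brings its terms back from Laurent series to power series.\<close>

lemma jtp_exp_ge: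
  assumes "0 < s" "s < K"
  shows "\<bar>i\<bar> \<le> jtp_exp K s i"
proof (cases "i \<ge> 0")
  case True
  then have "0 \<le> i * (i - 1)"
    by (cases "i = 0") auto
  then have "0 \<le> int K * c2 i"
    using two_c2[of i] by simp
  moreover have "i \<le> int s * i"
    using True assms mult_right_mono[of 1 "int s" i] by simp
  ultimately show ?thesis
    using True by (simp add: jtp_exp_def)
next
  case False
  have "0 \<le> (i + 1) * i"
    using False mult_nonpos_nonpos[of "i + 1" i] by simp
  then have "- i \<le> c2 i"
    using two_c2[of i] by (simp add: algebra_simps)
  then have "int K * (- i) \<le> int K * c2 i"
    by (rule mult_left_mono) simp
  moreover have "(int K - int s) * (- i) \<ge> 1 * (- i)"
    using False assms by (intro mult_right_mono) auto
  ultimately show ?thesis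
    using False by (simp add: jtp_exp_def algebra_simps)
qed

lemma jtp_exp_nonneg: "0 < s \<Longrightarrow> s < K \<Longrightarrow> 0 \<le> jtp_exp K s i"
  using jtp_exp_ge[of s K i] by linarith

definition jtp_term :: "nat \<Rightarrow> nat \<Rightarrow> int \<Rightarrow> rat fps" where
  "jtp_term K s i = sg i * fps_X ^ nat (jtp_exp K s i)"

lemma sg_mult_nth: "(sg i * f) $ d = (sg i :: 'a :: comm_ring_1) * f $ d"
  by (simp add: sg_def)

lemma qtheta_X_power:
  assumes "s \<le> K"
  shows "qtheta (fps_X ^ s) (fps_X ^ K) = qpoch_inf (fps_X ^ s) (fps_X ^ K) * qpoch_inf (fps_X ^ (K - s)) (fps_X ^ K)"
proof -
  have "(fps_X ^ K :: rat fps) = fps_X ^ s * fps_X ^ (K - s)"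
    using assms by (simp flip: power_add)
  moreover have "(fps_X ^ s :: rat fps) * fps_X ^ (K - s) / fps_X ^ s = fps_X ^ (K - s)"
    by (rule nonzero_mult_div_cancel_left) simp
  ultimately have "fps_X ^ K / fps_X ^ s = (fps_X ^ (K - s) :: rat fps)"
    by (simp only:)
  then show ?thesis
    by (simp add: qtheta_def)
qed

lemma fls_X_powi_of_int: "0 \<le> e \<Longrightarrow> (fls_X :: rat fls) powi e = fps_to_fls (fps_X ^ nat e)"
  by (metis fps_X_to_fls fps_to_fls_power nat_0_le power_int_of_nat)

lemma fps_to_fls_qfin:
  assumes "K > 0"
  shows "fps_to_fls (qfin K n) = qfield.qp (fls_X ^ K) (int n)"
proof -
  interpret qfield "fls_X ^ K :: rat fls"
    by (rule qfield_fls) fact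
  show ?thesis
    by (simp add: qfin_def qp_def fps_to_fls_prod fls_times_fps_to_fls fps_to_fls_power)
qed

lemma fps_to_fls_sg: "fps_to_fls (sg i :: 'a :: comm_ring_1 fps) = sg i"
  by (simp add: sg_def)

lemma fps_finite_jtp:
  assumes "0 < s" "s < K"
  shows "(\<Prod>i<n. 1 - fps_X ^ s * (fps_X ^ K) ^ i) * (\<Prod>i<n. 1 - fps_X ^ (K - s) * (fps_X ^ K) ^ i) =
    (\<Sum>i\<in>{- int n..int n}. jtp_term K s i *
      (qfin K (2 * n) * inverse (qfin K (nat (int n + i))) * inverse (qfin K (nat (int n - i)))))"
proof -
  interpret qfield "fls_X ^ K :: rat fls"
    by (rule qfield_fls) (use assms in simp)
  define z where "z = (fls_X ^ s :: rat fls)"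
  have "fps_to_fls ((\<Prod>i<n. 1 - fps_X ^ s * (fps_X ^ K) ^ i) * (\<Prod>i<n. 1 - fps_X ^ (K - s) * (fps_X ^ K) ^ i)) =
     (\<Prod>i<n. 1 - z * (fls_X ^ K) ^ i) * (\<Prod>i<n. 1 - (fls_X ^ K) ^ Suc i / z)"
  proof -
    have "(fls_X ^ K :: rat fls) ^ Suc i / z = fls_X ^ (K - s) * (fls_X ^ K) ^ i" for i
    proof -
      have "(fls_X ^ K :: rat fls) = fls_X ^ (K - s) * fls_X ^ s"
        using assms by (simp flip: power_add)
      moreover have "(fls_X :: rat fls) ^ (K - s) * fls_X ^ s / fls_X ^ s = fls_X ^ (K - s)"
        by (rule nonzero_mult_div_cancel_right) simp
      ultimately have "(fls_X ^ K :: rat fls) / z = fls_X ^ (K - s)"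
        unfolding z_def by (simp only:)
      then show ?thesis
        by (simp only: power_Suc times_divide_eq_left[symmetric])
    qed
    then show ?thesis
      by (simp only: fls_times_fps_to_fls fps_to_fls_prod fps_to_fls_power z_def fps_to_fls_minus fps_one_to_fls fps_X_to_fls)
  qed
  also have "\<dots> = jtp_sum z n n"
    by (rule finite_jtp) (simp add: z_def)
  also have "\<dots> = fps_to_fls (\<Sum>i\<in>{- int n..int n}. jtp_term K s i *
      (qfin K (2 * n) * inverse (qfin K (nat (int n + i))) * inverse (qfin K (nat (int n - i)))))"
    unfolding jtp_sum_def fps_to_fls_sum
  proof (intro sum.cong refl)
    fix i assume i: "i \<in> {- int n..int n}"
    have "qe (c2 i) * z powi i = fls_X powi (jtp_exp K s i)"
    proof -
      have "(fls_X :: rat fls) powi (jtp_exp K s i) = fls_X powi (int K * c2 i) * fls_X powi (int s * i)"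
        unfolding jtp_exp_def by (rule power_int_add) simp
      then show ?thesis
        by (simp only: qe_def z_def power_int_mult power_int_of_nat)
    qed
    also have "\<dots> = fps_to_fls (fps_X ^ nat (jtp_exp K s i))"
      using assms by (intro fls_X_powi_of_int jtp_exp_nonneg)
    finally have "sg i * qe (c2 i) * z powi i = fps_to_fls (jtp_term K s i)"
      by (simp add: jtp_term_def fls_times_fps_to_fls fps_to_fls_sg mult.assoc)
    moreover have "qb (int (n + n)) (int n + i) =
       fps_to_fls (qfin K (2 * n) * inverse (qfin K (nat (int n + i))) * inverse (qfin K (nat (int n - i))))"
      using i assms
      by (simp add: qb_def ri_def fls_times_fps_to_fls fps_to_fls_inverse qfin_nth_0 fps_to_fls_qfin)
    ultimately show "sg i * qe (c2 i) * z powi i * qb (int (n + n)) (int n + i) = fps_to_fls (jtp_term K s i *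
      (qfin K (2 * n) * inverse (qfin K (nat (int n + i))) * inverse (qfin K (nat (int n - i)))))"
      by (simp add: fls_times_fps_to_fls)
  qed
  finally show ?thesis
    by (simp only: fps_to_fls_eq_iff)
qed

text \<open>With n factors on both sides and n to infinity, the q-binomial coefficient at a fixed i
  tends to 1/P; this accounts for the factor P.\<close>

lemma jacobi_triple_product:
  assumes "0 < s" "s < K"
  shows "fps_sums (jtp_term K s) UNIV (qpoch_inf (fps_X ^ K) (fps_X ^ K) * qtheta (fps_X ^ s) (fps_X ^ K))"
proof -
  define P where "P = qpoch_inf (fps_X ^ K) (fps_X ^ K)"
  have K: "K > 0"
    using assms by simp
  have P0: "P $ 0 = 1"
    unfolding P_def by (rule qpoch_inf_nth_0[OF K K])
  have "finite {i \<in> UNIV. jtp_term K s i $ d \<noteq> 0}" for d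
  proof (rule finite_subset)
    show "{i \<in> UNIV. jtp_term K s i $ d \<noteq> 0} \<subseteq> {- int d..int d}"
    proof
      fix i assume "i \<in> {i \<in> UNIV. jtp_term K s i $ d \<noteq> 0}"
      then have "nat (jtp_exp K s i) = d"
        by (auto simp: jtp_term_def sg_mult_nth fps_X_power_nth split: if_splits)
      then show "i \<in> {- int d..int d}"
        using jtp_exp_ge[OF assms, of i] by auto
    qed
  qed simp
  then obtain S where S: "fps_sums (jtp_term K s) UNIV S"
    by (rule fps_sums_exists)
  have "(\<lambda>n. \<Sum>i\<in>{- int n..int n}. jtp_term K s i *
      (qfin K (2 * n) * inverse (qfin K (nat (int n + i))) * inverse (qfin K (nat (int n - i))))) \<longlonglongrightarrow>
      S * (P * inverse P * inverse P)"
  proof (rule tannery_fps[OF S])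
    fix i :: int
    show "(\<lambda>n. qfin K (2 * n) * inverse (qfin K (nat (int n + i))) * inverse (qfin K (nat (int n - i)))) \<longlonglongrightarrow> P * inverse P * inverse P"
      unfolding P_def
      by (intro tendsto_mult_fps qfin_shift_LIMSEQ qfin_inverse_LIMSEQ K)
        (rule filterlim_sequentially_shift[of _ "nat \<bar>i\<bar>"], simp)+
    show "eventually (\<lambda>n. i \<in> {- int n..int n}) sequentially"
      by (rule eventually_sequentiallyI[of "nat \<bar>i\<bar>"]) auto
  qed auto
  moreover have "(\<lambda>n. (\<Prod>i<n. 1 - fps_X ^ s * (fps_X ^ K) ^ i) * (\<Prod>i<n. 1 - fps_X ^ (K - s) * (fps_X ^ K) ^ i)) \<longlonglongrightarrow>
      qpoch_inf (fps_X ^ s) (fps_X ^ K) * qpoch_inf (fps_X ^ (K - s)) (fps_X ^ K)"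
    using assms by (intro tendsto_mult_fps qpoch_inf_LIMSEQ) auto
  ultimately have "S * (P * inverse P * inverse P) = qtheta (fps_X ^ s) (fps_X ^ K)"
    using assms qtheta_X_power[of s K] unfolding fps_finite_jtp[OF assms] by (simp add: LIMSEQ_unique)
  moreover have "P * inverse P = 1"
    using inverse_mult_eq_1'[of P] P0 by simp
  ultimately have "S = P * qtheta (fps_X ^ s) (fps_X ^ K)"
    by (metis mult.commute mult.left_commute mult.right_neutral)
  then show ?thesis
    using S by (simp add: P_def)
qed

lemma qpoch_inf_trisect:
  assumes "K > 0"
  shows "qpoch_inf (fps_X ^ K) (fps_X ^ K) =
    qpoch_inf (fps_X ^ (3 * K)) (fps_X ^ (3 * K)) * (qpoch_inf (fps_X ^ (2 * K)) (fps_X ^ (3 * K)) * qpoch_inf (fps_X ^ K) (fps_X ^ (3 * K)))"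
proof (rule LIMSEQ_unique)
  have "filterlim (\<lambda>n. 3 * n) sequentially sequentially"
    by (rule filterlim_sequentially_shift[of _ 0]) simp
  then show "(\<lambda>n. qfin K (3 * n)) \<longlonglongrightarrow> qpoch_inf (fps_X ^ K) (fps_X ^ K)"
    by (rule qfin_shift_LIMSEQ[OF assms])
  have "qfin K (3 * n) = (\<Prod>i<n. 1 - fps_X ^ (3 * K) * (fps_X ^ (3 * K)) ^ i) *
      ((\<Prod>i<n. 1 - fps_X ^ (2 * K) * (fps_X ^ (3 * K)) ^ i) * (\<Prod>i<n. 1 - fps_X ^ K * (fps_X ^ (3 * K)) ^ i))" for n
  proof (induction n)
    case (Suc n)
    have "3 * Suc n = Suc (Suc (Suc (3 * n)))"
      by simp
    then have *: "qfin K (3 * Suc n) = qfin K (3 * n) *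
      (1 - fps_X ^ K * (fps_X ^ K) ^ (3 * n)) * (1 - fps_X ^ K * (fps_X ^ K) ^ Suc (3 * n)) * (1 - fps_X ^ K * (fps_X ^ K) ^ Suc (Suc (3 * n)))"
      by (simp only: qfin_def prod.lessThan_Suc)
    have **: "fps_X ^ K * (fps_X ^ K) ^ (3 * n) = fps_X ^ K * (fps_X ^ (3 * K) :: rat fps) ^ n"
      "fps_X ^ K * (fps_X ^ K) ^ Suc (3 * n) = fps_X ^ (2 * K) * (fps_X ^ (3 * K) :: rat fps) ^ n"
      "fps_X ^ K * (fps_X ^ K) ^ Suc (Suc (3 * n)) = fps_X ^ (3 * K) * (fps_X ^ (3 * K) :: rat fps) ^ n"
      by (simp_all only: power_mult[symmetric] power_add[symmetric]) (simp_all add: algebra_simps)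
    show ?case
      unfolding * ** Suc.IH prod.lessThan_Suc by (simp only: mult_ac)
  qed (simp add: qfin_def)
  then show "(\<lambda>n. qfin K (3 * n)) \<longlonglongrightarrow>
     qpoch_inf (fps_X ^ (3 * K)) (fps_X ^ (3 * K)) * (qpoch_inf (fps_X ^ (2 * K)) (fps_X ^ (3 * K)) * qpoch_inf (fps_X ^ K) (fps_X ^ (3 * K)))"
    using assms by (simp only:) (intro tendsto_mult_fps qpoch_inf_LIMSEQ, simp_all)
qed

text \<open>The triple product in base q^(3 K): its three products collect the exponents congruent
  to 0, 2 K and K modulo 3 K. The parameter 2 K gives the exponent 3 c2(t) + 2 t that occurs in
  \<open>c2_triple_0\<close>.\<close>

lemma pentagonal:
  assumes "K > 0"
  shows "fps_sums (jtp_term (3 * K) (2 * K)) UNIV (qpoch_inf (fps_X ^ K) (fps_X ^ K))"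
  using jacobi_triple_product[of "2 * K" "3 * K"] assms
  by (simp add: qtheta_X_power qpoch_inf_trisect[OF assms])

subsection \<open>Macdonald's identity for the affine root system of type A2\<close>

definition mac_chi :: "int \<Rightarrow> rat fps" where
  "mac_chi d = (if d mod 3 = 1 then 1 else if d mod 3 = 2 then - 1 else 0)"

definition mac_exp :: "nat \<Rightarrow> nat \<Rightarrow> nat \<Rightarrow> int \<Rightarrow> int \<Rightarrow> int" where
  "mac_exp K s t A B = int K * ((A\<^sup>2 + B\<^sup>2 - A * B - A - B) div 3) + int s * A + int t * B"

text \<open>The character vanishes if A + B is 2 modulo 3. Otherwise 3 divides (A + B) (A + B - 1) -
  3 A B, so the division in \<open>mac_exp\<close> is exact.\<close>

definition mac_term :: "nat \<Rightarrow> nat \<Rightarrow> nat \<Rightarrow> int \<times> int \<Rightarrow> rat fps" where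
  "mac_term K s t = (\<lambda>(A, B). mac_chi (A + B + 1) * fps_X ^ nat (mac_exp K s t A B))"

text \<open>As a function of l, the sum c2(A - l) + c2(B - l) + c2(l) is quadratic with vertex (A +
  B)/3 - 1/6. The distance of the vertex from the integers decides: for A + B congruent to 0 or 1
  modulo 3 the exponents are pentagonal, with t reversed in the second case; for 2 they are
  symmetric about h + 1/2.\<close>

lemma c2_triple_0:
  assumes "A + B = 3 * h"
  shows "c2 (A - (h + t)) + c2 (B - (h + t)) + c2 (h + t) = (A\<^sup>2 + B\<^sup>2 - A * B - A - B) div 3 + (3 * c2 t + 2 * t)"
proof -
  have B: "B = 3 * h - A"
    using assms by simp
  have "A\<^sup>2 + B\<^sup>2 - A * B - A - B = 3 * (h * (3 * h - 1) - A * B)"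
    unfolding B by (simp add: power2_eq_square algebra_simps)
  then have Q: "(A\<^sup>2 + B\<^sup>2 - A * B - A - B) div 3 = h * (3 * h - 1) - A * B"
    by simp
  have "2 * (c2 (A - (h + t)) + c2 (B - (h + t)) + c2 (h + t)) = 2 * (h * (3 * h - 1) - A * B + (3 * c2 t + 2 * t))"
    using two_c2[of "A - (h + t)"] two_c2[of "B - (h + t)"] two_c2[of "h + t"] two_c2[of t]
    unfolding B by (simp add: algebra_simps)
  then show ?thesis
    unfolding Q by simp
qed

lemma c2_triple_1:
  assumes "A + B = 3 * h + 1"
  shows "c2 (A - (h + t)) + c2 (B - (h + t)) + c2 (h + t) = (A\<^sup>2 + B\<^sup>2 - A * B - A - B) div 3 + (3 * c2 (- t) + 2 * (- t))"
proof -
  have B: "B = 3 * h + 1 - A"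
    using assms by simp
  have "A\<^sup>2 + B\<^sup>2 - A * B - A - B = 3 * (h * (3 * h + 1) - A * B)"
    unfolding B by (simp add: power2_eq_square algebra_simps)
  then have Q: "(A\<^sup>2 + B\<^sup>2 - A * B - A - B) div 3 = h * (3 * h + 1) - A * B"
    by simp
  have "2 * (c2 (A - (h + t)) + c2 (B - (h + t)) + c2 (h + t)) = 2 * (h * (3 * h + 1) - A * B + (3 * c2 (- t) + 2 * (- t)))"
    using two_c2[of "A - (h + t)"] two_c2[of "B - (h + t)"] two_c2[of "h + t"] two_c2[of "- t"]
    unfolding B by (simp add: algebra_simps)
  then show ?thesis
    unfolding Q by simp
qed

lemma c2_triple_2:
  assumes "A + B = 3 * h + 2"
  shows "c2 (A - (2 * h + 1 - l)) + c2 (B - (2 * h + 1 - l)) + c2 (2 * h + 1 - l) = c2 (A - l) + c2 (B - l) + c2 l"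
proof -
  have B: "B = 3 * h + 2 - A"
    using assms by simp
  have "2 * (c2 (A - (2 * h + 1 - l)) + c2 (B - (2 * h + 1 - l)) + c2 (2 * h + 1 - l)) = 2 * (c2 (A - l) + c2 (B - l) + c2 l)"
    using two_c2[of "A - (2 * h + 1 - l)"] two_c2[of "B - (2 * h + 1 - l)"] two_c2[of "2 * h + 1 - l"]
      two_c2[of "A - l"] two_c2[of "B - l"] two_c2[of l]
    unfolding B by (simp add: algebra_simps)
  then show ?thesis
    by simp
qed

lemma jtp_exp_triple:
  "jtp_exp K s (A - l) + jtp_exp K t (B - l) + jtp_exp K (s + t) l =
     int K * (c2 (A - l) + c2 (B - l) + c2 l) + int s * A + int t * B"
  by (simp add: jtp_exp_def algebra_simps)

text \<open>The value of the triple exponent at l = h. It gives \<open>mac_exp\<close> its lower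
  bound via \<open>jtp_exp_ge\<close>.\<close>

lemma mac_exp_jtp:
  assumes "(A + B) mod 3 \<noteq> 2"
  defines "h \<equiv> (A + B) div 3"
  shows "mac_exp K s t A B = jtp_exp K s (A - h) + jtp_exp K t (B - h) + jtp_exp K (s + t) h"
proof -
  have "A + B = 3 * h + (A + B) mod 3" "(A + B) mod 3 = 0 \<or> (A + B) mod 3 = 1"
    using assms by (simp_all add: h_def) presburger
  then have "A + B = 3 * h \<or> A + B = 3 * h + 1"
    by linarith
  then have "c2 (A - h) + c2 (B - h) + c2 h = (A\<^sup>2 + B\<^sup>2 - A * B - A - B) div 3"
    using c2_triple_0[of A B h 0] c2_triple_1[of A B h 0] by (auto simp: c2_def)
  then show ?thesis
    unfolding jtp_exp_triple mac_exp_def by simp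
qed

lemma mac_exp_ge:
  assumes "(A + B) mod 3 \<noteq> 2" "0 < s" "0 < t" "s + t < K"
  shows "\<bar>A\<bar> \<le> mac_exp K s t A B" "\<bar>B\<bar> \<le> mac_exp K s t A B"
proof -
  define h where "h = (A + B) div 3"
  show "\<bar>A\<bar> \<le> mac_exp K s t A B" "\<bar>B\<bar> \<le> mac_exp K s t A B"
    unfolding mac_exp_jtp[OF assms(1), folded h_def]
    using jtp_exp_ge[of s K "A - h"] jtp_exp_ge[of t K "B - h"] jtp_exp_ge[of "s + t" K h] assms by linarith+
qed

lemma finite_mac_term:
  assumes "0 < s" "0 < t" "s + t < K"
  shows "finite {z \<in> UNIV. mac_term K s t z $ d \<noteq> 0}"
proof (rule finite_subset)
  show "{z \<in> UNIV. mac_term K s t z $ d \<noteq> 0} \<subseteq> {- int d..int d} \<times> {- int d..int d}"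
  proof clarify
    fix A B assume nz: "mac_term K s t (A, B) $ d \<noteq> 0"
    have "(A + B) mod 3 \<noteq> 2"
    proof
      assume "(A + B) mod 3 = 2"
      then have "(A + B + 1) mod 3 = 0"
        by presburger
      then show False
        using nz by (simp add: mac_term_def mac_chi_def)
    qed
    note ge = mac_exp_ge[OF this assms]
    have "nat (mac_exp K s t A B) = d"
      using nz by (auto simp: mac_term_def mac_chi_def fps_X_power_nth split: if_splits)
    then show "A \<in> {- int d..int d} \<and> B \<in> {- int d..int d}"
      using ge by auto
  qed
qed simp

lemma fps_sums_monomial_shift:
  assumes "fps_sums (jtp_term K s) UNIV S" "0 < s" "s < K" "bij g" "0 \<le> c"
  shows "fps_sums (\<lambda>l. sg (g l) * fps_X ^ nat (c + jtp_exp K s (g l))) UNIV (fps_X ^ nat c * S)"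
proof -
  have "fps_sums (\<lambda>i. jtp_term K s i * fps_X ^ nat c) UNIV (S * fps_X ^ nat c)"
    by (rule fps_sums_mult_right) fact
  from fps_sums_reindex[OF assms(4) this] have "fps_sums (\<lambda>l. jtp_term K s (g l) * fps_X ^ nat c) UNIV (S * fps_X ^ nat c)" .
  moreover have "jtp_term K s (g l) * fps_X ^ nat c = sg (g l) * fps_X ^ nat (c + jtp_exp K s (g l))" for l
    using jtp_exp_nonneg[OF assms(2,3), of "g l"] assms(5)
    by (simp add: jtp_term_def nat_add_distrib power_add mult_ac)
  ultimately show ?thesis
    by (simp add: mult.commute)
qed

lemma macdonald_inner:
  assumes "0 < s" "0 < t" "s + t < K"
  shows "fps_sums (\<lambda>l. jtp_term K s (A - l) * jtp_term K t (B - l) * jtp_term K (s + t) l) UNIV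
    (mac_term K s t (A, B) * qpoch_inf (fps_X ^ K) (fps_X ^ K))"
proof -
  define h where "h = (A + B) div 3"
  define E where "E l = jtp_exp K s (A - l) + jtp_exp K t (B - l) + jtp_exp K (s + t) l" for l
  define F where "F l = jtp_term K s (A - l) * jtp_term K t (B - l) * jtp_term K (s + t) l" for l
  define P where "P = qpoch_inf (fps_X ^ K) (fps_X ^ K)"
  have K: "K > 0"
    using assms by simp
  have F: "F l = sg (A + B + l) * fps_X ^ nat (E l)" for l
  proof -
    have "sg (A - l) * sg (B - l) * sg l = (sg (A + B + l) :: rat fps)"
      by (auto simp: sg_def)
    moreover have "fps_X ^ nat (E l) = fps_X ^ nat (jtp_exp K s (A - l)) * fps_X ^ nat (jtp_exp K t (B - l)) * (fps_X ^ nat (jtp_exp K (s + t) l) :: rat fps)"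
      using jtp_exp_nonneg[of s K "A - l"] jtp_exp_nonneg[of t K "B - l"] jtp_exp_nonneg[of "s + t" K l] assms
      by (simp add: E_def nat_add_distrib power_add)
    moreover have "F l = (sg (A - l) * sg (B - l) * sg l) *
       (fps_X ^ nat (jtp_exp K s (A - l)) * fps_X ^ nat (jtp_exp K t (B - l)) * fps_X ^ nat (jtp_exp K (s + t) l))"
      by (simp only: F_def jtp_term_def mult_ac)
    ultimately show ?thesis
      by (simp only:)
  qed
  have E: "E l = int K * (c2 (A - l) + c2 (B - l) + c2 l) + int s * A + int t * B" for l
    unfolding E_def by (rule jtp_exp_triple)
  have E_ge: "\<bar>l\<bar> \<le> E l" for l
    using jtp_exp_nonneg[of s K "A - l"] jtp_exp_nonneg[of t K "B - l"] jtp_exp_ge[of "s + t" K l] assms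
    by (simp add: E_def)
  have pent: "fps_sums (jtp_term (3 * K) (2 * K)) UNIV P"
    unfolding P_def by (rule pentagonal[OF K])
  have "A + B = 3 * h + (A + B) mod 3"
    by (simp add: h_def)
  moreover have "(A + B) mod 3 = 0 \<or> (A + B) mod 3 = 1 \<or> (A + B) mod 3 = 2"
    by presburger
  ultimately consider (0) "A + B = 3 * h" "(A + B) mod 3 = 0" | (1) "A + B = 3 * h + 1" "(A + B) mod 3 = 1" | (2) "A + B = 3 * h + 2" "(A + B) mod 3 = 2"
    by linarith
  then have "fps_sums F UNIV (mac_term K s t (A, B) * P)"
  proof cases
    case 0
    have "bij (\<lambda>l. l - h)"
      by (rule bij_betw_byWitness[of _ "\<lambda>l. l + h"]) auto
    moreover have "0 \<le> mac_exp K s t A B"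
      using mac_exp_ge(1)[OF _ assms, of A B] 0 by simp
    ultimately have "fps_sums (\<lambda>l. sg (l - h) * fps_X ^ nat (mac_exp K s t A B + jtp_exp (3 * K) (2 * K) (l - h))) UNIV (fps_X ^ nat (mac_exp K s t A B) * P)"
      using fps_sums_monomial_shift[OF pent] K by simp
    moreover have "sg (l - h) * fps_X ^ nat (mac_exp K s t A B + jtp_exp (3 * K) (2 * K) (l - h)) = F l" for l
    proof -
      have "E l = mac_exp K s t A B + jtp_exp (3 * K) (2 * K) (l - h)"
      proof -
        have D: "c2 (A - l) + c2 (B - l) + c2 l = (A\<^sup>2 + B\<^sup>2 - A * B - A - B) div 3 + (3 * c2 (l - h) + 2 * (l - h))"
          using c2_triple_0[OF 0(1), of "l - h"] by simp
        show ?thesis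
          unfolding E D mac_exp_def jtp_exp_def by (simp add: algebra_simps)
      qed
      moreover have "sg (A + B + l) = (sg (l - h) :: rat fps)"
        using 0(1) by (simp add: sg_def)
      ultimately show ?thesis
        by (simp add: F)
    qed
    moreover have "mac_term K s t (A, B) = fps_X ^ nat (mac_exp K s t A B)"
    proof -
      have "(A + B + 1) mod 3 = 1"
        using 0(2) by presburger
      then show ?thesis
        by (simp add: mac_term_def mac_chi_def)
    qed
    ultimately show ?thesis
      by simp
  next
    case 1
    have "bij (\<lambda>l. h - l)"
      by (rule bij_betw_byWitness[of _ "\<lambda>l. h - l"]) auto
    moreover have "0 \<le> mac_exp K s t A B"
      using mac_exp_ge(1)[OF _ assms, of A B] 1 by simp
    ultimately have "fps_sums (\<lambda>l. sg (h - l) * fps_X ^ nat (mac_exp K s t A B + jtp_exp (3 * K) (2 * K) (h - l))) UNIV (fps_X ^ nat (mac_exp K s t A B) * P)"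
      using fps_sums_monomial_shift[OF pent] K by simp
    from fps_sums_mult_right[OF this, of "- 1"]
    have "fps_sums (\<lambda>l. - (sg (h - l) * fps_X ^ nat (mac_exp K s t A B + jtp_exp (3 * K) (2 * K) (h - l)))) UNIV (- (fps_X ^ nat (mac_exp K s t A B) * P))"
      by simp
    moreover have "- (sg (h - l) * fps_X ^ nat (mac_exp K s t A B + jtp_exp (3 * K) (2 * K) (h - l))) = F l" for l
    proof -
      have "E l = mac_exp K s t A B + jtp_exp (3 * K) (2 * K) (h - l)"
      proof -
        have D: "c2 (A - l) + c2 (B - l) + c2 l = (A\<^sup>2 + B\<^sup>2 - A * B - A - B) div 3 + (3 * c2 (h - l) + 2 * (h - l))"
          using c2_triple_1[OF 1(1), of "l - h"] by simp
        show ?thesis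
          unfolding E D mac_exp_def jtp_exp_def by (simp add: algebra_simps)
      qed
      moreover have "sg (A + B + l) = - (sg (h - l) :: rat fps)"
        using 1(1) by (simp add: sg_def)
      ultimately show ?thesis
        by (simp add: F)
    qed
    moreover have "mac_term K s t (A, B) = - (fps_X ^ nat (mac_exp K s t A B))"
    proof -
      have "(A + B + 1) mod 3 = 2"
        using 1(2) by presburger
      then show ?thesis
        by (simp add: mac_term_def mac_chi_def)
    qed
    ultimately show ?thesis
      by simp
  next
    case 2
    have "finite {l \<in> UNIV. F l $ d \<noteq> 0}" for d
    proof (rule finite_subset)
      show "{l \<in> UNIV. F l $ d \<noteq> 0} \<subseteq> {- int d..int d}"
      proof
        fix l assume "l \<in> {l \<in> UNIV. F l $ d \<noteq> 0}"
        then have "nat (E l) = d"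
          by (auto simp: F sg_mult_nth fps_X_power_nth split: if_splits)
        then show "l \<in> {- int d..int d}"
          using E_ge[of l] by auto
      qed
    qed simp
    then obtain S where S: "fps_sums F UNIV S"
      by (rule fps_sums_exists)
    \<comment> \<open>This involution preserves the exponent and changes the parity of l, so the
      series equals its own negative.\<close>
    have "bij (\<lambda>l. 2 * h + 1 - l)"
      by (rule bij_betw_byWitness[of _ "\<lambda>l. 2 * h + 1 - l"]) auto
    from fps_sums_reindex[OF this S] have "fps_sums (\<lambda>l. F (2 * h + 1 - l)) UNIV S" .
    moreover have "F (2 * h + 1 - l) = F l * (- 1)" for l
    proof -
      have "E (2 * h + 1 - l) = E l"
        unfolding E c2_triple_2[OF 2(1)] ..
      moreover have "sg (A + B + (2 * h + 1 - l)) = - (sg (A + B + l) :: rat fps)"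
        by (auto simp: sg_def)
      ultimately show ?thesis
        by (simp add: F)
    qed
    ultimately have "fps_sums (\<lambda>l. F l * (- 1)) UNIV S"
      by simp
    from fps_sums_unique[OF this fps_sums_mult_right[OF S]] have "S = 0"
      by (simp add: fps_eq_iff)
    moreover have "mac_term K s t (A, B) = 0"
    proof -
      have "(A + B + 1) mod 3 = 0"
        using 2(2) by presburger
      then show ?thesis
        by (simp add: mac_term_def mac_chi_def)
    qed
    ultimately show ?thesis
      using S by simp
  qed
  then show ?thesis
    by (simp only: F_def[abs_def] P_def)
qed

text \<open>
  The coefficient of \<open>u\<^sup>A v\<^sup>B\<close> in the product of the three theta functions of \<open>u\<close>, \<open>v\<close> and \<open>u v\<close> is a
  monomial times the pentagonal number series, or zero.
\<close>

lemma macdonald_A2: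
  assumes "0 < s" "0 < t" "s + t < K"
  shows "fps_sums (mac_term K s t) UNIV ((qpoch_inf (fps_X ^ K) (fps_X ^ K))\<^sup>2 *
    (qtheta (fps_X ^ s) (fps_X ^ K) * qtheta (fps_X ^ t) (fps_X ^ K) * qtheta (fps_X ^ (s + t)) (fps_X ^ K)))"
proof -
  define P where "P = qpoch_inf (fps_X ^ K) (fps_X ^ K)"
  define \<Theta> where "\<Theta> = qtheta (fps_X ^ s) (fps_X ^ K) * qtheta (fps_X ^ t) (fps_X ^ K) * qtheta (fps_X ^ (s + t)) (fps_X ^ K)"
  have P: "P \<noteq> 0"
    using qpoch_inf_nth_0[of K K] assms by (auto simp: P_def)
  have prod: "fps_sums (\<lambda>((i, j), l). jtp_term K s i * jtp_term K t j * jtp_term K (s + t) l) ((UNIV \<times> UNIV) \<times> UNIV) (P ^ 3 * \<Theta>)"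
  proof -
    have "fps_sums (jtp_term K s) UNIV (P * qtheta (fps_X ^ s) (fps_X ^ K))"
      "fps_sums (jtp_term K t) UNIV (P * qtheta (fps_X ^ t) (fps_X ^ K))"
      "fps_sums (jtp_term K (s + t)) UNIV (P * qtheta (fps_X ^ (s + t)) (fps_X ^ K))"
      using jacobi_triple_product[of s K] jacobi_triple_product[of t K] jacobi_triple_product[of "s + t" K] assms
      unfolding P_def by simp_all
    from fps_sums_mult[OF fps_sums_mult[OF this(1,2)] this(3)] show ?thesis
      by (simp add: case_prod_unfold \<Theta>_def power3_eq_cube mult_ac)
  qed
  \<comment> \<open>Passes to A = i + l and B = j + l, the exponents of the formal variables u and
    v.\<close>
  have bij: "bij_betw (\<lambda>((A, B), l). ((A - l, B - l), l :: int)) ((UNIV \<times> UNIV) \<times> UNIV) ((UNIV \<times> UNIV) \<times> UNIV)"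
    by (rule bij_betw_byWitness[of _ "\<lambda>((i, j), l). ((i + l, j + l), l)"]) auto
  have triple: "fps_sums (\<lambda>((A, B), l). jtp_term K s (A - l) * jtp_term K t (B - l) * jtp_term K (s + t) l)
      ((UNIV \<times> UNIV) \<times> UNIV) (P ^ 3 * \<Theta>)"
    using fps_sums_reindex[OF bij prod] by (simp add: case_prod_unfold)
  have "fps_sums (\<lambda>z. mac_term K s t z * P) (UNIV \<times> UNIV) (P ^ 3 * \<Theta>)"
  proof (rule fps_sums_Sigma[OF triple])
    fix z :: "int \<times> int"
    show "fps_sums (\<lambda>l. (\<lambda>((A, B), l). jtp_term K s (A - l) * jtp_term K t (B - l) * jtp_term K (s + t) l) (z, l)) UNIV (mac_term K s t z * P)"
      using macdonald_inner[OF assms, of "fst z" "snd z"] by (simp add: case_prod_unfold P_def)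
  qed
  then have total: "fps_sums (\<lambda>z. mac_term K s t z * P) UNIV (P ^ 3 * \<Theta>)"
    unfolding UNIV_Times_UNIV .
  obtain S where S: "fps_sums (mac_term K s t) UNIV S"
    using fps_sums_exists[OF finite_mac_term[OF assms]] by blast
  \<comment> \<open>One factor P from the three triple products is used up by the pentagonal number
    series.\<close>
  have "S * P = P ^ 3 * \<Theta>"
    by (rule fps_sums_unique[OF fps_sums_mult_right[OF S] total])
  then have "S * P = (P\<^sup>2 * \<Theta>) * P"
    by (simp add: power3_eq_cube power2_eq_square mult_ac)
  then have "S = P\<^sup>2 * \<Theta>"
    using P by simp
  then show ?thesis
    using S by (simp add: P_def \<Theta>_def)
qed

subsection \<open>The limit of the finite identity\<close>

lemma LIMSEQ_unique_eq: "f \<longlonglongrightarrow> (a :: 'a :: t2_space) \<Longrightarrow> g \<longlonglongrightarrow> b \<Longrightarrow> (\<And>n. f n = g n) \<Longrightarrow> a = b"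
  using LIMSEQ_unique by (metis ext)

lemma qfac_eq_qfin: "qfac n = qfin 1 n"
proof -
  have "qpoch_inf fps_X fps_X = qfin 1 n * qpoch_inf (fps_X ^ Suc n) fps_X"
  proof (rule LIMSEQ_unique_eq)
    have "filterlim (\<lambda>m. n + m) sequentially sequentially"
      by (rule filterlim_sequentially_shift[of _ 0]) simp
    from qfin_shift_LIMSEQ[OF _ this, of 1] show "(\<lambda>m. qfin 1 (n + m)) \<longlonglongrightarrow> qpoch_inf fps_X fps_X"
      by simp
    have "(\<lambda>m. \<Prod>i<m. 1 - fps_X ^ Suc n * (fps_X ^ 1) ^ i) \<longlonglongrightarrow> qpoch_inf (fps_X ^ Suc n) (fps_X ^ 1)"
      by (rule qpoch_inf_LIMSEQ) simp_all
    then show "(\<lambda>m. qfin 1 n * (\<Prod>i<m. 1 - fps_X ^ Suc n * fps_X ^ i)) \<longlonglongrightarrow> qfin 1 n * qpoch_inf (fps_X ^ Suc n) fps_X"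
      by (intro tendsto_mult_fps tendsto_const) simp
    show "qfin 1 (n + m) = qfin 1 n * (\<Prod>i<m. 1 - fps_X ^ Suc n * fps_X ^ i)" for m
      by (induction m) (simp_all add: qfin_def power_add mult_ac)
  qed
  moreover have "qpoch_inf (fps_X ^ Suc n) fps_X $ 0 = 1"
    using qpoch_inf_nth_0[of "Suc n" 1] by simp
  then have "qpoch_inf (fps_X ^ Suc n) fps_X \<noteq> 0"
    by auto
  ultimately show ?thesis
    by (simp add: qpoch_def)
qed

definition rfac :: "int \<Rightarrow> rat fps" where
  "rfac j = (if j < 0 then 0 else inverse (qfin 1 (nat j)))"

lemma qfin_1_nth_0 [simp]: "qfin 1 n $ 0 = 1" "qfin (Suc 0) n $ 0 = 1"
  using qfin_nth_0[of 1 n] by simp_all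

lemma rfac_LIMSEQ: "(\<lambda>n. rfac (int n + j)) \<longlonglongrightarrow> inverse (qpoch_inf fps_X fps_X)"
proof (rule Lim_transform_eventually)
  have "filterlim (\<lambda>n. nat (int n + j)) sequentially sequentially"
    by (rule filterlim_sequentially_shift[of _ "nat \<bar>j\<bar>"]) simp
  from qfin_inverse_LIMSEQ[OF _ this, of 1]
  show "(\<lambda>n. inverse (qfin 1 (nat (int n + j)))) \<longlonglongrightarrow> inverse (qpoch_inf fps_X fps_X)"
    by simp
  show "eventually (\<lambda>n. inverse (qfin 1 (nat (int n + j))) = rfac (int n + j)) sequentially"
    by (rule eventually_sequentiallyI[of "nat \<bar>j\<bar>"]) (auto simp: rfac_def)
qed

interpretation fls: qfield "fls_X :: rat fls"
  using qfield_fls[of 1] by simp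

lemma fps_to_fls_qfin_1: "fps_to_fls (qfin 1 n) = fls.qp (int n)"
  using fps_to_fls_qfin[of 1 n] by simp

lemma fps_to_fls_rfac: "fps_to_fls (rfac j) = fls.ri j"
  using fps_to_fls_qfin_1[of "nat j"] by (simp add: rfac_def fls.ri_def fps_to_fls_inverse)

lemma fps_to_fls_qbinom: "fps_to_fls (qbinom n m) = fls.qb n m"
proof (cases "0 \<le> m \<and> m \<le> n")
  case True
  have "qbinom n m = qfin 1 (nat n) * (rfac m * rfac (n - m))"
    using True by (simp add: qbinom_def qfac_eq_qfin rfac_def fps_divide_unit fps_inverse_mult)
  then show ?thesis
    using fps_to_fls_qfin_1[of "nat n"] True
    by (simp add: fls.qb_def fls_times_fps_to_fls fps_to_fls_rfac mult.assoc)
next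
  case False
  then have "fls.qb n m = 0"
    by (intro fls.qb_eq_0) auto
  moreover have "qbinom n m = 0"
    unfolding qbinom_def using False by (rule if_not_P)
  ultimately show ?thesis
    by simp
qed

lemma fps_to_fls_summand:
  assumes "s \<ge> 1"
  shows "fps_to_fls (summand k s n m) = fls.gterm k s 1 n (m(k := 2 * n k))"
proof -
  have "fps_X ^ e / qfac j = fps_X ^ e * rfac (int j)" for e j
    by (simp add: qfac_eq_qfin rfac_def fps_divide_unit)
  moreover have "max s 1 = s"
    using assms by simp
  ultimately show ?thesis
    unfolding summand_def fls.gterm_def Let_def
    by (simp only: fls_times_fps_to_fls fps_to_fls_prod fps_to_fls_power fps_X_to_fls fps_to_fls_rfac fps_to_fls_qbinom)
qed

text \<open>Twice the exponent is n^2 + m^2 + (n - m)^2 + 2 m. With these bounds each power of q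
  meets only finitely many index families.\<close>

lemma qexponent_bounds: "n \<le> 2 * qexponent n m" "m \<le> 2 * qexponent n m"
proof -
  have sq: "int i \<le> (int i)\<^sup>2" for i
    by (cases i) (auto simp: power2_eq_square algebra_simps)
  have "2 * (int n * int m) \<le> (int n)\<^sup>2 + (int m)\<^sup>2"
    using zero_le_power2[of "int n - int m"] by (simp add: power2_diff)
  then have "int n \<le> 2 * (int n)\<^sup>2 - 2 * (int n * int m) + 2 * (int m)\<^sup>2 + 2 * int m"
    "int m \<le> 2 * (int n)\<^sup>2 - 2 * (int n * int m) + 2 * (int m)\<^sup>2 + 2 * int m"
    using sq[of n] sq[of m] by linarith+
  then have "int n \<le> 2 * int (qexponent n m)" "int m \<le> 2 * int (qexponent n m)"
    unfolding int_qexponent by (simp_all add: algebra_simps)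
  then show "n \<le> 2 * qexponent n m" "m \<le> 2 * qexponent n m"
    by linarith+
qed

lemma nth_eq_0_if_dvd: "fps_X ^ e dvd (f :: rat fps) \<Longrightarrow> d < e \<Longrightarrow> f $ d = 0"
  by (auto simp: fps_X_power_mult_nth elim!: dvdE)

definition index_set :: "nat \<Rightarrow> ((nat \<Rightarrow> nat) \<times> (nat \<Rightarrow> nat)) set" where
  "index_set k = ({1..k} \<rightarrow>\<^sub>E UNIV) \<times> ({1..k-1} \<rightarrow>\<^sub>E UNIV)"

definition index_box :: "nat \<Rightarrow> nat \<Rightarrow> ((nat \<Rightarrow> nat) \<times> (nat \<Rightarrow> nat)) set" where
  "index_box k N = ({1..k} \<rightarrow>\<^sub>E {..N}) \<times> ({1..k-1} \<rightarrow>\<^sub>E {..2 * N})"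

lemma finite_index_box: "finite (index_box k N)"
  by (simp add: index_box_def finite_PiE)

lemma index_box_subset: "index_box k N \<subseteq> index_set k"
  by (auto simp: index_box_def index_set_def PiE_def)

lemma finite_summand:
  assumes "k \<ge> 1"
  shows "finite {z \<in> index_set k. (case z of (n, m) \<Rightarrow> summand k s n m) $ d \<noteq> 0}"
proof (rule finite_subset[OF _ finite_index_box])
  show "{z \<in> index_set k. (case z of (n, m) \<Rightarrow> summand k s n m) $ d \<noteq> 0} \<subseteq> index_box k (2 * d)"
  proof clarify
    fix n m assume nm: "(n, m) \<in> index_set k" "summand k s n m $ d \<noteq> 0"
    define m' where "m' = m(k := 2 * n k)"
    have s: "summand k s n m = fps_X ^ ((n k)\<^sup>2 + (\<Sum>i=s..k. n i)) * inverse (qfac (n 1)) *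
        (\<Prod>i=1..k-1. fps_X ^ qexponent (n i) (m' i) * (qbinom (int (n i)) (int (n (i + 1))) *
           qbinom (int (n i) - int (n (i + 1)) + int (m' (i + 1))) (int (m' i))))"
      by (simp add: summand_def Let_def m'_def qfac_eq_qfin fps_divide_unit mult.assoc)
    have "fps_X ^ (n k)\<^sup>2 dvd summand k s n m"
      unfolding s power_add by (intro dvd_mult2 dvd_triv_left)
    then have "(n k)\<^sup>2 \<le> d"
      using nm(2) nth_eq_0_if_dvd not_le_imp_less by blast
    moreover have "n k \<le> (n k)\<^sup>2"
      by (simp add: power2_eq_square)
    ultimately have nk: "n k \<le> 2 * d"
      by linarith
    have i: "n i \<le> 2 * d \<and> m i \<le> 2 * d" if "i \<in> {1..k-1}" for i
    proof -
      define g where "g i = fps_X ^ qexponent (n i) (m' i) * (qbinom (int (n i)) (int (n (i + 1))) *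
           qbinom (int (n i) - int (n (i + 1)) + int (m' (i + 1))) (int (m' i)))" for i
      have "fps_X ^ qexponent (n i) (m' i) dvd g i"
        unfolding g_def by (rule dvd_triv_left)
      also have "g i dvd prod g {1..k-1}"
        using that by (intro dvd_prodI) auto
      also have "prod g {1..k-1} dvd summand k s n m"
        unfolding s g_def by (rule dvd_triv_right)
      finally have "fps_X ^ qexponent (n i) (m' i) dvd summand k s n m" .
      then have "qexponent (n i) (m' i) \<le> d"
        using nm(2) nth_eq_0_if_dvd not_le_imp_less by blast
      moreover have "m' i = m i"
        using that by (auto simp: m'_def)
      ultimately show ?thesis
        using qexponent_bounds[where n = "n i" and m = "m i"] by auto
    qed
    have "n i \<le> 2 * d" if "i \<in> {1..k}" for i
      using that nk i[of i] by (cases "i = k") auto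
    moreover have "m i \<le> 2 * (2 * d)" if "i \<in> {1..k-1}" for i
      using i[OF that] by simp
    ultimately show "(n, m) \<in> index_box k (2 * d)"
      using nm(1) by (auto simp: index_box_def index_set_def PiE_def Pi_def)
  qed
qed

text \<open>The finite identity behind the theorem: \<open>beta\<close> is the multisum cut off at
  N, with every summand weighted by factors that tend to a constant independent of the
  indices.\<close>

lemma fls_beta_eq:
  assumes "k \<ge> 1" "s \<ge> 1" "\<And>r. 1 \<le> r \<Longrightarrow> r < k \<Longrightarrow> \<epsilon> = (if s \<le> r then 1 else 0)" "\<epsilon> + d = (if s \<le> k then 1 else 0)"
  shows "fls.beta \<epsilon> d k N N = fps_to_fls (rfac (int N) * (\<Sum>(n, m)\<in>index_box k N. summand k s n m *
     (rfac (int N - int (n 1)) * rfac (int N + 1 - int (n 1) + int ((m(k := 2 * n k)) 1)))))"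
proof -
  define f where "f n j = fls.ri (int N - int n) * fls.ri (int N + 1 - int n + int j)" for n j :: nat
  have k: "k = Suc (k - 1)" "k - (k - 1) = 1"
    using assms(1) by simp_all
  have "fls.beta \<epsilon> d k N N = fls.beta \<epsilon> d (Suc (k - 1)) N N"
    using k(1) by simp
  also have "\<dots> = fls.ri (int N) * (\<Sum>n\<le>N. \<Sum>j\<le>2 * n. fls.ri (int N - int n) * fls.ri (int N + 1 - int n + int j) * fls.chain \<epsilon> (\<epsilon> + d) (k - 1) n j)"
    by (rule fls.beta_chain)
  also have "(\<Sum>n\<le>N. \<Sum>j\<le>2 * n. fls.ri (int N - int n) * fls.ri (int N + 1 - int n + int j) * fls.chain \<epsilon> (\<epsilon> + d) (k - 1) n j) =
     (\<Sum>n\<le>N. \<Sum>j\<le>2 * N. fls.chain \<epsilon> (\<epsilon> + d) (k - 1) n j * f n j)"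
    unfolding f_def by (intro sum.cong refl sum.mono_neutral_cong_left) (auto simp: fls.chain_eq_0 mult_ac)
  also have "\<dots> = (\<Sum>n\<in>{1..k} \<rightarrow>\<^sub>E {..N}. \<Sum>m\<in>{1..k - 1} \<rightarrow>\<^sub>E {..2 * N}.
      fls.gterm k s 1 n (m(k := 2 * n k)) * f (n 1) ((m(k := 2 * n k)) 1))"
    using fls.gterm_sum[where i = "k - 1" and k = k and \<epsilon> = \<epsilon> and s = s and e = "\<epsilon> + d" and N = N and f = f] assms unfolding k(2) by simp
  also have "\<dots> = (\<Sum>(n, m)\<in>index_box k N. fls.gterm k s 1 n (m(k := 2 * n k)) * f (n 1) ((m(k := 2 * n k)) 1))"
    unfolding index_box_def sum.cartesian_product ..
  finally show ?thesis
    unfolding fls_times_fps_to_fls fps_to_fls_sum fps_to_fls_rfac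
    by (simp add: case_prod_unfold fls_times_fps_to_fls fps_to_fls_summand[OF assms(2)] fps_to_fls_rfac f_def)
qed

section \<open>Letting the outer bounds tend to infinity\<close>

definition psif :: "nat \<Rightarrow> int \<Rightarrow> int \<Rightarrow> int \<Rightarrow> nat \<Rightarrow> rat fps" where
  "psif r x y z N = qfin 1 (2 * N + r) *
     (rfac (int N + (- x)) * rfac (int N + (- y)) * rfac (int N + (- z)) *
      rfac (int N + (int r + x)) * rfac (int N + (int r + y)) * rfac (int N + (int r + z)))"

lemma fps_to_fls_psif: "fps_to_fls (psif r x y z N) = fls.psi (int r) x y z (int N) (int N)"
  using fps_to_fls_qfin_1[of "2 * N + r"]
  by (simp add: psif_def fls.psi_def fls_times_fps_to_fls fps_to_fls_rfac add.assoc)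

lemma psif_LIMSEQ:
  defines "P \<equiv> qpoch_inf fps_X fps_X"
  shows "psif r x y z \<longlonglongrightarrow> P * inverse P ^ 6"
proof -
  have "filterlim (\<lambda>n. 2 * n + r) sequentially sequentially"
    by (rule filterlim_sequentially_shift[of _ 0]) simp
  from qfin_shift_LIMSEQ[OF _ this, of 1] have "(\<lambda>n. qfin 1 (2 * n + r)) \<longlonglongrightarrow> P"
    by (simp add: P_def)
  then have "psif r x y z \<longlonglongrightarrow> P * (inverse P * inverse P * inverse P * inverse P * inverse P * inverse P)"
    unfolding psif_def[abs_def] P_def by (intro tendsto_mult_fps rfac_LIMSEQ) simp
  then show ?thesis
    by (simp add: power_def numeral_eq_Suc mult.assoc)
qed

text \<open>The coordinates a = 1 - A, b = A - B, c = B - 1 send (A, B) = (0, 0) to (1, 0, -1), the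
  triple of weight 1. Moreover b - c is congruent to A + B + 1 modulo 3, so the two characters
  agree.\<close>

definition mac_box :: "nat \<Rightarrow> (int \<times> int) set" where
  "mac_box N = {(A, B). (1 - A, A - B, B - 1) \<in> zero_sum_box (8 * int N + 20)}"

lemma mac_box_bij: "bij_betw (\<lambda>(A, B). (1 - A, A - B, B - 1)) (mac_box N) (zero_sum_box (8 * int N + 20))"
  by (rule bij_betw_byWitness[of _ "\<lambda>(a, b, c). (1 - a, c + 1)"]) (auto simp: mac_box_def zero_sum_box_def)

lemma weight_mac_term:
  assumes "0 < s" "s + 1 < K"
    and "(A + B) mod 3 \<noteq> 2 \<Longrightarrow> mac_exp K s 1 A B = ((1 - A)\<^sup>2 + (A - B)\<^sup>2 + (B - 1)\<^sup>2 - 2) div 3 + l"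
  shows "fls.weight (1 - A) (A - B) (B - 1) * fls.qe l = fps_to_fls (mac_term K s 1 (A, B))"
proof -
  have "A - B - (B - 1) = (A + B + 1) + (- B) * 3"
    by simp
  then have "(A - B - (B - 1)) mod 3 = (A + B + 1) mod 3"
    by (simp only: mod_mult_self1)
  then have chi: "fls.chi (A - B - (B - 1)) = fps_to_fls (mac_chi (A + B + 1))"
    by (simp add: fls.chi_def mac_chi_def)
  show ?thesis
  proof (cases "(A + B) mod 3 = 2")
    case True
    then have "(A + B + 1) mod 3 = 0"
      by presburger
    then have "mac_chi (A + B + 1) = 0"
      by (simp add: mac_chi_def)
    then show ?thesis
      using chi by (simp add: fls.weight_def mac_term_def)
  next
    case False
    have "0 \<le> mac_exp K s 1 A B"
      using mac_exp_ge(1)[OF False assms(1) _ assms(2)] by simp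
    then have "fls.qe (mac_exp K s 1 A B) = fps_to_fls (fps_X ^ nat (mac_exp K s 1 A B))"
      unfolding fls.qe_def by (rule fls_X_powi_of_int)
    then show ?thesis
      unfolding fls.weight_def chi mult.assoc fls.qe_add[symmetric] assms(3)[OF False, symmetric] mac_term_def
      by (simp add: fls_times_fps_to_fls)
  qed
qed

text \<open>The limit argument common to the three values of \<open>s\<close>:
  \<open>expansion\<close> is the finite identity, and \<open>l\<close> says that weight and chain
  factor together give the Macdonald exponent in base 3 k + 2.\<close>

lemma summand_sums:
  assumes "k \<ge> 1" "s \<ge> 1" "s \<le> k + 1"
    and "\<And>r. 1 \<le> r \<Longrightarrow> r < k \<Longrightarrow> \<epsilon> = (if s \<le> r then 1 else 0)" "\<epsilon> + d = (if s \<le> k then 1 else 0)"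
    and expansion: "\<And>N. fls.beta \<epsilon> d k N N = (\<Sum>(a, b, c)\<in>zero_sum_box (8 * int N + 20). fls.weight a b c *
        fls.qe (l a b c) * fls.psi (int r) (a - x) (b - y) (c - y) (int N) (int N))"
    and l: "\<And>A B. (A + B) mod 3 \<noteq> 2 \<Longrightarrow>
        mac_exp (3 * k + 2) s 1 A B = ((1 - A)\<^sup>2 + (A - B)\<^sup>2 + (B - 1)\<^sup>2 - 2) div 3 + l (1 - A) (A - B) (B - 1)"
  shows "fps_sums (\<lambda>(n, m). summand k s n m) (index_set k)
     ((qpoch_inf (fps_X ^ (3 * k + 2)) (fps_X ^ (3 * k + 2)))\<^sup>2 / (qpoch_inf fps_X fps_X)\<^sup>2 *
      qthetas [fps_X, fps_X ^ s, fps_X ^ (s + 1)] (fps_X ^ (3 * k + 2)))"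
proof -
  define K where "K = 3 * k + 2"
  define P where "P = qpoch_inf fps_X fps_X"
  define T where "T = (qpoch_inf (fps_X ^ K) (fps_X ^ K))\<^sup>2 *
    (qtheta (fps_X ^ s) (fps_X ^ K) * qtheta (fps_X ^ 1) (fps_X ^ K) * qtheta (fps_X ^ (s + 1)) (fps_X ^ K))"
  have K: "0 < s" "s + 1 < K"
    using assms by (simp_all add: K_def)
  have P0: "P $ 0 = 1"
    unfolding P_def using qpoch_inf_nth_0[of 1 1] by simp
  then have P1: "P * inverse P = 1"
    using inverse_mult_eq_1'[of P] by simp
  obtain S where S: "fps_sums (\<lambda>(n, m). summand k s n m) (index_set k) S"
    using fps_sums_exists[OF finite_summand[OF assms(1)]] by blast
  have T: "fps_sums (mac_term K s 1) UNIV T"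
    unfolding T_def using macdonald_A2[of s 1 K] K by simp
  define L where "L N = rfac (int N) * (\<Sum>z\<in>index_box k N. (case z of (n, m) \<Rightarrow> summand k s n m) * (case z of (n, m) \<Rightarrow>
     rfac (int N - int (n 1)) * rfac (int N + 1 - int (n 1) + int ((m(k := 2 * n k)) 1))))" for N
  have lhs: "L \<longlonglongrightarrow> inverse P * (S * (inverse P * inverse P))"
    unfolding L_def[abs_def]
  proof (intro tendsto_mult_fps tannery_fps[OF S])
    show "(\<lambda>N. rfac (int N)) \<longlonglongrightarrow> inverse P"
      using rfac_LIMSEQ[of 0] by (simp add: P_def)
    fix z assume z: "z \<in> index_set k"
    obtain n m where [simp]: "z = (n, m)"
      by (cases z)
    show "(\<lambda>N. case z of (n, m) \<Rightarrow> rfac (int N - int (n 1)) * rfac (int N + 1 - int (n 1) + int ((m(k := 2 * n k)) 1))) \<longlonglongrightarrow> inverse P * inverse P"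
      using tendsto_mult_fps[OF rfac_LIMSEQ[of "- int (n 1)"] rfac_LIMSEQ[of "1 - int (n 1) + int ((m(k := 2 * n k)) 1)"]]
      by (simp add: P_def algebra_simps)
    have "eventually (\<lambda>N. (\<forall>i\<in>{1..k}. n i \<le> N) \<and> (\<forall>i\<in>{1..k-1}. m i \<le> N)) sequentially"
      by (intro eventually_conj eventually_ball_finite ballI eventually_ge_at_top) auto
    then show "eventually (\<lambda>N. z \<in> index_box k N) sequentially"
    proof eventually_elim
      case (elim N)
      then have "\<forall>i\<in>{1..k-1}. m i \<le> 2 * N"
        by fastforce
      then show ?case
        using z elim by (auto simp: index_box_def index_set_def PiE_def Pi_def)
    qed
  qed (auto simp: finite_index_box index_box_subset)
  have rhs: "(\<lambda>N. \<Sum>z\<in>mac_box N. mac_term K s 1 z * (case z of (A, B) \<Rightarrow> psif r (1 - A - x) (A - B - y) (B - 1 - y) N)) \<longlonglongrightarrow> T * (P * inverse P ^ 6)"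
  proof (rule tannery_fps[OF T])
    fix z :: "int \<times> int"
    obtain A B where [simp]: "z = (A, B)"
      by (cases z)
    show "(\<lambda>N. case z of (A, B) \<Rightarrow> psif r (1 - A - x) (A - B - y) (B - 1 - y) N) \<longlonglongrightarrow> P * inverse P ^ 6"
      unfolding P_def using psif_LIMSEQ by simp
    show "eventually (\<lambda>N. z \<in> mac_box N) sequentially"
      by (rule eventually_sequentiallyI[of "nat (\<bar>A\<bar> + \<bar>B\<bar>)"]) (auto simp: mac_box_def zero_sum_box_def)
  next
    fix N
    show "finite (mac_box N)"
      using bij_betw_finite[OF mac_box_bij, of N] by simp
  qed auto
  have "L N = (\<Sum>z\<in>mac_box N. mac_term K s 1 z * (case z of (A, B) \<Rightarrow> psif r (1 - A - x) (A - B - y) (B - 1 - y) N))" for N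
  proof -
    have "fps_to_fls (L N) = fls.beta \<epsilon> d k N N"
      using fls_beta_eq[OF assms(1,2,4,5), of N] by (simp only: L_def case_prod_unfold)
    also have "\<dots> = (\<Sum>(A, B)\<in>mac_box N. fls.weight (1 - A) (A - B) (B - 1) *
        fls.qe (l (1 - A) (A - B) (B - 1)) * fls.psi (int r) (1 - A - x) (A - B - y) (B - 1 - y) (int N) (int N))"
      unfolding expansion by (subst sum.reindex_bij_betw[OF mac_box_bij, symmetric]) (simp add: case_prod_unfold)
    also have "\<dots> = fps_to_fls (\<Sum>z\<in>mac_box N. mac_term K s 1 z * (case z of (A, B) \<Rightarrow> psif r (1 - A - x) (A - B - y) (B - 1 - y) N))"
      unfolding fps_to_fls_sum
    proof (intro sum.cong refl, clarify)
      fix A B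
      have "fls.weight (1 - A) (A - B) (B - 1) * fls.qe (l (1 - A) (A - B) (B - 1)) = fps_to_fls (mac_term K s 1 (A, B))"
        by (rule weight_mac_term[OF K]) (use l in \<open>simp add: K_def\<close>)
      then show "fls.weight (1 - A) (A - B) (B - 1) * fls.qe (l (1 - A) (A - B) (B - 1)) *
           fls.psi (int r) (1 - A - x) (A - B - y) (B - 1 - y) (int N) (int N) =
         fps_to_fls (mac_term K s 1 (A, B) * psif r (1 - A - x) (A - B - y) (B - 1 - y) N)"
        by (simp add: fls_times_fps_to_fls fps_to_fls_psif)
    qed
    finally show ?thesis
      by (simp only: fps_to_fls_eq_iff)
  qed
  \<comment> \<open>The limits are S / P^3 and T / P^5; each kernel contributes one P in the
    numerator and six in the denominator.\<close>
  from LIMSEQ_unique_eq[OF lhs rhs this]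
  have "inverse P * (S * (inverse P * inverse P)) * P ^ 3 = T * (P * inverse P ^ 6) * P ^ 3"
    by simp
  moreover have "inverse P * (S * (inverse P * inverse P)) * P ^ 3 = S * (P * inverse P) ^ 3"
    by (simp add: power3_eq_cube mult_ac)
  moreover have "T * (P * inverse P ^ 6) * P ^ 3 = T * inverse P ^ 2 * (P * inverse P) ^ 4"
    by (simp add: power_def numeral_eq_Suc mult_ac)
  ultimately have "S = T * inverse P ^ 2"
    using P1 by simp
  also have "\<dots> = (qpoch_inf (fps_X ^ K) (fps_X ^ K))\<^sup>2 / P\<^sup>2 * qthetas [fps_X, fps_X ^ s, fps_X ^ (s + 1)] (fps_X ^ K)"
  proof -
    have "P\<^sup>2 $ 0 \<noteq> 0"
      using P0 by (simp add: power2_eq_square)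
    then show ?thesis
      by (simp add: T_def qthetas_def fps_divide_unit fps_inverse_power mult_ac)
  qed
  finally show ?thesis
    using S by (simp add: K_def P_def)
qed

theorem theorem2p2:
  fixes k s :: nat
  assumes "k \<ge> 1" and "s \<in> {1, k, k + 1}"
  shows "((\<lambda>(n, m). summand k s n m) has_sum
           (qpoch_inf (fps_X ^ (3 * k + 2)) (fps_X ^ (3 * k + 2)))\<^sup>2 / (qpoch_inf fps_X fps_X)\<^sup>2 *
           qthetas [fps_X, fps_X ^ s, fps_X ^ (s + 1)] (fps_X ^ (3 * k + 2)))
         (({1..k} \<rightarrow>\<^sub>E UNIV) \<times> ({1..k-1} \<rightarrow>\<^sub>E UNIV))"
proof -
  define Q where "Q A B = (A\<^sup>2 + B\<^sup>2 - A * B - A - B) div 3" for A B :: int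
  have Q: "A\<^sup>2 + B\<^sup>2 - A * B - A - B = 3 * Q A B" if "(A + B) mod 3 \<noteq> 2" for A B
  proof -
    have "3 dvd A + B \<or> 3 dvd A + B - 1"
      using that by presburger
    then have "3 dvd (A + B) * (A + B - 1)"
      by (auto intro: dvd_mult dvd_mult2)
    then have "3 dvd (A + B) * (A + B - 1) - 3 * (A * B)"
      by (rule dvd_diff) simp
    also have "(A + B) * (A + B - 1) - 3 * (A * B) = A\<^sup>2 + B\<^sup>2 - A * B - A - B"
      by (simp add: power2_eq_square algebra_simps)
    finally show ?thesis
      by (simp add: Q_def)
  qed
  have norm: "((1 - A)\<^sup>2 + (A - B)\<^sup>2 + (B - 1)\<^sup>2 - 2) div 3 = 2 * Q A B" if "(A + B) mod 3 \<noteq> 2" for A B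
  proof -
    have "(1 - A)\<^sup>2 + (A - B)\<^sup>2 + (B - 1)\<^sup>2 - 2 = 2 * (A\<^sup>2 + B\<^sup>2 - A * B - A - B)"
      by (simp add: power2_eq_square algebra_simps)
    then show ?thesis
      unfolding Q[OF that] by simp
  qed
  have e2: "- 1 - ((1 - A) * (A - B) + (1 - A) * (B - 1) + (A - B) * (B - 1)) = 3 * Q A B" if "(A + B) mod 3 \<noteq> 2" for A B
    unfolding Q[OF that, symmetric] by (simp add: power2_eq_square algebra_simps)
  have bound: "4 * (int N + int N) + 20 \<le> 8 * int N + 20" for N
    by simp
  have "fps_sums (\<lambda>(n, m). summand k s n m) (index_set k)
     ((qpoch_inf (fps_X ^ (3 * k + 2)) (fps_X ^ (3 * k + 2)))\<^sup>2 / (qpoch_inf fps_X fps_X)\<^sup>2 *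
      qthetas [fps_X, fps_X ^ s, fps_X ^ (s + 1)] (fps_X ^ (3 * k + 2)))"
  proof (cases "s = 1")
    case True
    show ?thesis
    proof (rule summand_sums[where \<epsilon> = 1 and d = 0 and r = 2 and x = 1 and y = 1])
      fix N
      show "fls.beta 1 0 k N N = (\<Sum>(a, b, c)\<in>zero_sum_box (8 * int N + 20). fls.weight a b c *
        fls.qe (c - a + 2 + int k * (- 1 - (a * b + a * c + b * c))) * fls.psi (int 2) (a - 1) (b - 1) (c - 1) (int N) (int N))"
        using fls.beta_expansion1[OF bound[of N]] by simp
    next
      fix A B :: int assume AB: "(A + B) mod 3 \<noteq> 2"
      show "mac_exp (3 * k + 2) s 1 A B = ((1 - A)\<^sup>2 + (A - B)\<^sup>2 + (B - 1)\<^sup>2 - 2) div 3 +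
         (B - 1 - (1 - A) + 2 + int k * (- 1 - ((1 - A) * (A - B) + (1 - A) * (B - 1) + (A - B) * (B - 1))))"
        \<comment> \<open>The linear part is A + B; for \<open>s = 1\<close> the steps add only
          multiples of \<open>Q\<close>.\<close>
        unfolding norm[OF AB] e2[OF AB] mac_exp_def Q_def[symmetric] using True by (simp add: algebra_simps)
    qed (use assms True in auto)
  next
    case False
    have e2': "- (1 - A) - ((1 - A) * (A - B) + (1 - A) * (B - 1) + (A - B) * (B - 1)) = A + 3 * Q A B" if "(A + B) mod 3 \<noteq> 2" for A B
      using e2[OF that] by simp
    show ?thesis
    proof (cases "s = k + 1")
      case True
      show ?thesis
      proof (rule summand_sums[where \<epsilon> = 0 and d = 0 and r = 1 and x = 1 and y = 0])
        fix N
        show "fls.beta 0 0 k N N = (\<Sum>(a, b, c)\<in>zero_sum_box (8 * int N + 20). fls.weight a b c *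
          fls.qe (c - a + 2 + int k * (- a - (a * b + a * c + b * c))) * fls.psi (int 1) (a - 1) (b - 0) (c - 0) (int N) (int N))"
          using fls.beta_expansion2[OF bound[of N]] by simp
      next
        fix A B :: int assume AB: "(A + B) mod 3 \<noteq> 2"
        show "mac_exp (3 * k + 2) s 1 A B = ((1 - A)\<^sup>2 + (A - B)\<^sup>2 + (B - 1)\<^sup>2 - 2) div 3 +
           (B - 1 - (1 - A) + 2 + int k * (- (1 - A) - ((1 - A) * (A - B) + (1 - A) * (B - 1) + (A - B) * (B - 1))))"
          \<comment> \<open>The starting point has linear part A + B, and each of the k steps adds
            A.\<close>
          unfolding norm[OF AB] e2'[OF AB] mac_exp_def Q_def[symmetric] using True by (simp add: algebra_simps)
      qed (use assms True in auto)
    next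
      case neq: False
      then have s: "s = k"
        using assms False by auto
      show ?thesis
      proof (rule summand_sums[where \<epsilon> = 0 and d = 1 and r = 1 and x = 1 and y = 0])
        fix N
        show "fls.beta 0 1 k N N = (\<Sum>(a, b, c)\<in>zero_sum_box (8 * int N + 20). fls.weight a b c *
          fls.qe (c + 1 + int k * (- a - (a * b + a * c + b * c))) * fls.psi (int 1) (a - 1) (b - 0) (c - 0) (int N) (int N))"
          using fls.beta_expansion3[OF bound[of N]] by simp
      next
        fix A B :: int assume AB: "(A + B) mod 3 \<noteq> 2"
        show "mac_exp (3 * k + 2) s 1 A B = ((1 - A)\<^sup>2 + (A - B)\<^sup>2 + (B - 1)\<^sup>2 - 2) div 3 +
           (B - 1 + 1 + int k * (- (1 - A) - ((1 - A) * (A - B) + (1 - A) * (B - 1) + (A - B) * (B - 1))))"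
          \<comment> \<open>The starting point with \<open>d = 1\<close> has linear part B, and the
            k steps add k A.\<close>
          unfolding norm[OF AB] e2'[OF AB] mac_exp_def Q_def[symmetric] using s by (simp add: algebra_simps)
      qed (use assms s in auto)
    qed
  qed
  then show ?thesis
    unfolding index_set_def by (rule fps_sums_imp_has_sum)
qed

end
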